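(* Let $M$ be a bounded, connected, embedded complex submanifold of $\mathbb{C}^d$. Let $S\subset M$ be a geodesic subspace of $M$ such that $(S,\mathsf{k}_M|_{S\times S})$ is Gromov hyperbolic. Then $S$ is a visibility subspace of $M$ if and only if the identity map $\mathsf{id}_S:S\to S$ extends to a continuous surjective map $\widehat{\mathsf{id}}_S:\overline{S}^G\to\overline{S}$, where $\overline{S}^G$ denotes the Gromov compactification of $S$ with respect to $\mathsf{k}_M|_{S\times S}$. Moreover, this extended map is a homeomorphism if and only if $S$ has no geodesic loops in $\overline{S}$.
   Context: $\mathsf{k}_M$ is the Kobayashi distance of $M$. $\overline S$ denotes the closure of $S$ in $\mathbb{C}^d$ and $\partial_a S:=\overline S\setminus S$. A $\mathsf{k}_M$-geodesic is a map $\sigma:I\to M$, $I\subset\mathbb{R}$ an interval, with $\mathsf{k}_M(\sigma(s),\sigma(t))=|s-t|$ for all $s,t\in I$. A subset $S$ of $M$ is a geodesic subspace if (i) $(S,\mathsf{k}_M|_{S\times S})$ is Cauchy-complete, and (ii) for any two distinct points of $S$ there exists a geodesic of $(M,\mathsf{k}_M)$ that passes through those points and is contained in $S$. (Such a space $(S,\mathsf{k}_M|_{S\times S})$ is a proper geodesic distance space.) A geodesic subspace $S$ is a visibility subspace of $M$ if for any $p\neq q$ in $\partial_a S$ there exist $\mathbb{C}^d$-neighbourhoods $U$ of $p$ and $V$ of $q$ with $\overline U\cap\overline V=\emptyset$ and a compact subset $K$ of $S$ such that, for every $\mathsf{k}_M$-geodesic $\gamma$ in $S$ with initial point in $U\cap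 S$ and terminal point in $V\cap S$, the image of $\gamma$ meets $K$. A geodesic loop of $S$ in $\overline S$ is a geodesic line $\gamma$ in $(S,\mathsf{k}_M|_{S\times S})$ (an isometric embedding of $(\mathbb{R},|\cdot|)$) such that the set of limit points in $\overline S$ of $\gamma(t)$ as $t\to\infty$ equals the set of limit points in $\overline S$ of $\gamma(t)$ as $t\to-\infty$. For a proper geodesic Gromov hyperbolic distance space $(X,d)$, the Gromov compactification is $\overline X^G=X\sqcup\partial_GX$, where $\partial_G X$ is the set of geodesic rays modulo the relation of being at bounded distance from each other, with the standard topology, described as follows: fixing a basepoint $o$ and calling "generalized ray" a geodesic ray from $o$, or a geodesic segment from $o$ continued as a constant at its endpoint (with $c(\infty)$ denoting the class of $c$ in $\partial_GX$ in the first case and the endpoint of the segment in the second), $x_n\to x$ in $\overline X^G$ iff there exist generalized rays $c_n$ from $o$ with $c_n(\infty)=x_n$ such that every subsequence of $(c_n)$ has a further subsequence converging uniformly on compact sets to a generalized ray $c$ with $c(\infty)=x$. It is a compact Hausdorff space containing $X$ as an open dense subset. *)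

theory Defs
  imports "HOL-Complex_Analysis.Complex_Analysis"
begin

section \<open>Embedded complex submanifolds and the Kobayashi distance\<close>

text \<open>Holomorphic maps between open subsets of \<open>\<complex>\<^sup>n\<close> and \<open>\<complex>\<^sup>m\<close>: real
  Frechet differentiable with complex linear derivative.\<close>

definition holomorphic_map_on ::
    "(complex ^ 'n) set \<Rightarrow> (complex ^ 'n \<Rightarrow> complex ^ 'm) \<Rightarrow> bool" where
  "holomorphic_map_on U \<Phi> \<longleftrightarrow>
     (\<forall>x\<in>U. \<exists>D. (\<Phi> has_derivative D) (at x) \<and> (\<forall>c v. D (c *s v) = c *s D v))"

definition biholomorphic_between ::
    "(complex ^ 'n) set \<Rightarrow> (complex ^ 'n) set \<Rightarrow> (complex ^ 'n \<Rightarrow> complex ^ 'n) \<Rightarrow> bool" where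
  "biholomorphic_between U V \<Phi> \<longleftrightarrow>
     open U \<and> open V \<and> bij_betw \<Phi> U V \<and>
     holomorphic_map_on U \<Phi> \<and> holomorphic_map_on V (the_inv_into U \<Phi>)"

text \<open>Submanifold charts: near each of its points, \<open>M\<close> is straightened by a biholomorphism of
  the ambient space to a coordinate subspace, all of whose dimensions are equal. \<open>M\<close> need not be
  closed; its manifold topology is the subspace topology.\<close>

definition embedded_complex_submanifold :: "(complex ^ 'd) set \<Rightarrow> bool" where
  "embedded_complex_submanifold M \<longleftrightarrow>
     (\<exists>n. \<forall>p\<in>M. \<exists>U V \<Phi> J.
        p \<in> U \<and> biholomorphic_between U V \<Phi> \<and> card (J :: 'd set) = n \<and>
        \<Phi> ` (M \<inter> U) = {w \<in> V. \<forall>i. i \<notin> J \<longrightarrow> w $ i = 0})"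

text \<open>As \<open>M\<close> is embedded, a map into \<open>M\<close> is holomorphic iff it is holomorphic
  as a map into \<open>\<complex>\<^sup>d\<close>.\<close>

definition holomorphic_disc :: "(complex ^ 'd) set \<Rightarrow> (complex \<Rightarrow> complex ^ 'd) \<Rightarrow> bool" where
  "holomorphic_disc M f \<longleftrightarrow>
     (\<forall>i. (\<lambda>z. f z $ i) holomorphic_on ball 0 1) \<and> f ` ball 0 1 \<subseteq> M"

text \<open>Normalised so that the infinitesimal metric is \<open>|dz| / (1 - |z|\<^sup>2)\<close>.\<close>

definition poincare_dist :: "complex \<Rightarrow> complex \<Rightarrow> real" where
  "poincare_dist z w = artanh (cmod ((z - w) / (1 - cnj z * w)))"

text \<open>Infimum over chains of holomorphic discs. The value off \<open>M \<times> M\<close> is a dummy, chosen so that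
  the library's locale \<open>Metric_space\<close>, which asks for symmetry and nonnegativity on the whole
  type, can be applied.\<close>

definition kobayashi_dist :: "(complex ^ 'd) set \<Rightarrow> complex ^ 'd \<Rightarrow> complex ^ 'd \<Rightarrow> real" where
  "kobayashi_dist M x y =
     (if x \<in> M \<and> y \<in> M then
        Inf {\<Sum>k<n. poincare_dist (a k) (b k) | (n::nat) f a b.
               0 < n \<and>
               (\<forall>k<n. holomorphic_disc M (f k) \<and> a k \<in> ball 0 1 \<and> b k \<in> ball 0 1) \<and>
               f 0 (a 0) = x \<and>
               (\<forall>k. Suc k < n \<longrightarrow> f k (b k) = f (Suc k) (a (Suc k))) \<and>
               f (n - 1) (b (n - 1)) = y}
      else 0)"


section \<open>Geodesics and Gromov hyperbolicity\<close>

text \<open>Throughout, \<open>(X, d)\<close> is a distance space with carrier \<open>X\<close>. Values of \<open>\<sigma>\<close> outside \<open>I\<close> are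
  irrelevant.\<close>

definition geodesic_on ::
    "'a set \<Rightarrow> ('a \<Rightarrow> 'a \<Rightarrow> real) \<Rightarrow> real set \<Rightarrow> (real \<Rightarrow> 'a) \<Rightarrow> bool" where
  "geodesic_on X d I \<sigma> \<longleftrightarrow>
     is_interval I \<and> \<sigma> ` I \<subseteq> X \<and> (\<forall>s\<in>I. \<forall>t\<in>I. d (\<sigma> s) (\<sigma> t) = \<bar>s - t\<bar>)"

definition gromov_product :: "('a \<Rightarrow> 'a \<Rightarrow> real) \<Rightarrow> 'a \<Rightarrow> 'a \<Rightarrow> 'a \<Rightarrow> real" where
  "gromov_product d w x y = (d w x + d w y - d x y) / 2"

definition gromov_hyperbolic :: "'a set \<Rightarrow> ('a \<Rightarrow> 'a \<Rightarrow> real) \<Rightarrow> bool" where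
  "gromov_hyperbolic X d \<longleftrightarrow>
     (\<exists>\<delta>\<ge>0. \<forall>w\<in>X. \<forall>x\<in>X. \<forall>y\<in>X. \<forall>z\<in>X.
        gromov_product d w x z \<ge> min (gromov_product d w x y) (gromov_product d w y z) - \<delta>)"


section \<open>The Gromov compactification\<close>

definition geodesic_rays :: "'a set \<Rightarrow> ('a \<Rightarrow> 'a \<Rightarrow> real) \<Rightarrow> (real \<Rightarrow> 'a) set" where
  "geodesic_rays X d = {c. geodesic_on X d {0..} c}"

definition asymptotic_rel ::
    "'a set \<Rightarrow> ('a \<Rightarrow> 'a \<Rightarrow> real) \<Rightarrow> ((real \<Rightarrow> 'a) \<times> (real \<Rightarrow> 'a)) set" where
  "asymptotic_rel X d =
     {(c, c'). c \<in> geodesic_rays X d \<and> c' \<in> geodesic_rays X d \<and>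
               (\<exists>B. \<forall>t\<ge>0. d (c t) (c' t) \<le> B)}"

definition gromov_boundary :: "'a set \<Rightarrow> ('a \<Rightarrow> 'a \<Rightarrow> real) \<Rightarrow> (real \<Rightarrow> 'a) set set" where
  "gromov_boundary X d = geodesic_rays X d // asymptotic_rel X d"

definition gromov_bar :: "'a set \<Rightarrow> ('a \<Rightarrow> 'a \<Rightarrow> real) \<Rightarrow> ('a + (real \<Rightarrow> 'a) set) set" where
  "gromov_bar X d = X <+> gromov_boundary X d"

text \<open>\<open>generalized_ray X d b c x\<close>: \<open>c\<close> is a generalized ray from \<open>b\<close> with \<open>c(\<infinity>) = x\<close>.\<close>

definition generalized_ray ::
    "'a set \<Rightarrow> ('a \<Rightarrow> 'a \<Rightarrow> real) \<Rightarrow> 'a \<Rightarrow> (real \<Rightarrow> 'a) \<Rightarrow> 'a + (real \<Rightarrow> 'a) set \<Rightarrow> bool" where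
  "generalized_ray X d b c x \<longleftrightarrow>
     c 0 = b \<and>
     ((c \<in> geodesic_rays X d \<and> x = Inr (asymptotic_rel X d `` {c})) \<or>
      (\<exists>L\<ge>0. geodesic_on X d {0..L} c \<and> (\<forall>t\<ge>L. c t = c L) \<and> x = Inl (c L)))"

definition converges_on_compacts ::
    "('a \<Rightarrow> 'a \<Rightarrow> real) \<Rightarrow> (nat \<Rightarrow> real \<Rightarrow> 'a) \<Rightarrow> (real \<Rightarrow> 'a) \<Rightarrow> bool" where
  "converges_on_compacts d c c' \<longleftrightarrow>
     (\<forall>C. compact C \<longrightarrow> C \<subseteq> {0..} \<longrightarrow>
        (\<forall>e>0. \<forall>\<^sub>F n in sequentially. \<forall>t\<in>C. d (c n t) (c' t) < e))"

definition gromov_converges ::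
    "'a set \<Rightarrow> ('a \<Rightarrow> 'a \<Rightarrow> real) \<Rightarrow> 'a \<Rightarrow>
     (nat \<Rightarrow> 'a + (real \<Rightarrow> 'a) set) \<Rightarrow> 'a + (real \<Rightarrow> 'a) set \<Rightarrow> bool" where
  "gromov_converges X d b s x \<longleftrightarrow>
     (\<exists>c. (\<forall>n. generalized_ray X d b (c n) (s n)) \<and>
          (\<forall>r::nat \<Rightarrow> nat. strict_mono r \<longrightarrow>
             (\<exists>(r'::nat \<Rightarrow> nat) c'. strict_mono r' \<and> generalized_ray X d b c' x \<and>
                converges_on_compacts d (c \<circ> r \<circ> r') c')))"

text \<open>The topology determined by this convergence: the closed sets are the sequentially closed
  ones.\<close>

definition gromov_open ::
    "'a set \<Rightarrow> ('a \<Rightarrow> 'a \<Rightarrow> real) \<Rightarrow> 'a \<Rightarrow> ('a + (real \<Rightarrow> 'a) set) set \<Rightarrow> bool" where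
  "gromov_open X d b U \<longleftrightarrow>
     U \<subseteq> gromov_bar X d \<and>
     (\<forall>s x. (\<forall>n. s n \<in> gromov_bar X d - U) \<longrightarrow> gromov_converges X d b s x \<longrightarrow> x \<notin> U)"

definition gromov_topology ::
    "'a set \<Rightarrow> ('a \<Rightarrow> 'a \<Rightarrow> real) \<Rightarrow> 'a \<Rightarrow> ('a + (real \<Rightarrow> 'a) set) topology" where
  "gromov_topology X d b = topology (gromov_open X d b)"

lemma gromov_converges_subseq:
  assumes "gromov_converges X d b s x" "strict_mono (q::nat \<Rightarrow> nat)"
  shows "gromov_converges X d b (s \<circ> q) x"
proof -
  obtain c where c: "\<forall>n. generalized_ray X d b (c n) (s n)"
    and sub: "\<And>r::nat \<Rightarrow> nat. strict_mono r \<Longrightarrow>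
             (\<exists>(r'::nat \<Rightarrow> nat) c'. strict_mono r' \<and> generalized_ray X d b c' x \<and>
                converges_on_compacts d (c \<circ> r \<circ> r') c')"
    using assms(1) unfolding gromov_converges_def by blast
  show ?thesis
    unfolding gromov_converges_def
  proof (intro exI[of _ "c \<circ> q"] conjI allI impI)
    fix n show "generalized_ray X d b ((c \<circ> q) n) ((s \<circ> q) n)" using c by simp
  next
    fix r :: "nat \<Rightarrow> nat" assume "strict_mono r"
    show "\<exists>(r'::nat \<Rightarrow> nat) c'. strict_mono r' \<and> generalized_ray X d b c' x \<and>
                converges_on_compacts d (c \<circ> q \<circ> r \<circ> r') c'"
      using sub[OF strict_mono_o[OF assms(2) \<open>strict_mono r\<close>]] unfolding o_assoc .
  qed
qed

lemma istopology_gromov_open: "istopology (gromov_open X d b)"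
  unfolding istopology_def
proof (intro conjI allI impI)
  fix U V assume U: "gromov_open X d b U" and V: "gromov_open X d b V"
  show "gromov_open X d b (U \<inter> V)"
    unfolding gromov_open_def
  proof (intro conjI allI impI)
    show "U \<inter> V \<subseteq> gromov_bar X d" using U unfolding gromov_open_def by blast
  next
    fix s x
    assume s: "\<forall>n. s n \<in> gromov_bar X d - U \<inter> V" and x: "gromov_converges X d b s x"
    have key: "x \<notin> W" if W: "gromov_open X d b W" and inf: "infinite {n. s n \<notin> W}" for W
    proof -
      let ?q = "enumerate {n. s n \<notin> W}"
      have "strict_mono ?q" using inf by (rule strict_mono_enumerate)
      then have "gromov_converges X d b (s \<circ> ?q) x" using x by (rule gromov_converges_subseq[rotated])
      moreover have "\<forall>n. (s \<circ> ?q) n \<in> gromov_bar X d - W"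
        using s enumerate_in_set[OF inf] by auto
      ultimately show ?thesis using W unfolding gromov_open_def by blast
    qed
    have "{n. s n \<notin> U} \<union> {n. s n \<notin> V} = UNIV" using s by auto
    then have "infinite {n. s n \<notin> U} \<or> infinite {n. s n \<notin> V}"
      by (metis finite_UnI infinite_UNIV_nat)
    then show "x \<notin> U \<inter> V" using key[OF U] key[OF V] by auto
  qed
next
  fix \<U> assume \<U>: "\<forall>U\<in>\<U>. gromov_open X d b U"
  show "gromov_open X d b (\<Union>\<U>)"
    unfolding gromov_open_def
  proof (intro conjI allI impI)
    show "\<Union>\<U> \<subseteq> gromov_bar X d" using \<U> unfolding gromov_open_def by blast
  next
    fix s x
    assume "\<forall>n. s n \<in> gromov_bar X d - \<Union>\<U>" "gromov_converges X d b s x"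
    then show "x \<notin> \<Union>\<U>" using \<U> unfolding gromov_open_def by blast
  qed
qed

lemma openin_gromov_topology: "openin (gromov_topology X d b) U \<longleftrightarrow> gromov_open X d b U"
  unfolding gromov_topology_def by (simp add: istopology_gromov_open)

lemma generalized_ray_in_gromov_bar:
  assumes "generalized_ray X d b c x"
  shows "x \<in> gromov_bar X d"
  using assms unfolding generalized_ray_def
proof (elim conjE disjE exE)
  assume "c \<in> geodesic_rays X d" and x: "x = Inr (asymptotic_rel X d `` {c})"
  then have "asymptotic_rel X d `` {c} \<in> gromov_boundary X d"
    unfolding gromov_boundary_def by (intro quotientI)
  then show ?thesis unfolding x gromov_bar_def by (rule InrI)
next
  fix L :: real assume "0 \<le> L" "geodesic_on X d {0..L} c" and x: "x = Inl (c L)"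
  then have "c L \<in> X" unfolding geodesic_on_def by auto
  then show ?thesis unfolding x gromov_bar_def by (rule InlI)
qed

lemma topspace_gromov_topology: "topspace (gromov_topology X d b) = gromov_bar X d"
proof -
  have "gromov_open X d b (gromov_bar X d)" by (simp add: gromov_open_def)
  moreover have "U \<subseteq> gromov_bar X d" if "gromov_open X d b U" for U
    using that by (simp add: gromov_open_def)
  ultimately show ?thesis
    unfolding topspace_def openin_gromov_topology by blast
qed


section \<open>Visibility subspaces and geodesic loops\<close>

definition geodesic_subspace :: "(complex ^ 'd) set \<Rightarrow> (complex ^ 'd) set \<Rightarrow> bool" where
  "geodesic_subspace M S \<longleftrightarrow>
     S \<subseteq> M \<and>
     Metric_space.mcomplete S (kobayashi_dist M) \<and>
     (\<forall>x\<in>S. \<forall>y\<in>S. x \<noteq> y \<longrightarrow>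
        (\<exists>I \<sigma>. geodesic_on M (kobayashi_dist M) I \<sigma> \<and> x \<in> \<sigma> ` I \<and> y \<in> \<sigma> ` I \<and> \<sigma> ` I \<subseteq> S))"

text \<open>Since \<open>M\<close> is embedded and bounded, compactness of \<open>K\<close> means the same in
  \<open>\<complex>\<^sup>d\<close> and for the Kobayashi distance.\<close>

definition visibility_subspace :: "(complex ^ 'd) set \<Rightarrow> (complex ^ 'd) set \<Rightarrow> bool" where
  "visibility_subspace M S \<longleftrightarrow>
     geodesic_subspace M S \<and>
     (\<forall>p \<in> closure S - S. \<forall>q \<in> closure S - S. p \<noteq> q \<longrightarrow>
        (\<exists>U V K. p \<in> interior U \<and> q \<in> interior V \<and> closure U \<inter> closure V = {} \<and>
           compact K \<and> K \<subseteq> S \<and>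
           (\<forall>\<gamma> s t. s \<le> t \<longrightarrow> geodesic_on M (kobayashi_dist M) {s..t} \<gamma> \<longrightarrow> \<gamma> ` {s..t} \<subseteq> S \<longrightarrow>
              \<gamma> s \<in> U \<inter> S \<longrightarrow> \<gamma> t \<in> V \<inter> S \<longrightarrow> \<gamma> ` {s..t} \<inter> K \<noteq> {})))"

definition limit_points_along ::
    "(complex ^ 'd) set \<Rightarrow> real filter \<Rightarrow> (real \<Rightarrow> complex ^ 'd) \<Rightarrow> (complex ^ 'd) set" where
  "limit_points_along S F \<gamma> =
     {p \<in> closure S. \<exists>t::nat \<Rightarrow> real. filterlim t F sequentially \<and> (\<lambda>n. \<gamma> (t n)) \<longlonglongrightarrow> p}"

definition geodesic_loop ::
    "(complex ^ 'd) set \<Rightarrow> (complex ^ 'd) set \<Rightarrow> (real \<Rightarrow> complex ^ 'd) \<Rightarrow> bool" where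
  "geodesic_loop M S \<gamma> \<longleftrightarrow>
     geodesic_on S (kobayashi_dist M) UNIV \<gamma> \<and>
     limit_points_along S at_top \<gamma> = limit_points_along S at_bot \<gamma>"

definition extends_identity ::
    "(complex ^ 'd) set \<Rightarrow> (complex ^ 'd) set \<Rightarrow> complex ^ 'd \<Rightarrow>
     (complex ^ 'd + (real \<Rightarrow> complex ^ 'd) set \<Rightarrow> complex ^ 'd) \<Rightarrow> bool" where
  "extends_identity M S b F \<longleftrightarrow>
     continuous_map (gromov_topology S (kobayashi_dist M) b) (top_of_set (closure S)) F \<and>
     F ` gromov_bar S (kobayashi_dist M) = closure S \<and>
     (\<forall>x\<in>S. F (Inl x) = x)"

end

theory Submission
  imports Defs "HOL-Library.Diagonal_Subsequence"
begin

text \<open>By the Schwarz lemma and submanifold charts, \<open>k\<^sub>M\<close> is a metric inducing the Euclidean topology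
  of \<open>M\<close>, so \<open>S\<close> is locally compact and, being complete and geodesic, proper (Hopf-Rinow). From
  there on only a proper geodesic hyperbolic space sitting topologically inside a compact
  Euclidean set matters.

  If visibility holds, two subsequential limits \<open>p \<noteq> q\<close> along one ray, along asymptotic rays, or
  along generalized rays converging in the Gromov sense would force far-away geodesic pieces from
  near \<open>p\<close> to near \<open>q\<close> to meet a fixed compact set; hence sending a class of rays to the common
  Euclidean limit is well defined and sequentially continuous. Conversely, if geodesics from near
  \<open>p\<close> to near \<open>q\<close> avoid all balls about the basepoint, the Gromov products of their endpoints tend
  to infinity, so the endpoints converge to one and the same Gromov boundary point, which a
  continuous extension cannot send to both \<open>p\<close> and \<open>q\<close>. Finally, an extension is a closed map by
  sequential compactness, so it is a homeomorphism iff it is injective; two distinct boundary points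
  are joined by a geodesic line, and this line is a loop iff they have the same image.\<close>


section \<open>The Kobayashi distance of a bounded submanifold\<close>

text \<open>Two obstacles shape the proof. The boundary consists of classes of rays starting
  anywhere, whereas convergence is tested on generalized rays from \<open>b\<close>; so each class
  must be shown to contain a ray from \<open>b\<close>, and the same limit argument shows that the
  points of a ray converge to its class (\<open>limit_along_ray\<close>). Moreover, visibility
  speaks only of pairs of points outside \<open>S\<close>, whereas values of the extension may
  accumulate at points of \<open>S\<close>; near those, bounded distance from \<open>b\<close> takes
  the place of visibility (\<open>visibleE\<close>).

  All hyperbolic estimates come from the four-point inequality applied with basepoint
  \<open>b\<close>, at a fixed height above \<open>b\<close>. They have the form of a bounded error,
  which survives limits because distances are continuous, and any bounded error is enough to make
  rays asymptotic. Compactness is used in sequential form, in keeping with a topology whose closed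
  sets are the sequentially closed ones. Rays, segments and lines all fall under one Arzela-Ascoli
  statement for 1-Lipschitz maps on the whole real line.\<close>

lemma poincare_dist_commute: "poincare_dist z w = poincare_dist w z"
proof -
  have "cmod (1 - cnj z * w) = cmod (1 - cnj w * z)"
    by (metis complex_cnj_cnj complex_cnj_diff complex_cnj_mult complex_cnj_one complex_mod_cnj mult.commute)
  then show ?thesis
    unfolding poincare_dist_def by (simp add: norm_divide norm_minus_commute)
qed

lemma poincare_dist_zero: "poincare_dist 0 w = artanh (cmod w)"
  by (simp add: poincare_dist_def)

text \<open>A crude linear bound obtained from \<open>ln y \<le> y - 1\<close> at
  \<open>y = (1 - x) / (1 + x)\<close>; later only the existence of some linear bound
  matters.\<close>

lemma artanh_ge_half:
  fixes x :: real
  assumes "0 \<le> x" "x < 1"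
  shows "x / 2 \<le> artanh x"
proof -
  have "ln ((1 - x) / (1 + x)) \<le> (1 - x) / (1 + x) - 1"
    using assms by (intro ln_le_minus_one) auto
  moreover have "ln ((1 - x) / (1 + x)) = - ln ((1 + x) / (1 - x))"
    using assms by (simp add: ln_div)
  moreover have "(1 - x) / (1 + x) - 1 = - (2 * x / (1 + x))"
    using assms by (simp add: field_simps)
  moreover have "x \<le> 2 * x / (1 + x)"
  proof -
    have "x * x \<le> x * 1" using assms by (intro mult_left_mono) auto
    then show ?thesis using assms by (simp add: field_simps)
  qed
  ultimately show ?thesis unfolding artanh_def by linarith
qed

text \<open>A disc automorphism moves \<open>a\<close> to the centre, and subtracting
  \<open>f a\<close> and dividing by \<open>2 * R\<close> turns f into a self-map of the disc fixing
  0, to which the Schwarz lemma applies. The factor 4 is this 2 times the 2 from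
  \<open>artanh_ge_half\<close>.\<close>

lemma Schwarz_Pick_bounded:
  assumes hol: "f holomorphic_on ball 0 1" and bd: "\<And>z. z \<in> ball 0 1 \<Longrightarrow> cmod (f z) < R"
    and a: "a \<in> ball 0 1" and b: "b \<in> ball 0 1"
  shows "cmod (f a - f b) \<le> 4 * R * poincare_dist a b"
proof -
  have a1: "cmod a < 1" and b1: "cmod b < 1" using a b by auto
  have R: "R > 0" using bd[OF a] by (meson norm_ge_zero order_le_less_trans)
  let ?\<phi> = "Moebius_function 0 (- a)"
  define w where "w = Moebius_function 0 a b"
  have w1: "cmod w < 1" unfolding w_def by (rule Moebius_function_norm_lt_1[OF a1 b1])
  have \<phi>w: "?\<phi> w = b" unfolding w_def
    by (rule Moebius_function_compose) (use a1 b1 in auto)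
  have \<phi>0: "?\<phi> 0 = a" by (simp add: Moebius_function_def)
  have \<phi>ball: "?\<phi> z \<in> ball 0 1" if "cmod z < 1" for z
    using Moebius_function_norm_lt_1[of "-a" z 0] a1 that by simp
  have hol\<phi>: "?\<phi> holomorphic_on ball 0 1"
    by (rule Moebius_function_holomorphic) (use a1 in simp)
  define h where "h z = (f (?\<phi> z) - f a) / of_real (2 * R)" for z
  have "(f \<circ> ?\<phi>) holomorphic_on ball 0 1"
    by (rule holomorphic_on_compose_gen[OF hol\<phi> hol]) (use \<phi>ball in auto)
  then have holh: "h holomorphic_on ball 0 1"
    unfolding h_def o_def using R by (intro holomorphic_intros) auto
  have h1: "cmod (h z) < 1" if "cmod z < 1" for z
  proof -
    have "cmod (f (?\<phi> z) - f a) \<le> cmod (f (?\<phi> z)) + cmod (f a)" by (rule norm_triangle_ineq4)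
    also have "\<dots> < 2 * R" using bd[OF \<phi>ball[OF that]] bd[OF a] by simp
    finally show ?thesis using R by (simp add: h_def norm_divide norm_mult)
  qed
  have "cmod (h w) \<le> cmod w"
  proof (rule Schwarz_Lemma(1)[OF holh _ _ w1])
    show "h 0 = 0" unfolding h_def \<phi>0 by simp
    show "cmod (h z) < 1" if "cmod z < 1" for z by (rule h1[OF that])
  qed
  moreover have "cmod (h w) = cmod (f a - f b) / (2 * R)"
    unfolding h_def \<phi>w using R by (simp add: norm_divide norm_mult norm_minus_commute)
  ultimately have "cmod (f a - f b) \<le> 2 * R * cmod w"
    using R by (simp add: pos_divide_le_eq mult.commute)
  moreover have "cmod w \<le> 2 * poincare_dist a b"
  proof -
    have "cmod w = cmod ((a - b) / (1 - cnj a * b))"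
      by (simp add: w_def Moebius_function_def norm_divide norm_minus_commute)
    then show ?thesis
      using artanh_ge_half[of "cmod w"] w1 by (simp add: poincare_dist_def)
  qed
  moreover from this have "2 * R * cmod w \<le> 2 * R * (2 * poincare_dist a b)"
    using R by (intro mult_left_mono) auto
  ultimately show ?thesis by simp
qed

text \<open>Schwarz-Pick for the identity map, with \<open>R = 1\<close>.\<close>

lemma poincare_dist_nonneg:
  assumes "a \<in> ball 0 1" "b \<in> ball 0 1"
  shows "0 \<le> poincare_dist a b"
proof -
  have "cmod (a - b) \<le> 4 * 1 * poincare_dist a b"
    by (rule Schwarz_Pick_bounded[of "\<lambda>z. z", OF _ _ assms]) auto
  then show ?thesis using norm_ge_zero[of "a - b"] by linarith
qed

lemma norm_vector_smult: "norm (c *s x) = norm c * norm (x :: complex ^ 'n)"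
  by (simp add: norm_vec_def norm_mult L2_set_right_distrib)

section \<open>Chains of holomorphic discs and the infimum of their lengths\<close>

inductive disc_chain :: "(complex ^ 'd) set \<Rightarrow> complex ^ 'd \<Rightarrow> complex ^ 'd \<Rightarrow> real \<Rightarrow> bool"
  for M where
  single: "holomorphic_disc M f \<Longrightarrow> a \<in> ball 0 1 \<Longrightarrow> b \<in> ball 0 1 \<Longrightarrow> f a = x \<Longrightarrow> f b = y \<Longrightarrow>
    disc_chain M x y (poincare_dist a b)"
| step: "disc_chain M x y r \<Longrightarrow> holomorphic_disc M f \<Longrightarrow> a \<in> ball 0 1 \<Longrightarrow> b \<in> ball 0 1 \<Longrightarrow>
    f a = y \<Longrightarrow> f b = z \<Longrightarrow> disc_chain M x z (r + poincare_dist a b)"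

text \<open>The inductive form makes concatenation and reversal of chains plain inductions instead
  of index shifts. Counting by the last index \<open>m\<close> builds in that a chain has at least
  one disc.\<close>

lemma disc_chain_of_sequence:
  assumes "\<And>k. k \<le> m \<Longrightarrow> holomorphic_disc M (f k) \<and> a k \<in> ball 0 1 \<and> b k \<in> ball 0 1"
    and "\<And>k. k < m \<Longrightarrow> f k (b k) = f (Suc k) (a (Suc k))"
  shows "disc_chain M (f 0 (a 0)) (f m (b m)) (\<Sum>k\<le>m. poincare_dist (a k) (b k))"
  using assms
proof (induction m)
  case 0
  then show ?case using disc_chain.single[of M "f 0" "a 0" "b 0"] by simp
next
  case (Suc m)
  have "disc_chain M (f 0 (a 0)) (f m (b m)) (\<Sum>k\<le>m. poincare_dist (a k) (b k))"
    using Suc.prems by (intro Suc.IH) auto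
  from disc_chain.step[OF this, of "f (Suc m)" "a (Suc m)" "b (Suc m)"]
  show ?case using Suc.prems(1)[of "Suc m"] Suc.prems(2)[of m] by simp
qed

lemma sequence_of_disc_chain:
  assumes "disc_chain M x y r"
  shows "\<exists>m f a b. (\<forall>k\<le>m. holomorphic_disc M (f k) \<and> a k \<in> ball 0 1 \<and> b k \<in> ball 0 1) \<and>
    (\<forall>k<m. f k (b k) = f (Suc k) (a (Suc k))) \<and> f 0 (a 0) = x \<and> f m (b m) = y \<and>
    r = (\<Sum>k\<le>m. poincare_dist (a k) (b k))"
  using assms
proof induction
  case (single f a b x y)
  then show ?case
    by (intro exI[of _ 0] exI[of _ "\<lambda>_. f"] exI[of _ "\<lambda>_. a"] exI[of _ "\<lambda>_. b"]) auto
next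
  case (step x y r g a' b' z)
  then obtain m f a b where
    *: "\<forall>k\<le>m. holomorphic_disc M (f k) \<and> a k \<in> ball 0 1 \<and> b k \<in> ball 0 1"
      "\<forall>k<m. f k (b k) = f (Suc k) (a (Suc k))" "f 0 (a 0) = x" "f m (b m) = y"
      "r = (\<Sum>k\<le>m. poincare_dist (a k) (b k))" by blast
  show ?case
    by (intro exI[of _ "Suc m"] exI[of _ "f(Suc m := g)"] exI[of _ "a(Suc m := a')"]
        exI[of _ "b(Suc m := b')"])
      (use * step in \<open>auto simp: le_Suc_eq less_Suc_eq\<close>)
qed

lemma kobayashi_dist_disc_chain:
  assumes "x \<in> M" "y \<in> M"
  shows "kobayashi_dist M x y = Inf {r. disc_chain M x y r}"
proof -
  have "{\<Sum>k<n. poincare_dist (a k) (b k) | (n::nat) f a b.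
               0 < n \<and>
               (\<forall>k<n. holomorphic_disc M (f k) \<and> a k \<in> ball 0 1 \<and> b k \<in> ball 0 1) \<and>
               f 0 (a 0) = x \<and>
               (\<forall>k. Suc k < n \<longrightarrow> f k (b k) = f (Suc k) (a (Suc k))) \<and>
               f (n - 1) (b (n - 1)) = y} = {r. disc_chain M x y r}" (is "?A = ?B")
  proof (intro equalityI subsetI)
    fix r assume "r \<in> ?A"
    then obtain n f a b where r: "r = (\<Sum>k<n. poincare_dist (a k) (b k))" and n: "0 < n"
      and *: "\<forall>k<n. holomorphic_disc M (f k) \<and> a k \<in> ball 0 1 \<and> b k \<in> ball 0 1"
        "f 0 (a 0) = x" "\<forall>k. Suc k < n \<longrightarrow> f k (b k) = f (Suc k) (a (Suc k))"
        "f (n - 1) (b (n - 1)) = y" by blast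
    obtain m where m: "n = Suc m" using n gr0_conv_Suc by auto
    show "r \<in> ?B" using disc_chain_of_sequence[of m M f a b] *
      by (simp add: r m lessThan_Suc_atMost less_Suc_eq_le)
  next
    fix r assume "r \<in> ?B"
    then obtain m f a b where *: "\<forall>k\<le>m. holomorphic_disc M (f k) \<and> a k \<in> ball 0 1 \<and> b k \<in> ball 0 1"
      "\<forall>k<m. f k (b k) = f (Suc k) (a (Suc k))" "f 0 (a 0) = x" "f m (b m) = y"
      "r = (\<Sum>k\<le>m. poincare_dist (a k) (b k))" using sequence_of_disc_chain[of M x y r] by auto
    show "r \<in> ?A" unfolding mem_Collect_eq
      by (intro exI[of _ "Suc m"] exI[of _ f] exI[of _ a] exI[of _ b])
        (use * in \<open>auto simp: lessThan_Suc_atMost less_Suc_eq_le\<close>)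
  qed
  then show ?thesis using assms by (simp add: kobayashi_dist_def)
qed

lemma disc_chain_nonneg: "disc_chain M x y r \<Longrightarrow> 0 \<le> r"
  by (induction rule: disc_chain.induct) (auto simp: poincare_dist_nonneg add_nonneg_nonneg)

lemma disc_chain_trans:
  assumes "disc_chain M y z s" "disc_chain M x y r"
  shows "disc_chain M x z (r + s)"
  using assms
proof induction
  case (single f a b y z)
  then show ?case using disc_chain.step by metis
next
  case (step y z s f a b w)
  have "disc_chain M x w ((r + s) + poincare_dist a b)"
    using disc_chain.step[OF step.IH[OF step.prems] step.hyps(2-6)] .
  then show ?case by (simp add: add.assoc)
qed

lemma disc_chain_sym:
  assumes "disc_chain M x y r"
  shows "disc_chain M y x r"
  using assms
proof induction
  case (single f a b x y)
  then show ?case using disc_chain.single poincare_dist_commute by metis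
next
  case (step x y r f a b z)
  have "disc_chain M z y (poincare_dist a b)"
    using disc_chain.single[OF step.hyps(2,4,3,6,5)] poincare_dist_commute by metis
  from disc_chain_trans[OF step.IH this] show ?case by (simp add: add.commute)
qed

lemma kobayashi_dist_le:
  assumes "disc_chain M x y r" "x \<in> M" "y \<in> M"
  shows "kobayashi_dist M x y \<le> r"
  unfolding kobayashi_dist_disc_chain[OF assms(2,3)]
  by (rule cInf_lower) (use assms disc_chain_nonneg in \<open>auto intro!: bdd_belowI[of _ 0]\<close>)

lemma kobayashi_dist_commute: "kobayashi_dist M x y = kobayashi_dist M y x"
proof (cases "x \<in> M \<and> y \<in> M")
  case True
  have "{r. disc_chain M x y r} = {r. disc_chain M y x r}" using disc_chain_sym by blast
  then show ?thesis using True by (simp add: kobayashi_dist_disc_chain)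
qed (auto simp: kobayashi_dist_def)

text \<open>Schwarz-Pick in each coordinate; \<open>CARD('d)\<close> enters because the Euclidean
  norm is estimated by the sum of the coordinates. Being additive along chains, the bound survives
  the infimum.\<close>

lemma disc_chain_norm_le:
  fixes M :: "(complex ^ 'd) set"
  assumes R: "\<And>x. x \<in> M \<Longrightarrow> norm x < R" and "disc_chain M x y r"
  shows "norm (x - y) \<le> 4 * R * CARD('d) * r"
proof -
  have disc: "norm (f a - f b) \<le> 4 * R * CARD('d) * poincare_dist a b"
    if f: "holomorphic_disc M f" and ab: "a \<in> ball 0 1" "b \<in> ball 0 1" for f a b
  proof -
    have "norm (f a - f b) \<le> (\<Sum>i\<in>UNIV. cmod ((f a - f b) $ i))"
      unfolding norm_vec_def by (rule L2_set_le_sum) simp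
    also have "\<dots> \<le> (\<Sum>i\<in>(UNIV::'d set). 4 * R * poincare_dist a b)"
    proof (rule sum_mono)
      fix i :: 'd
      have "cmod (f z $ i) < R" if "z \<in> ball 0 1" for z
      proof -
        have "f z \<in> M" using f that unfolding holomorphic_disc_def by blast
        from R[OF this] Finite_Cartesian_Product.norm_nth_le[of "f z" i] show ?thesis by linarith
      qed
      then show "cmod ((f a - f b) $ i) \<le> 4 * R * poincare_dist a b"
        using Schwarz_Pick_bounded[of "\<lambda>z. f z $ i" R a b] f ab
        by (simp add: holomorphic_disc_def)
    qed
    finally show ?thesis by (simp add: algebra_simps)
  qed
  show ?thesis using assms(2)
  proof induction
    case (single f a b x y)
    then show ?case using disc by blast
  next
    case (step x y r f a b z)
    have "norm (x - z) \<le> norm (x - y) + norm (y - z)"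
      using norm_triangle_ineq[of "x - y" "y - z"] by simp
    also have "\<dots> \<le> 4 * R * CARD('d) * r + 4 * R * CARD('d) * poincare_dist a b"
      using step.IH disc[OF step.hyps(2-4)] step.hyps(5,6) by (intro add_mono) auto
    finally show ?case by (simp add: algebra_simps)
  qed
qed

section \<open>Submanifold charts and the discs they provide\<close>

lemma holomorphic_map_on_imp_continuous_on:
  "holomorphic_map_on U \<Phi> \<Longrightarrow> continuous_on U \<Phi>"
  unfolding holomorphic_map_on_def
  by (meson continuous_at_imp_continuous_on has_derivative_continuous)

text \<open>Complex linearity of the derivative D makes the restriction to a complex line complex
  differentiable, with derivative \<open>D u $ i\<close>.\<close>

lemma holomorphic_on_line:
  fixes \<Psi> :: "complex ^ 'n \<Rightarrow> complex ^ 'm"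
  assumes hol: "holomorphic_map_on V \<Psi>" and line: "\<And>z. z \<in> T \<Longrightarrow> p + z *s u \<in> V"
    and "open T"
  shows "(\<lambda>z. \<Psi> (p + z *s u) $ i) holomorphic_on T"
proof (rule holomorphic_onI)
  fix z assume z: "z \<in> T"
  obtain D where D: "(\<Psi> has_derivative D) (at (p + z *s u))"
    and lin: "\<And>c v. D (c *s v) = c *s D v"
    using hol line[OF z] unfolding holomorphic_map_on_def by blast
  have "bounded_linear (\<lambda>z::complex. z *s u)"
    by (rule bounded_linear_intro[of _ "norm u"])
      (auto simp: vec_eq_iff algebra_simps norm_vector_smult)
  then have "((\<lambda>z. p + z *s u) has_derivative (\<lambda>h. h *s u)) (at z)"
    using has_derivative_add[OF has_derivative_const[of p] bounded_linear_imp_has_derivative] by simp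
  from diff_chain_at[OF this D]
  have "((\<lambda>z. \<Psi> (p + z *s u)) has_derivative (\<lambda>h. D (h *s u))) (at z)"
    by (simp add: o_def)
  from bounded_linear.has_derivative[OF bounded_linear_vec_nth this, of i]
  have "((\<lambda>z. \<Psi> (p + z *s u) $ i) has_derivative (\<lambda>h. D u $ i * h)) (at z)"
    by (simp add: lin mult.commute)
  then have "((\<lambda>z. \<Psi> (p + z *s u) $ i) has_field_derivative D u $ i) (at z)"
    by (simp add: has_field_derivative_def)
  then show "(\<lambda>z. \<Psi> (p + z *s u) $ i) field_differentiable at z within T"
    using field_differentiable_at_within field_differentiable_def by blast
qed

text \<open>Membership in \<open>M\<close> can be read off on both sides of the chart: in
  \<open>U\<close> because injectivity of \<open>\<Phi>\<close> forces a point with vanishing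
  coordinates to be the preimage lying in \<open>M\<close>, in \<open>V\<close> because every point
  of the coordinate subspace is attained.\<close>

lemma submanifold_chart:
  fixes M :: "(complex ^ 'd) set"
  assumes "embedded_complex_submanifold M" "p \<in> M"
  obtains U V and \<Phi> \<Psi> :: "complex ^ 'd \<Rightarrow> complex ^ 'd" and J where "open U" "open V" "p \<in> U" "\<And>x. x \<in> U \<Longrightarrow> \<Phi> x \<in> V"
    "\<And>x. x \<in> U \<Longrightarrow> \<Psi> (\<Phi> x) = x" "continuous_on U \<Phi>" "holomorphic_map_on V \<Psi>"
    "\<And>x. x \<in> U \<Longrightarrow> x \<in> M \<longleftrightarrow> (\<forall>i. i \<notin> J \<longrightarrow> \<Phi> x $ i = 0)"
    "\<And>w. w \<in> V \<Longrightarrow> (\<forall>i. i \<notin> J \<longrightarrow> w $ i = 0) \<Longrightarrow> \<Psi> w \<in> M"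
proof -
  obtain n where "\<forall>p\<in>M. \<exists>U V \<Phi> (J :: 'd set). p \<in> U \<and> biholomorphic_between U V \<Phi> \<and> card J = n \<and>
        \<Phi> ` (M \<inter> U) = {w \<in> V. \<forall>i. i \<notin> J \<longrightarrow> w $ i = 0}"
    using assms(1) unfolding embedded_complex_submanifold_def by (rule exE)
  from bspec[OF this assms(2)]
  obtain U V J and \<Phi> :: "complex ^ 'd \<Rightarrow> complex ^ 'd" where p: "p \<in> U"
    and bi: "biholomorphic_between U V \<Phi>"
    and im: "\<Phi> ` (M \<inter> U) = {w \<in> V. \<forall>i. i \<notin> J \<longrightarrow> w $ i = 0}"
    by (elim exE conjE)
  have inj: "inj_on \<Phi> U" and V: "\<Phi> ` U = V"
    using bi by (auto simp: biholomorphic_between_def bij_betw_def)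
  show thesis
  proof (rule that[of U V \<Phi> "the_inv_into U \<Phi>" J])
    show "x \<in> M \<longleftrightarrow> (\<forall>i. i \<notin> J \<longrightarrow> \<Phi> x $ i = 0)" if "x \<in> U" for x
    proof
      assume "x \<in> M" then show "\<forall>i. i \<notin> J \<longrightarrow> \<Phi> x $ i = 0" using that im by blast
    next
      assume "\<forall>i. i \<notin> J \<longrightarrow> \<Phi> x $ i = 0"
      then have "\<Phi> x \<in> \<Phi> ` (M \<inter> U)" using im V that by blast
      then obtain y where "y \<in> M" "y \<in> U" "\<Phi> x = \<Phi> y" by blast
      with inj that show "x \<in> M" by (auto dest: inj_onD)
    qed
    show "the_inv_into U \<Phi> w \<in> M" if "w \<in> V" "\<forall>i. i \<notin> J \<longrightarrow> w $ i = 0" for w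
    proof -
      have "w \<in> \<Phi> ` (M \<inter> U)" using im that by blast
      then show ?thesis using the_inv_into_f_f[OF inj] by auto
    qed
  qed (use bi p V inj in \<open>auto simp: biholomorphic_between_def the_inv_into_f_f
        intro: holomorphic_map_on_imp_continuous_on\<close>)
qed

text \<open>In the chart, p and x lie on an affine disc centred at \<open>\<Phi> p\<close> and
  pointing towards \<open>\<Phi> x\<close>. Its radius \<open>\<rho>\<close> depends on p only, so
  when x approaches p its parameter tends to 0, and with it the Poincare distance from 0.\<close>

lemma disc_chain_local:
  fixes M :: "(complex ^ 'd) set"
  assumes M: "embedded_complex_submanifold M" and p: "p \<in> M" and "e > 0"
  obtains \<delta> where "\<delta> > 0" "\<And>x. x \<in> M \<Longrightarrow> dist x p < \<delta> \<Longrightarrow> \<exists>r<e. disc_chain M p x r"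
proof -
  obtain U V and \<Phi> \<Psi> :: "complex ^ 'd \<Rightarrow> complex ^ 'd" and J where open_UV: "open U" "open V" and pU: "p \<in> U"
    and \<Phi>V: "\<And>x. x \<in> U \<Longrightarrow> \<Phi> x \<in> V" and inv: "\<And>x. x \<in> U \<Longrightarrow> \<Psi> (\<Phi> x) = x"
    and cont: "continuous_on U \<Phi>" and hol: "holomorphic_map_on V \<Psi>"
    and MU: "\<And>x. x \<in> U \<Longrightarrow> x \<in> M \<longleftrightarrow> (\<forall>i. i \<notin> J \<longrightarrow> \<Phi> x $ i = 0)"
    and \<Psi>M: "\<And>w. w \<in> V \<Longrightarrow> (\<forall>i. i \<notin> J \<longrightarrow> w $ i = 0) \<Longrightarrow> \<Psi> w \<in> M"
    by (rule submanifold_chart[OF M p]) (rule that)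
  obtain \<rho> where \<rho>: "\<rho> > 0" "ball (\<Phi> p) \<rho> \<subseteq> V"
    using open_UV(2) \<Phi>V[OF pU] open_contains_ball by blast
  have lim: "(artanh \<longlongrightarrow> artanh 0) (at (0::real))"
    using isCont_artanh[of 0] by (simp add: isCont_def)
  then obtain \<tau> where \<tau>: "\<tau> > 0" "\<And>t. \<bar>t\<bar> < \<tau> \<Longrightarrow> artanh t < e"
  proof -
    obtain \<tau> where "\<tau> > 0" "\<And>t. t \<noteq> 0 \<Longrightarrow> \<bar>t\<bar> < \<tau> \<Longrightarrow> \<bar>artanh t\<bar> < e"
      using lim \<open>e > 0\<close> unfolding LIM_eq by force
    then have "artanh t < e" if "\<bar>t\<bar> < \<tau>" for t
      using that \<open>e > 0\<close> by (cases "t = 0") force+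
    with \<open>\<tau> > 0\<close> show thesis by (rule that)
  qed
  \<comment> \<open>The disc reaches \<open>\<Phi> x\<close> at the parameter
    \<open>norm v / \<rho>\<close>. This bound makes the parameter smaller than 1, so that it
    belongs to the disc, and smaller than \<open>\<tau>\<close>.\<close>
  define \<eta> where "\<eta> = \<rho> * min \<tau> 1"
  have "\<eta> > 0" using \<rho> \<tau> by (simp add: \<eta>_def)
  have "isCont \<Phi> p" using cont open_UV pU continuous_on_eq_continuous_at by blast
  then obtain \<delta>1 where \<delta>1: "\<delta>1 > 0" "\<And>x. dist x p < \<delta>1 \<Longrightarrow> dist (\<Phi> x) (\<Phi> p) < \<eta>"
    using \<open>\<eta> > 0\<close> unfolding continuous_at_eps_delta by blast
  obtain \<delta>2 where \<delta>2: "\<delta>2 > 0" "ball p \<delta>2 \<subseteq> U" using open_UV(1) pU open_contains_ball by blast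
  show thesis
  proof (rule that[of "min \<delta>1 \<delta>2"])
    show "min \<delta>1 \<delta>2 > 0" using \<delta>1 \<delta>2 by simp
    fix x assume x: "x \<in> M" and xp: "dist x p < min \<delta>1 \<delta>2"
    have xU: "x \<in> U" using xp \<delta>2(2) by (auto simp: dist_commute)
    define v where "v = \<Phi> x - \<Phi> p"
    have v: "norm v < \<eta>" using \<delta>1(2)[of x] xp by (simp add: v_def dist_norm)
    \<comment> \<open>For \<open>v = 0\<close> the division by zero makes the disc constant, as it should be.\<close>
    define u where "u = (\<rho> / norm v) *\<^sub>R v"
    define t where "t = norm v / \<rho>"
    have t: "0 \<le> t" "t < \<tau>" "t < 1"
    proof -
      have "t < min \<tau> 1" 
        using v pos_divide_less_eq[OF \<rho>(1)] unfolding t_def \<eta>_def by (simp only: mult.commute[of \<rho>])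
      then show "t < \<tau>" "t < 1" by auto
    qed (use \<rho>(1) in \<open>simp add: t_def\<close>)
    have nu: "norm u \<le> \<rho>" using \<rho>(1) by (simp add: u_def)
    have tu: "of_real t *s u = v"
      using \<rho>(1) by (cases "v = 0") (auto simp: t_def u_def vec_eq_iff scaleR_conv_of_real[where 'a = complex])
    \<comment> \<open>Both points lie in \<open>M\<close>, so \<open>v\<close> and \<open>u\<close>
      lie in the coordinate subspace and the whole affine disc is mapped into
      \<open>M\<close>.\<close>
    have v0: "v $ i = 0" if "i \<notin> J" for i
      using MU[OF xU] MU[OF pU] x p that by (simp add: v_def)
    have in_V: "\<Phi> p + z *s u \<in> V" if "z \<in> ball 0 1" for z
    proof -
      have "norm (z *s u) \<le> cmod z * \<rho>"
        unfolding norm_vector_smult by (rule mult_left_mono[OF nu]) simp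
      also have "\<dots> < \<rho>" using that \<rho>(1) by simp
      finally have "norm (z *s u) < \<rho>" .
      then show ?thesis using \<rho>(2) by (auto simp: dist_norm)
    qed
    define f where "f z = \<Psi> (\<Phi> p + z *s u)" for z
    have "holomorphic_disc M f"
      unfolding holomorphic_disc_def
    proof (intro conjI allI)
      show "(\<lambda>z. f z $ i) holomorphic_on ball 0 1" for i
        unfolding f_def by (rule holomorphic_on_line[OF hol in_V]) auto
      have "f z \<in> M" if "z \<in> ball 0 1" for z
        unfolding f_def using MU[OF pU] p v0
        by (intro \<Psi>M[OF in_V[OF that]]) (auto simp: u_def)
      then show "f ` ball 0 1 \<subseteq> M" by blast
    qed
    then have "disc_chain M (f 0) (f (of_real t)) (poincare_dist 0 (of_real t))"
      by (rule disc_chain.single) (use t in auto)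
    moreover have "f 0 = p" using inv[OF pU] by (simp add: f_def vec_eq_iff)
    moreover have "f (of_real t) = x" using inv[OF xU] by (simp add: f_def tu v_def)
    moreover have "poincare_dist 0 (of_real t) < e" using \<tau>(2)[of t] t by (simp add: poincare_dist_zero)
    ultimately show "\<exists>r<e. disc_chain M p x r" by auto
  qed
qed

text \<open>\<open>M\<close> may fail to be closed, but within a chart domain it is the preimage of
  a closed linear subspace.\<close>

lemma submanifold_locally_compact:
  fixes M :: "(complex ^ 'd) set"
  assumes M: "embedded_complex_submanifold M" and p: "p \<in> M"
  obtains r where "r > 0" "compact (cball p r \<inter> M)"
proof -
  obtain U J and \<Phi> :: "complex ^ 'd \<Rightarrow> complex ^ 'd" where U: "open U" "p \<in> U" and cont: "continuous_on U \<Phi>"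
    and MU: "\<And>x. x \<in> U \<Longrightarrow> x \<in> M \<longleftrightarrow> (\<forall>i. i \<notin> J \<longrightarrow> \<Phi> x $ i = 0)"
    by (rule submanifold_chart[OF M p]) blast
  obtain r where r: "r > 0" "cball p r \<subseteq> U" using U open_contains_cball by blast
  have "closed (cball p r \<inter> \<Phi> -` {w. \<forall>i. i \<notin> J \<longrightarrow> w $ i = 0})"
  proof (rule continuous_closed_preimage)
    show "continuous_on (cball p r) \<Phi>" using cont r(2) continuous_on_subset by blast
    show "closed {w :: complex ^ 'd. \<forall>i. i \<notin> J \<longrightarrow> w $ i = 0}"
      by (intro closed_Collect_all closed_Collect_imp closed_Collect_eq) (auto intro!: continuous_intros)
  qed simp
  moreover have "cball p r \<inter> \<Phi> -` {w. \<forall>i. i \<notin> J \<longrightarrow> w $ i = 0} = cball p r \<inter> M"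
    using MU r(2) by auto
  ultimately have "compact (cball p r \<inter> M)"
    by (metis Int_commute Int_left_absorb closed_Int_compact compact_cball)
  then show thesis using r(1) that by blast
qed

section \<open>The Kobayashi metric and its topology\<close>

locale bounded_submanifold =
  fixes M :: "(complex ^ 'd) set"
  assumes bounded: "bounded M" and connected: "connected M"
    and embedded: "embedded_complex_submanifold M"
begin

text \<open>Being joined by a chain is an equivalence relation with open classes, so connectedness
  leaves a single class. Hence the infimum defining the distance is never taken over the empty
  set.\<close>

lemma disc_chain_exists:
  assumes "x \<in> M" "y \<in> M"
  shows "\<exists>r. disc_chain M x y r"
proof -
  show ?thesis
  proof (rule connected_equivalence_relation[OF connected assms])
    fix a assume a: "a \<in> M"
    obtain \<delta> where \<delta>: "\<delta> > 0" "\<And>x. x \<in> M \<Longrightarrow> dist x a < \<delta> \<Longrightarrow> \<exists>r<1. disc_chain M a x r"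
      using disc_chain_local[OF embedded a, of 1] by auto
    show "\<exists>T. openin (top_of_set M) T \<and> a \<in> T \<and> (\<forall>x\<in>T. \<exists>r. disc_chain M a x r)"
      by (intro exI[of _ "M \<inter> ball a \<delta>"] conjI openin_open_Int)
        (use a \<delta> in \<open>force simp: dist_commute\<close>)+
  qed (use disc_chain_sym disc_chain_trans in blast)+
qed

lemma kobayashi_dist_nonneg: "0 \<le> kobayashi_dist M x y"
proof (cases "x \<in> M \<and> y \<in> M")
  case True
  then show ?thesis
    using disc_chain_exists[of x y] disc_chain_nonneg
    by (auto simp: kobayashi_dist_disc_chain intro!: cInf_greatest)
qed (auto simp: kobayashi_dist_def)

lemma kobayashi_dist_approx:
  assumes "x \<in> M" "y \<in> M" "e > 0"
  obtains r where "disc_chain M x y r" "r < kobayashi_dist M x y + e"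
  using cInf_lessD[of "{r. disc_chain M x y r}" "kobayashi_dist M x y + e"] assms
    disc_chain_exists[of x y] by (auto simp: kobayashi_dist_disc_chain)

text \<open>The chain bound after passing to the infimum. It separates points and makes Kobayashi
  convergence imply Euclidean convergence.\<close>

lemma norm_le_kobayashi_dist:
  obtains C where "C > 0" "\<And>x y. x \<in> M \<Longrightarrow> y \<in> M \<Longrightarrow> norm (x - y) \<le> C * kobayashi_dist M x y"
proof -
  obtain R where R: "R > 0" "\<And>x. x \<in> M \<Longrightarrow> norm x < R"
    using bounded bounded_pos_less by blast
  let ?C = "4 * R * CARD('d)"
  have C: "?C > 0" using R(1) by simp
  show thesis
  proof (rule that[OF C])
    fix x y assume xy: "x \<in> M" "y \<in> M"
    show "norm (x - y) \<le> ?C * kobayashi_dist M x y"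
    proof (rule field_le_epsilon)
      fix e :: real assume "e > 0"
      then have "e / ?C > 0" using C by simp
      then obtain r where r: "disc_chain M x y r" "r < kobayashi_dist M x y + e / ?C"
        using kobayashi_dist_approx xy by blast
      have "norm (x - y) \<le> ?C * r" using disc_chain_norm_le R(2) r(1) by blast
      also have "\<dots> \<le> ?C * (kobayashi_dist M x y + e / ?C)"
        using r(2) C by (intro mult_left_mono) auto
      also have "\<dots> = ?C * kobayashi_dist M x y + e" using R(1) by (simp add: field_simps)
      finally show "norm (x - y) \<le> ?C * kobayashi_dist M x y + e" .
    qed
  qed
qed

sublocale Metric_space M "kobayashi_dist M"
proof
  show "0 \<le> kobayashi_dist M x y" for x y by (rule kobayashi_dist_nonneg)
  show "kobayashi_dist M x y = kobayashi_dist M y x" for x y by (rule kobayashi_dist_commute)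
  show "kobayashi_dist M x y = 0 \<longleftrightarrow> x = y" if "x \<in> M" "y \<in> M" for x y
  proof
    assume "kobayashi_dist M x y = 0"
    then show "x = y" using norm_le_kobayashi_dist that by (metis mult_zero_right norm_le_zero_iff right_minus_eq)
  next
    assume "x = y"
    have "kobayashi_dist M x x < 0 + e" if e: "e > 0" for e
    proof -
      obtain r where "r < e" "disc_chain M x x r"
        using disc_chain_local[OF embedded \<open>x \<in> M\<close> e] \<open>x \<in> M\<close> by (metis dist_self)
      then show ?thesis using kobayashi_dist_le \<open>x \<in> M\<close> by fastforce
    qed
    then show "kobayashi_dist M x y = 0"
      using \<open>x = y\<close> kobayashi_dist_nonneg[of x x] by (metis add_0 less_irrefl order_le_less)
  qed
  show "kobayashi_dist M x z \<le> kobayashi_dist M x y + kobayashi_dist M y z"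
    if xyz: "x \<in> M" "y \<in> M" "z \<in> M" for x y z
  proof (rule field_le_epsilon)
    fix e :: real assume "e > 0"
    then have e: "e / 2 > 0" by simp
    obtain r where r: "disc_chain M x y r" "r < kobayashi_dist M x y + e / 2"
      using kobayashi_dist_approx[OF xyz(1,2) e] .
    obtain s where s: "disc_chain M y z s" "s < kobayashi_dist M y z + e / 2"
      using kobayashi_dist_approx[OF xyz(2,3) e] .
    from kobayashi_dist_le[OF disc_chain_trans[OF s(1) r(1)]] xyz r(2) s(2)
    show "kobayashi_dist M x z \<le> kobayashi_dist M x y + kobayashi_dist M y z + e" by simp
  qed
qed

text \<open>One direction is the Lipschitz bound, the other the existence of arbitrarily short
  chains to nearby points.\<close>

lemma limitin_kobayashi_iff:
  assumes "\<And>n. s n \<in> M" "x \<in> M"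
  shows "limitin mtopology s x sequentially \<longleftrightarrow> s \<longlonglongrightarrow> x"
proof
  assume "limitin mtopology s x sequentially"
  then have lim: "(\<lambda>n. kobayashi_dist M (s n) x) \<longlonglongrightarrow> 0"
    by (simp add: limitin_metric_dist_null)
  obtain C where C: "C > 0" "\<And>x y. x \<in> M \<Longrightarrow> y \<in> M \<Longrightarrow> norm (x - y) \<le> C * kobayashi_dist M x y"
    using norm_le_kobayashi_dist by blast
  have "(\<lambda>n. C * kobayashi_dist M (s n) x) \<longlonglongrightarrow> 0"
    using tendsto_mult_left[OF lim, of C] by simp
  then have "(\<lambda>n. s n - x) \<longlonglongrightarrow> 0"
    by (rule Lim_null_comparison[rotated]) (use C(2) assms in auto)
  then show "s \<longlonglongrightarrow> x" by (simp add: LIM_zero_iff)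
next
  assume s: "s \<longlonglongrightarrow> x"
  show "limitin mtopology s x sequentially"
    unfolding limitin_metric
  proof (intro conjI allI impI)
    fix e :: real assume "e > 0"
    then obtain \<delta> where \<delta>: "\<delta> > 0" "\<And>y. y \<in> M \<Longrightarrow> dist y x < \<delta> \<Longrightarrow> \<exists>r<e. disc_chain M x y r"
      using disc_chain_local[OF embedded assms(2)] by metis
    have "\<forall>\<^sub>F n in sequentially. dist (s n) x < \<delta>" using s \<delta>(1) tendstoD by blast
    then show "\<forall>\<^sub>F n in sequentially. s n \<in> M \<and> kobayashi_dist M (s n) x < e"
    proof eventually_elim
      case (elim n)
      then obtain r where "r < e" "disc_chain M x (s n) r" using \<delta>(2) assms(1) by blast
      then show ?case using kobayashi_dist_le[of M x "s n" r] assms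
        by (simp add: kobayashi_dist_commute[of M "s n" x])
    qed
  qed (rule assms)
qed

end


section \<open>Proper metric spaces\<close>

context Metric_space
begin

text \<open>If some ball about b is not compact, the radii of compact balls have a finite supremum
  R. The ball of radius R is itself compact: it is nearly exhausted by smaller balls, hence totally
  bounded, and it is closed in a complete space. Finitely many local compact balls then cover a
  slightly larger ball, a contradiction.\<close>

theorem Hopf_Rinow:
  assumes complete: "mcomplete"
    and local_compact: "\<And>x. x \<in> M \<Longrightarrow> \<exists>r>0. compactin mtopology (mcball x r)"
    and between: "\<And>x y t. x \<in> M \<Longrightarrow> y \<in> M \<Longrightarrow> 0 \<le> t \<Longrightarrow> t \<le> d x y \<Longrightarrow>
      \<exists>z\<in>M. d x z = t \<and> d z y = d x y - t"
    and b: "b \<in> M"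
  shows "compactin mtopology (mcball b r)"
proof (rule ccontr)
  assume not_compact: "\<not> ?thesis"
  define A where "A = {r. 0 \<le> r \<and> compactin mtopology (mcball b r)}"
  have down: "compactin mtopology (mcball b s)" if "compactin mtopology (mcball b t)" "s \<le> t" for s t
    using closed_compactin[OF that(1) mcball_subset_concentric[OF that(2)] closedin_mcball] .
  have upper: "s \<le> r" if "s \<in> A" for s
    using that down[of s r] not_compact by (force simp: A_def)
  have "mcball b 0 = {b}" using b zero[of b] nonneg[of b] by (auto simp: order_antisym_conv)
  then have zero_A: "0 \<in> A" using b by (simp add: A_def)
  have bdd: "bdd_above A" using upper by (rule bdd_aboveI)
  define R where "R = Sup A"
  have R0: "0 \<le> R" unfolding R_def by (rule cSup_upper[OF zero_A bdd])
  have below: "compactin mtopology (mcball b s)" if "s < R" for s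
  proof -
    obtain t where "t \<in> A" "s < t" using \<open>s < R\<close> less_cSup_iff[of A s] zero_A bdd unfolding R_def by blast
    then show ?thesis using down[of t s] by (simp add: A_def)
  qed
  \<comment> \<open>Sliding y towards b through the points supplied by \<open>between\<close>: it
    enters the ball of radius t after moving by at most \<open>s - t\<close>.\<close>
  have split: "\<exists>z. z \<in> mcball b t \<and> d z y \<le> max 0 (s - t)" if "y \<in> mcball b s" and t: "0 \<le> t" for y s t
  proof -
    have y: "y \<in> M" "d b y \<le> s" using that by auto
    obtain z where "z \<in> M" "d b z = min (d b y) t" "d z y = d b y - min (d b y) t"
      using between[OF b y(1), of "min (d b y) t"] t by auto
    then show ?thesis using y b by (intro exI[of _ z]) auto
  qed
  have "mtotally_bounded (mcball b R)"
    unfolding mtotally_bounded_def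
  proof (intro allI impI)
    fix \<epsilon> :: real assume "\<epsilon> > 0"
    \<comment> \<open>A net of mesh \<open>\<epsilon> / 2\<close> for this smaller ball is one of
      mesh \<open>\<epsilon>\<close> for the ball of radius R, whose points slide in by at most
      \<open>\<epsilon> / 2\<close>. The radius fails to be smaller than R only if R is 0, where the
      ball is a single point.\<close>
    define \<rho> where "\<rho> = max 0 (R - \<epsilon> / 2)"
    have "compactin mtopology (mcball b \<rho>)"
    proof (cases "\<rho> < R")
      case False
      then have "\<rho> = 0" using \<open>\<epsilon> > 0\<close> R0 by (auto simp: \<rho>_def)
      then show ?thesis using zero_A by (simp add: A_def)
    qed (rule below)
    then have "mtotally_bounded (mcball b \<rho>)" by (rule compactin_imp_mtotally_bounded)
    then obtain K where K: "finite K" "K \<subseteq> mcball b \<rho>" "mcball b \<rho> \<subseteq> (\<Union>x\<in>K. mball x (\<epsilon> / 2))"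
      using \<open>\<epsilon> > 0\<close> unfolding mtotally_bounded_def by (meson half_gt_zero)
    show "\<exists>K. finite K \<and> K \<subseteq> mcball b R \<and> mcball b R \<subseteq> (\<Union>x\<in>K. mball x \<epsilon>)"
    proof (intro exI[of _ K] conjI subsetI)
      show "x \<in> mcball b R" if "x \<in> K" for x
        using that K(2) R0 \<open>\<epsilon> > 0\<close> by (auto simp: \<rho>_def max_def split: if_splits)
      fix y assume y: "y \<in> mcball b R"
      obtain z where z: "z \<in> mcball b \<rho>" "d z y \<le> max 0 (R - \<rho>)"
        using split[OF y, of \<rho>] by (auto simp: \<rho>_def)
      obtain x where x: "x \<in> K" "z \<in> mball x (\<epsilon> / 2)" using K(3) z(1) by blast
      have "d x y \<le> d x z + d z y" using x z y by (intro triangle) auto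
      also have "\<dots> < \<epsilon> / 2 + \<epsilon> / 2"
        using x z(2) \<open>\<epsilon> > 0\<close> by (intro add_less_le_mono) (auto simp: \<rho>_def)
      finally show "y \<in> (\<Union>x\<in>K. mball x \<epsilon>)" using x y by auto
    qed (rule K(1))
  qed
  then have compact_R: "compactin mtopology (mcball b R)"
    using mtotally_bounded_eq_compact_closure_of[OF complete] closure_of_eq[of mtopology "mcball b R"]
    by (metis closedin_mcball)
  obtain r where r: "\<And>x. x \<in> M \<Longrightarrow> r x > 0 \<and> compactin mtopology (mcball x (r x))"
    using local_compact by metis
  have "\<exists>\<F>. finite \<F> \<and> \<F> \<subseteq> (\<lambda>x. mball x (r x / 2)) ` mcball b R \<and> mcball b R \<subseteq> \<Union>\<F>"
    by (rule compactinD[OF compact_R]) (use r in auto)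
  then obtain \<F> where \<F>: "finite \<F>" "\<F> \<subseteq> (\<lambda>x. mball x (r x / 2)) ` mcball b R" "mcball b R \<subseteq> \<Union>\<F>"
    by blast
  obtain F where F: "F \<subseteq> mcball b R" "finite F" and "\<F> = (\<lambda>x. mball x (r x / 2)) ` F"
    using finite_subset_image[OF \<F>(1,2)] by blast
  then have cover: "mcball b R \<subseteq> (\<Union>x\<in>F. mball x (r x / 2))" using \<F>(3) by blast
  \<comment> \<open>Half of each local radius is used for covering the R-ball, the other half is
    left for stepping out of it. The inserted 1 makes the finite set visibly nonempty.\<close>
  define \<eta> where "\<eta> = Min (insert 1 ((\<lambda>x. r x / 2) ` F))"
  have \<eta>: "\<eta> > 0" unfolding \<eta>_def using F r by (subst Min_gr_iff) auto
  have \<eta>_le: "\<eta> \<le> r x / 2" if "x \<in> F" for x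
    unfolding \<eta>_def using F(2) that by (intro Min_le) auto
  have "compactin mtopology (mcball b (R + \<eta>))"
  proof (rule closed_compactin)
    show "compactin mtopology (\<Union>((\<lambda>x. mcball x (r x)) ` F))"
      by (rule compactin_Union) (use F r in auto)
    show "mcball b (R + \<eta>) \<subseteq> (\<Union>x\<in>F. mcball x (r x))"
    proof
      fix y assume y: "y \<in> mcball b (R + \<eta>)"
      obtain z where z: "z \<in> mcball b R" "d z y \<le> max 0 (R + \<eta> - R)"
        using split[OF y R0] by blast
      obtain x where x: "x \<in> F" "z \<in> mball x (r x / 2)" using cover z(1) by blast
      have "d x y \<le> d x z + d z y" using x z y by (intro triangle) auto
      also have "\<dots> \<le> r x" using x z(2) \<eta> \<eta>_le[OF x(1)] by auto
      finally show "y \<in> (\<Union>x\<in>F. mcball x (r x))" using x y by auto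
    qed
  qed (rule closedin_mcball)
  then have "R + \<eta> \<in> A" using R0 \<eta> by (simp add: A_def)
  then have "R + \<eta> \<le> R" unfolding R_def by (rule cSup_upper[OF _ bdd])
  then show False using \<eta> by simp
qed

lemma abs_mdist_diff_le:
  assumes "x \<in> M" "y \<in> M" "x' \<in> M" "y' \<in> M"
  shows "\<bar>d x y - d x' y'\<bar> \<le> d x x' + d y y'"
  using triangle[OF assms(1,3,2)] triangle[OF assms(3,4,2)] triangle[OF assms(3,1,4)]
    triangle[OF assms(1,2,4)] commute[of x' x] commute[of y' y] by linarith

lemma tendsto_mdist:
  assumes "\<And>n. x n \<in> M" "\<And>n. y n \<in> M" "x' \<in> M" "y' \<in> M"
    and "((\<lambda>n. d (x n) x') \<longlongrightarrow> 0) F" "((\<lambda>n. d (y n) y') \<longlongrightarrow> 0) F"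
  shows "((\<lambda>n. d (x n) (y n)) \<longlongrightarrow> d x' y') F"
proof -
  have "((\<lambda>n. d (x n) (y n) - d x' y') \<longlongrightarrow> 0) F"
  proof (rule Lim_null_comparison)
    show "\<forall>\<^sub>F n in F. norm (d (x n) (y n) - d x' y') \<le> d (x n) x' + d (y n) y'"
      using abs_mdist_diff_le assms(1-4) by (auto intro!: always_eventually)
    show "((\<lambda>n. d (x n) x' + d (y n) y') \<longlongrightarrow> 0) F"
      using tendsto_add[OF assms(5,6)] by simp
  qed
  then show ?thesis by (simp add: LIM_zero_iff)
qed

end

section \<open>Bolzano-Weierstrass and Arzela-Ascoli in proper spaces\<close>

locale proper_metric_space = Metric_space X d for X :: "'a set" and d +
  assumes proper: "x \<in> X \<Longrightarrow> compactin mtopology (mcball x r)"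
begin

lemma bounded_subsequence:
  fixes s :: "nat \<Rightarrow> 'a"
  assumes "b \<in> X" "\<And>n. s n \<in> X" "\<And>n. d b (s n) \<le> R"
  obtains l r where "strict_mono r" "l \<in> X" "(\<lambda>n. d (s (r n)) l) \<longlonglongrightarrow> 0"
proof -
  have "range s \<subseteq> mcball b R" using assms by auto
  then obtain l r where "l \<in> mcball b R" "strict_mono r" "limitin mtopology (s \<circ> r) l sequentially"
    using proper[OF assms(1), of R] unfolding compactin_sequentially by blast
  then show thesis using that[of r l] by (auto simp: limitin_metric_dist_null)
qed

text \<open>A diagonal subsequence converges at all rational times, the Lipschitz bound carries this
  over to all times, and a finite grid makes it uniform on bounded intervals. The domain is all of
  the reals so that rays and lines are covered alike.\<close>

lemma Arzela_Ascoli_Lipschitz: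
  fixes f :: "nat \<Rightarrow> real \<Rightarrow> 'a"
  assumes inX: "\<And>n t. f n t \<in> X" and lip: "\<And>n s t. d (f n s) (f n t) \<le> \<bar>s - t\<bar>"
    and b: "b \<in> X" "\<And>n. d b (f n 0) \<le> B"
  obtains r g where "strict_mono r" "\<And>t. g t \<in> X" "\<And>t. (\<lambda>n. d (f (r n) t) (g t)) \<longlonglongrightarrow> 0"
    "\<And>T e. e > 0 \<Longrightarrow> \<forall>\<^sub>F n in sequentially. \<forall>t\<in>{-T..T}. d (f (r n) t) (g t) < e"
proof -
  define q :: "nat \<Rightarrow> real" where "q = from_nat_into \<rat>"
  have q: "range q = \<rat>"
    unfolding q_def by (rule range_from_nat_into) (use countable_rat Rats_0 in blast)+
  have bound: "d b (f n t) \<le> B + \<bar>t\<bar>" for n t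
    using triangle[OF b(1) inX[of n 0] inX[of n t]] b(2)[of n] lip[of n 0 t] by simp
  define P where "P k s \<longleftrightarrow> (\<exists>l\<in>X. (\<lambda>n. d (f (s n) (q k)) l) \<longlonglongrightarrow> 0)" for k and s :: "nat \<Rightarrow> nat"
  interpret subseqs P
  proof
    fix k and s :: "nat \<Rightarrow> nat" assume "strict_mono s"
    show "\<exists>r'. strict_mono r' \<and> P k (s \<circ> r')"
      by (rule bounded_subsequence[of b "\<lambda>n. f (s n) (q k)" "B + \<bar>q k\<bar>"])
        (use b inX bound in \<open>auto simp: P_def\<close>)
  qed
  \<comment> \<open>From index \<open>Suc k\<close> on, the diagonal sequence runs through the
    sequence selected for \<open>q k\<close>; the shift does not affect the limit.\<close>
  have "P k (diagseq \<circ> (+) (Suc k))" for k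
  proof (rule diagseq_holds)
    fix r s :: "nat \<Rightarrow> nat" and n assume r: "strict_mono r" and "P n s"
    then obtain l where "l \<in> X" "(\<lambda>i. d (f (s i) (q n)) l) \<longlonglongrightarrow> 0" by (auto simp: P_def)
    from this(1) LIMSEQ_subseq_LIMSEQ[OF this(2) r] show "P n (s \<circ> r)" by (auto simp: P_def o_def)
  qed
  then have rat: "\<exists>l\<in>X. (\<lambda>n. d (f (diagseq n) (q k)) l) \<longlonglongrightarrow> 0" for k
    using LIMSEQ_offset[of "\<lambda>n. d (f (diagseq n) (q k)) _" "Suc k"]
    by (fastforce simp: P_def o_def add.commute)
  have "\<exists>l\<in>X. (\<lambda>n. d (f (diagseq n) t) l) \<longlonglongrightarrow> 0" for t
  proof -
    have "MCauchy (\<lambda>n. f (diagseq n) t)"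
      unfolding MCauchy_def
    proof (intro conjI allI impI)
      fix \<epsilon> :: real assume "\<epsilon> > 0"
      obtain u where "u \<in> \<rat>" "t < u" "u < t + \<epsilon> / 4" using Rats_dense_in_real[of t "t + \<epsilon> / 4"] \<open>\<epsilon> > 0\<close> by auto
      then obtain k where k: "\<bar>t - q k\<bar> < \<epsilon> / 4" using q by (metis abs_minus_commute abs_of_pos diff_gt_0_iff_gt diff_less_eq add.commute imageE)
      obtain l where l: "l \<in> X" "(\<lambda>n. d (f (diagseq n) (q k)) l) \<longlonglongrightarrow> 0" using rat by blast
      obtain N where N: "\<And>n. n \<ge> N \<Longrightarrow> d (f (diagseq n) (q k)) l < \<epsilon> / 4"
        using order_tendstoD(2)[OF l(2), of "\<epsilon> / 4"] \<open>\<epsilon> > 0\<close> by (auto simp: eventually_sequentially)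
      have near: "d (f (diagseq n) t) l < \<epsilon> / 2" if "n \<ge> N" for n
        using triangle[OF inX inX l(1), of "diagseq n" t "diagseq n" "q k"] N[OF that]
          lip[of "diagseq n" t "q k"] k by linarith
      show "\<exists>N. \<forall>n n'. N \<le> n \<longrightarrow> N \<le> n' \<longrightarrow> d (f (diagseq n) t) (f (diagseq n') t) < \<epsilon>"
      proof (intro exI[of _ N] allI impI)
        fix n n' assume "N \<le> n" "N \<le> n'"
        then show "d (f (diagseq n) t) (f (diagseq n') t) < \<epsilon>"
          using triangle'[OF inX l(1) inX, of "diagseq n" t "diagseq n'" t] near[of n] near[of n'] by linarith
      qed
    qed (use inX in auto)
    \<comment> \<open>Properness supplies completeness: a Cauchy sequence of bounded values has a
      convergent subsequence, so it converges.\<close>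
    moreover obtain l r where "strict_mono r" "l \<in> X" "(\<lambda>n. d (f (diagseq (r n)) t) l) \<longlonglongrightarrow> 0"
      by (rule bounded_subsequence[of b "\<lambda>n. f (diagseq n) t" "B + \<bar>t\<bar>"]) (use b inX bound in auto)
    moreover have "limitin mtopology ((\<lambda>n. f (diagseq n) t) \<circ> r) l sequentially"
      unfolding limitin_metric_dist_null using inX calculation(3,4) by (simp add: o_def)
    ultimately have "limitin mtopology (\<lambda>n. f (diagseq n) t) l sequentially"
      using MCauchy_convergent_subsequence by blast
    then show ?thesis by (auto simp: limitin_metric_dist_null)
  qed
  then obtain g where g: "\<And>t. g t \<in> X" "\<And>t. (\<lambda>n. d (f (diagseq n) t) (g t)) \<longlonglongrightarrow> 0" by metis
  have lip_g: "d (g s) (g t) \<le> \<bar>s - t\<bar>" for s t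
    by (rule tendsto_upperbound[OF tendsto_mdist[OF _ _ g(1) g(1) g(2) g(2)]])
      (use inX lip in auto)
  show thesis
  proof (rule that[OF subseq_diagseq g])
    fix T e :: real assume "e > 0"
    \<comment> \<open>Three errors of at most h occur: from t to a grid point for \<open>f\<close>,
      convergence at the grid point, and back to t for \<open>g\<close>. The grid consists of the
      multiples of h around \<open>{-T..T}\<close>.\<close>
    define h where "h = e / 4"
    have h: "h > 0" using \<open>e > 0\<close> by (simp add: h_def)
    have "\<forall>\<^sub>F n in sequentially. \<forall>j\<in>{\<lfloor>-T / h\<rfloor>..\<lfloor>T / h\<rfloor>}. d (f (diagseq n) (of_int j * h)) (g (of_int j * h)) < h"
      using order_tendstoD(2)[OF g(2) h] by (intro eventually_ball_finite) auto
    then show "\<forall>\<^sub>F n in sequentially. \<forall>t\<in>{-T..T}. d (f (diagseq n) t) (g t) < e"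
    proof eventually_elim
      case (elim n)
      show ?case
      proof
        fix t assume t: "t \<in> {-T..T}"
        define j where "j = \<lfloor>t / h\<rfloor>"
        have j: "j \<in> {\<lfloor>-T / h\<rfloor>..\<lfloor>T / h\<rfloor>}"
          unfolding j_def using t h divide_right_mono[of "-T" t h]
          by (auto intro!: floor_mono divide_right_mono)
        have "of_int j * h \<le> t" "t \<le> (of_int j + 1) * h"
          using floor_divide_lower[OF h, of t] floor_divide_upper[OF h, of t] by (simp_all add: j_def)
        then have tj: "\<bar>t - of_int j * h\<bar> \<le> h" by (simp add: algebra_simps)
        let ?u = "of_int j * h"
        have "d (f (diagseq n) t) (g t) \<le> d (f (diagseq n) t) (f (diagseq n) ?u) + d (f (diagseq n) ?u) (g t)"
          by (intro triangle inX g(1))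
        also have "d (f (diagseq n) ?u) (g t) \<le> d (f (diagseq n) ?u) (g ?u) + d (g ?u) (g t)"
          by (intro triangle inX g(1))
        finally show "d (f (diagseq n) t) (g t) < e"
          using lip[of "diagseq n" t ?u] lip_g[of ?u t] tj bspec[OF elim j]
          unfolding h_def abs_minus_commute[of ?u t] by linarith
      qed
    qed
  qed
qed

end


section \<open>Generalized rays\<close>

locale proper_geodesic_space = proper_metric_space X d for X :: "'a set" and d +
  fixes b
  assumes base: "b \<in> X"
    and geodesic: "x \<in> X \<Longrightarrow> y \<in> X \<Longrightarrow> \<exists>\<sigma>. geodesic_on X d {0..d x y} \<sigma> \<and> \<sigma> 0 = x \<and> \<sigma> (d x y) = y"
begin

abbreviation "gray \<equiv> generalized_ray X d b"

lemma geodesic_onD: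
  assumes "geodesic_on X d I c"
  shows "s \<in> I \<Longrightarrow> c s \<in> X" "s \<in> I \<Longrightarrow> t \<in> I \<Longrightarrow> d (c s) (c t) = \<bar>s - t\<bar>"
  using assms unfolding geodesic_on_def by blast+

lemma geodesic_on_subset:
  assumes "geodesic_on X d I c" "J \<subseteq> I" "is_interval J"
  shows "geodesic_on X d J c"
  using assms unfolding geodesic_on_def by blast

text \<open>Rays and eventually constant segments are treated alike through the function
  \<open>t \<mapsto> d b (c t)\<close>, which is \<open>t\<close> or \<open>min t L\<close>.\<close>

lemma gray_properties:
  assumes "gray c x"
  shows "c 0 = b" "t \<ge> 0 \<Longrightarrow> c t \<in> X"
    "s \<ge> 0 \<Longrightarrow> t \<ge> 0 \<Longrightarrow> d (c s) (c t) = \<bar>d b (c s) - d b (c t)\<bar>"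
    "t \<ge> 0 \<Longrightarrow> d b (c t) \<le> t"
proof -
  have "c 0 = b \<and> (\<forall>t\<ge>0. c t \<in> X) \<and> (\<forall>s\<ge>0. \<forall>t\<ge>0. d (c s) (c t) = \<bar>d b (c s) - d b (c t)\<bar>) \<and>
    (\<forall>t\<ge>0. d b (c t) \<le> t)"
    using assms unfolding generalized_ray_def
  proof (elim conjE disjE exE)
    assume "c 0 = b" "c \<in> geodesic_rays X d"
    have geo: "geodesic_on X d {0..} c" using \<open>c \<in> geodesic_rays X d\<close> by (simp add: geodesic_rays_def)
    have "d (c s) (c t) = \<bar>s - t\<bar>" if "s \<ge> 0" "t \<ge> 0" for s t
      using geodesic_onD(2)[OF geo, of s t] that by simp
    moreover from this[of 0] have "d b (c t) = t" if "t \<ge> 0" for t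
      using \<open>c 0 = b\<close> that by simp
    moreover have "c t \<in> X" if "t \<ge> 0" for t
      using geodesic_onD(1)[OF geo, of t] that by simp
    ultimately show ?thesis using \<open>c 0 = b\<close> by simp
  next
    fix L assume "c 0 = b" "0 \<le> L" and geo: "geodesic_on X d {0..L} c" and const: "\<forall>t\<ge>L. c t = c L"
    have min: "c t = c (min t L)" for t
      using const[rule_format, of t] by (cases "L \<le> t") (auto simp: min_def)
    have "d b (c t) = min t L" if "t \<ge> 0" for t
      using geodesic_onD(2)[OF geo, of 0 "min t L"] \<open>c 0 = b\<close> \<open>0 \<le> L\<close> that min[of t] by auto
    moreover have "c t \<in> X" if "t \<ge> 0" for t
      using geodesic_onD(1)[OF geo, of "min t L"] \<open>0 \<le> L\<close> that min[of t] by auto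
    moreover have "d (c s) (c t) = \<bar>min s L - min t L\<bar>" if "s \<ge> 0" "t \<ge> 0" for s t
      unfolding min[of s] min[of t] by (rule geodesic_onD(2)[OF geo]) (use \<open>0 \<le> L\<close> that in auto)
    ultimately show ?thesis using \<open>c 0 = b\<close> by simp
  qed
  then show "c 0 = b" "t \<ge> 0 \<Longrightarrow> c t \<in> X"
    "s \<ge> 0 \<Longrightarrow> t \<ge> 0 \<Longrightarrow> d (c s) (c t) = \<bar>d b (c s) - d b (c t)\<bar>"
    "t \<ge> 0 \<Longrightarrow> d b (c t) \<le> t" by blast+
qed

text \<open>The length of the segment is forced to be \<open>d b p\<close>, so it can be eliminated
  from all later formulas.\<close>

lemma gray_Inl:
  assumes "gray c (Inl p)"
  shows "p \<in> X" "t \<ge> 0 \<Longrightarrow> d b (c t) = min t (d b p)" "t \<ge> d b p \<Longrightarrow> c t = p"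
proof -
  obtain L where c: "c 0 = b" "0 \<le> L" "geodesic_on X d {0..L} c" "\<forall>t\<ge>L. c t = c L" "p = c L"
    using assms unfolding generalized_ray_def by blast
  have L: "d b p = L" using geodesic_onD(2)[OF c(3), of 0 L] c(1,2,5) by simp
  show "p \<in> X" using geodesic_onD(1)[OF c(3), of L] c(2,5) by simp
  show const: "c t = p" if "t \<ge> d b p" for t
    using c(4)[rule_format, of t] c(5) L that by metis
  show "d b (c t) = min t (d b p)" if "t \<ge> 0"
  proof (cases "t \<le> L")
    case True
    have "d (c 0) (c t) = \<bar>0 - t\<bar>"
      by (rule geodesic_onD(2)[OF c(3)]) (use True that in auto)
    then show ?thesis unfolding c(1) L using True that by simp
  next
    case False
    then show ?thesis unfolding L using const[of t] L by simp
  qed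
qed

lemma gray_Inr:
  assumes "gray c (Inr \<xi>)"
  shows "c \<in> geodesic_rays X d" "\<xi> = asymptotic_rel X d `` {c}" "t \<ge> 0 \<Longrightarrow> d b (c t) = t"
proof -
  show "c \<in> geodesic_rays X d" "\<xi> = asymptotic_rel X d `` {c}"
    using assms unfolding generalized_ray_def by auto
  then show "t \<ge> 0 \<Longrightarrow> d b (c t) = t"
    using geodesic_onD(2)[of "{0..}" c 0 t] assms by (simp add: generalized_ray_def geodesic_rays_def)
qed

lemma gray_of_ray:
  assumes "c \<in> geodesic_rays X d" "c 0 = b"
  shows "gray c (Inr (asymptotic_rel X d `` {c}))"
  using assms by (simp add: generalized_ray_def)

lemma gray_exists_Inl:
  assumes "p \<in> X"
  shows "\<exists>c. gray c (Inl p)"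
proof -
  obtain \<sigma> where \<sigma>: "geodesic_on X d {0..d b p} \<sigma>" "\<sigma> 0 = b" "\<sigma> (d b p) = p"
    using geodesic[OF base assms] by blast
  have "geodesic_on X d {0..d b p} (\<lambda>t. \<sigma> (min t (d b p)))"
    using \<sigma>(1) by (auto simp: geodesic_on_def)
  then have "gray (\<lambda>t. \<sigma> (min t (d b p))) (Inl p)"
    unfolding generalized_ray_def using \<sigma>(2,3) nonneg[of b p] by (intro conjI disjI2 exI[of _ "d b p"]) auto
  then show ?thesis by blast
qed

text \<open>Converse of \<open>gray_properties\<close> and \<open>gray_profile\<close>. A limit of
  generalized rays is recognised through these distance formulas, which pass to limits, whereas
  segments may well converge to a ray.\<close>

lemma gray_of_profile:
  assumes b: "c 0 = b" and inX: "\<And>t. t \<ge> 0 \<Longrightarrow> c t \<in> X"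
    and dist: "\<And>s t. s \<ge> 0 \<Longrightarrow> t \<ge> 0 \<Longrightarrow> d (c s) (c t) = \<bar>d b (c s) - d b (c t)\<bar>"
    and profile: "(\<forall>t\<ge>0. d b (c t) = t) \<or> (\<exists>L\<ge>0. \<forall>t\<ge>0. d b (c t) = min t L)"
  shows "\<exists>x. gray c x"
  using profile
proof (elim disjE exE conjE)
  assume "\<forall>t\<ge>0. d b (c t) = t"
  then have "c \<in> geodesic_rays X d"
    using inX dist by (auto simp: geodesic_rays_def geodesic_on_def is_interval_ci)
  then show ?thesis using gray_of_ray b by blast
next
  fix L :: real assume L: "L \<ge> 0" "\<forall>t\<ge>0. d b (c t) = min t L"
  have "geodesic_on X d {0..L} c"
    using inX dist L by (auto simp: geodesic_on_def is_interval_cc)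
  moreover have "c t = c L" if "t \<ge> L" for t
  proof -
    have "d (c t) (c L) = 0" using dist[of t L] L that by simp
    then show ?thesis using inX L(1) that zero[of "c t" "c L"] by simp
  qed
  ultimately show ?thesis using b L(1) unfolding generalized_ray_def by blast
qed

lemma gray_profile:
  assumes "gray c x"
  shows "(\<forall>t\<ge>0. d b (c t) = t) \<or> (\<exists>L\<ge>0. \<forall>t\<ge>0. d b (c t) = min t L)"
proof (cases x)
  case (Inl p)
  then show ?thesis using gray_Inl[of c p] assms nonneg[of b p] by blast
next
  case (Inr \<xi>)
  then show ?thesis using gray_Inr(3)[of c \<xi>] assms by blast
qed

section \<open>Locally uniform limits of generalized rays and Gromov convergence\<close>

lemma converges_on_compacts_pointwise:
  assumes "converges_on_compacts d c c'" "t \<ge> 0"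
  shows "(\<lambda>n. d (c n t) (c' t)) \<longlonglongrightarrow> 0"
proof (rule tendstoI)
  fix e :: real assume "e > 0"
  have "\<forall>\<^sub>F n in sequentially. \<forall>t\<in>{t}. d (c n t) (c' t) < e"
    by (rule assms(1)[unfolded converges_on_compacts_def, rule_format])
      (use assms(2) \<open>e > 0\<close> in auto)
  then show "\<forall>\<^sub>F n in sequentially. dist (d (c n t) (c' t)) 0 < e"
    using nonneg by simp
qed

lemma converges_on_compacts_subseq:
  assumes "converges_on_compacts d c c'" "strict_mono r"
  shows "converges_on_compacts d (c \<circ> r) c'"
  unfolding converges_on_compacts_def
proof (intro allI impI)
  fix C :: "real set" and e :: real assume "compact C" "C \<subseteq> {0..}" "e > 0"
  then have "\<forall>\<^sub>F n in sequentially. \<forall>t\<in>C. d (c n t) (c' t) < e"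
    using assms(1) unfolding converges_on_compacts_def by blast
  from eventually_subseq[OF assms(2) this]
  show "\<forall>\<^sub>F n in sequentially. \<forall>t\<in>C. d ((c \<circ> r) n t) (c' t) < e" by simp
qed

text \<open>After Arzela-Ascoli the distance formula passes to the limit, and only the profile needs
  an argument: either the limit keeps height t at every time t, or one time at which it falls short
  determines its length.\<close>

lemma gray_convergent_subsequence:
  fixes c :: "nat \<Rightarrow> real \<Rightarrow> 'a"
  assumes gray: "\<And>n. gray (c n) (s n)"
  obtains r c' x where "strict_mono r" "gray c' x" "converges_on_compacts d (c \<circ> r) c'"
proof -
  \<comment> \<open>Constant to the left of 0, hence 1-Lipschitz on the whole line.\<close>
  define f where "f n t = c n (max 0 t)" for n t
  have lip: "d (f n s) (f n t) \<le> \<bar>s - t\<bar>" for n s t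
  proof -
    have "\<bar>d b (c n u) - d b (c n v)\<bar> \<le> \<bar>u - v\<bar>" if "u \<ge> 0" "v \<ge> 0" for u v
      using gray_profile[OF gray, of n] that by (auto simp: min_def)
    from this[of "max 0 s" "max 0 t"] gray_properties(3)[OF gray, of "max 0 s" "max 0 t" n]
    have "d (f n s) (f n t) \<le> \<bar>max 0 s - max 0 t\<bar>" by (simp add: f_def)
    also have "\<dots> \<le> \<bar>s - t\<bar>" by (simp add: max_def)
    finally show ?thesis .
  qed
  have fX: "f n t \<in> X" for n t using gray_properties(2)[OF gray] by (simp add: f_def)
  obtain r g where r: "strict_mono r" and g: "\<And>t. g t \<in> X"
    and lim: "\<And>t. (\<lambda>n. d (f (r n) t) (g t)) \<longlonglongrightarrow> 0"
    and unif: "\<And>T e. e > 0 \<Longrightarrow> \<forall>\<^sub>F n in sequentially. \<forall>t\<in>{-T..T}. d (f (r n) t) (g t) < e"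
    by (rule Arzela_Ascoli_Lipschitz[of f b 0])
      (use fX lip base gray_properties(1)[OF gray] in \<open>auto simp: f_def\<close>)
  have lim_dist: "(\<lambda>n. d (c (r n) s) (c (r n) t)) \<longlonglongrightarrow> d (g s) (g t)" if "s \<ge> 0" "t \<ge> 0" for s t
    using tendsto_mdist[OF fX fX g g lim lim, of s t] that by (simp add: f_def)
  have g0: "g 0 = b"
  proof -
    have "d b (g 0) = 0" using lim[of 0] gray_properties(1)[OF gray] by (simp add: f_def LIMSEQ_const_iff)
    then show ?thesis using zero[OF base g] by simp
  qed
  have lim_base: "(\<lambda>n. d b (c (r n) t)) \<longlonglongrightarrow> d b (g t)" if "t \<ge> 0" for t
    using lim_dist[of 0 t] that gray_properties(1)[OF gray] by (simp add: g0)
  have "\<exists>x. gray g x"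
  proof (rule gray_of_profile[of g, OF g0 g])
    fix s t :: real assume st: "s \<ge> 0" "t \<ge> 0"
    have "(\<lambda>n. d (c (r n) s) (c (r n) t)) \<longlonglongrightarrow> \<bar>d b (g s) - d b (g t)\<bar>"
      using tendsto_rabs[OF tendsto_diff[OF lim_base[OF st(1)] lim_base[OF st(2)]]]
        gray_properties(3)[OF gray st] by simp
    then show "d (g s) (g t) = \<bar>d b (g s) - d b (g t)\<bar>"
      using LIMSEQ_unique lim_dist[OF st] by blast
  next
    have le: "d b (g t) \<le> t" if "t \<ge> 0" for t
      by (rule LIMSEQ_le_const2[OF lim_base[OF that]]) (use gray_properties(4)[OF gray that] in auto)
    show "(\<forall>t\<ge>0. d b (g t) = t) \<or> (\<exists>L\<ge>0. \<forall>t\<ge>0. d b (g t) = min t L)"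
    proof (rule disjCI)
      assume "\<not> (\<exists>L\<ge>0. \<forall>t\<ge>0. d b (g t) = min t L)"
      \<comment> \<open>If the limit falls short of height T at time T, then \<open>c (r n)\<close>
        has eventually stopped before T, so \<open>d b (c (r n) T)\<close> is its length and fixes
        its whole profile; these lengths converge to \<open>?L\<close>.\<close>
      have False if T: "T \<ge> 0" "d b (g T) \<noteq> T" for T
      proof -
        let ?L = "d b (g T)"
        have L: "?L < T" using le[OF T(1)] T(2) by simp
        have ev: "\<forall>\<^sub>F n in sequentially. d b (c (r n) T) < T"
          using order_tendstoD(2)[OF lim_base[OF T(1)] L] .
        have "d b (g t) = min t ?L" if t: "t \<ge> 0" for t
        proof (rule LIMSEQ_unique[OF lim_base[OF t]])
          have "\<forall>\<^sub>F n in sequentially. min t (d b (c (r n) T)) = d b (c (r n) t)"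
            using ev
          proof eventually_elim
            case (elim n)
            then obtain L where "d b (c (r n) T) = min T L" "d b (c (r n) t) = min t L"
              using gray_profile[OF gray, of "r n"] T(1) t by (metis less_irrefl)
            then show ?case using elim by simp
          qed
          then show "(\<lambda>n. d b (c (r n) t)) \<longlonglongrightarrow> min t ?L"
            by (rule Lim_transform_eventually[rotated]) (intro tendsto_min tendsto_const lim_base T(1))
        qed
        then show False
          using \<open>\<not> (\<exists>L\<ge>0. \<forall>t\<ge>0. d b (g t) = min t L)\<close> nonneg[of b "g T"] by blast
      qed
      then show "\<forall>t\<ge>0. d b (g t) = t" by blast
    qed
  qed
  then obtain x where x: "gray g x" ..
  have "converges_on_compacts d (c \<circ> r) g"
    unfolding converges_on_compacts_def
  proof (intro allI impI)
    fix C :: "real set" and e :: real assume C: "compact C" "C \<subseteq> {0..}" and "e > 0"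
    obtain T where T: "\<And>t. t \<in> C \<Longrightarrow> \<bar>t\<bar> \<le> T" using compact_imp_bounded[OF C(1)] unfolding bounded_real by blast
    show "\<forall>\<^sub>F n in sequentially. \<forall>t\<in>C. d ((c \<circ> r) n t) (g t) < e"
      using unif[OF \<open>e > 0\<close>, of T]
    proof eventually_elim
      case (elim n)
      show ?case
      proof
        fix t assume t: "t \<in> C"
        then have "t \<in> {-T..T}" using T[OF t] by auto
        then show "d ((c \<circ> r) n t) (g t) < e" using elim t C(2) by (force simp: f_def)
      qed
    qed
  qed
  then show thesis using that r x by blast
qed

lemma gromov_convergesI:
  assumes "\<And>n. gray (c n) (s n)" "gray c' x" "converges_on_compacts d c c'"
  shows "gromov_converges X d b s x"
  unfolding gromov_converges_def
proof (intro exI[of _ c] conjI allI impI)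
  fix r :: "nat \<Rightarrow> nat" assume r: "strict_mono r"
  then show "\<exists>(r' :: nat \<Rightarrow> nat) c'. strict_mono r' \<and> gray c' x \<and> converges_on_compacts d (c \<circ> r \<circ> r') c'"
    using assms converges_on_compacts_subseq[OF assms(3) r]
    by (intro exI[of _ id] exI[of _ c']) (simp add: strict_mono_def)
qed (rule assms)

text \<open>The definition guarantees locally uniform convergence only along further subsequences.
  One of them is enough wherever limits are identified subsequence by subsequence.\<close>

lemma gromov_convergesD:
  assumes "gromov_converges X d b s x"
  obtains r c c' where "strict_mono (r :: nat \<Rightarrow> nat)" "\<And>n. gray (c n) (s (r n))" "gray c' x"
    "converges_on_compacts d c c'"
proof -
  obtain c where c: "\<forall>n. gray (c n) (s n)"
    and sub: "\<And>r::nat \<Rightarrow> nat. strict_mono r \<Longrightarrow> \<exists>(r'::nat \<Rightarrow> nat) c'. strict_mono r' \<and> gray c' x \<and>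
                converges_on_compacts d (c \<circ> r \<circ> r') c'"
    using assms unfolding gromov_converges_def by blast
  obtain r' :: "nat \<Rightarrow> nat" and c' where "strict_mono r'" "gray c' x" "converges_on_compacts d (c \<circ> id \<circ> r') c'"
    using sub[of id] by (auto simp: strict_mono_def)
  then show thesis using c that[of r' "c \<circ> r'" c'] by simp
qed

text \<open>If the sequence left an open set infinitely often, a subsequence in the complement would
  still converge to x, against sequential closedness of the complement.\<close>

lemma gromov_converges_limitin:
  assumes "gromov_converges X d b s x" "\<And>n. s n \<in> gromov_bar X d" "x \<in> gromov_bar X d"
  shows "limitin (gromov_topology X d b) s x sequentially"
  unfolding limitin_def topspace_gromov_topology
proof (intro conjI allI impI assms(3))
  fix U assume U: "openin (gromov_topology X d b) U \<and> x \<in> U"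
  show "\<forall>\<^sub>F n in sequentially. s n \<in> U"
  proof (rule ccontr)
    assume "\<not> ?thesis"
    then have inf: "infinite {n. s n \<notin> U}"
      by (metis (mono_tags, lifting) MOST_iff_cofinite Collect_cong INFM_iff_infinite cofinite_eq_sequentially not_eventually frequently_cofinite)
    let ?q = "enumerate {n. s n \<notin> U}"
    have "strict_mono ?q" using inf by (rule strict_mono_enumerate)
    from gromov_converges_subseq[OF assms(1) this] have "gromov_converges X d b (s \<circ> ?q) x" .
    moreover have "\<forall>n. (s \<circ> ?q) n \<in> gromov_bar X d - U"
      using assms(2) enumerate_in_set[OF inf] by auto
    ultimately show False using U unfolding openin_gromov_topology gromov_open_def by blast
  qed
qed

lemma geodesic_rays_equiv: "equiv (geodesic_rays X d) (asymptotic_rel X d)"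
proof (rule equivI)
  have inX: "c t \<in> X" if "c \<in> geodesic_rays X d" "t \<ge> 0" for c t
    using that by (auto simp: geodesic_rays_def geodesic_on_def)
  show "asymptotic_rel X d \<subseteq> geodesic_rays X d \<times> geodesic_rays X d"
    by (auto simp: asymptotic_rel_def)
  show "refl_on (geodesic_rays X d) (asymptotic_rel X d)"
    using inX by (intro refl_onI) (auto simp: asymptotic_rel_def intro!: exI[of _ 0])
  show "sym (asymptotic_rel X d)"
    by (intro symI) (auto simp: asymptotic_rel_def commute)
  show "trans (asymptotic_rel X d)"
  proof (rule transI)
    fix c1 c2 c3 assume "(c1, c2) \<in> asymptotic_rel X d" "(c2, c3) \<in> asymptotic_rel X d"
    then obtain B B' where c: "c1 \<in> geodesic_rays X d" "c2 \<in> geodesic_rays X d" "c3 \<in> geodesic_rays X d"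
      and B: "\<forall>t\<ge>0. d (c1 t) (c2 t) \<le> B" "\<forall>t\<ge>0. d (c2 t) (c3 t) \<le> B'"
      by (auto simp: asymptotic_rel_def)
    have "d (c1 t) (c3 t) \<le> B + B'" if t: "t \<ge> 0" for t
      using triangle[OF inX[OF c(1) t] inX[OF c(2) t] inX[OF c(3) t]] B t by fastforce
    then show "(c1, c3) \<in> asymptotic_rel X d" using c by (auto simp: asymptotic_rel_def)
  qed
qed

lemma asymptotic_class_eq_iff:
  assumes "c \<in> geodesic_rays X d" "c' \<in> geodesic_rays X d"
  shows "asymptotic_rel X d `` {c} = asymptotic_rel X d `` {c'} \<longleftrightarrow> (\<exists>B. \<forall>t\<ge>0. d (c t) (c' t) \<le> B)"
  using eq_equiv_class_iff[OF geodesic_rays_equiv assms] assms by (auto simp: asymptotic_rel_def)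

end


section \<open>Hyperbolicity\<close>

lemma tendsto_via_subsequences:
  fixes s :: "nat \<Rightarrow> 'a :: metric_space"
  assumes "\<And>r :: nat \<Rightarrow> nat. strict_mono r \<Longrightarrow> \<exists>r'. strict_mono r' \<and> (s \<circ> r \<circ> r') \<longlonglongrightarrow> l"
  shows "s \<longlonglongrightarrow> l"
proof (rule ccontr)
  assume "\<not> s \<longlonglongrightarrow> l"
  then obtain e where "e > 0" and not: "\<not> (\<forall>\<^sub>F n in sequentially. dist (s n) l < e)"
    unfolding tendsto_iff by blast
  have inf: "infinite {n. \<not> dist (s n) l < e}"
    using not unfolding cofinite_eq_sequentially[symmetric] eventually_cofinite .
  define r where "r = enumerate {n. \<not> dist (s n) l < e}"
  have far: "\<not> dist (s (r n)) l < e" for n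
    using enumerate_in_set[OF inf, of n] by (simp add: r_def)
  obtain r' where "(s \<circ> r \<circ> r') \<longlonglongrightarrow> l"
    using assms[of r] strict_mono_enumerate[OF inf] unfolding r_def by blast
  then have "\<forall>\<^sub>F n in sequentially. dist ((s \<circ> r \<circ> r') n) l < e" using \<open>e > 0\<close> by (rule tendstoD)
  then show False using far by (simp add: eventually_sequentially)
qed

context proper_geodesic_space
begin

lemma gromov_product_le:
  assumes "x \<in> X" "y \<in> X"
  shows "gromov_product d b x y \<le> d b x" "gromov_product d b x y \<le> d b y"
    "0 \<le> gromov_product d b x y"
  using triangle[OF base assms(1,2)] triangle[OF base assms(2,1)] triangle[OF assms(1) base assms(2)]
    commute[of x y] commute[of x b]
  unfolding gromov_product_def by simp_all

lemma gray_lim_dist_base: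
  assumes gray: "\<And>n. gray (c n) (s n)" "gray c' x" and conv: "converges_on_compacts d c c'"
    and "t \<ge> 0"
  shows "(\<lambda>n. d b (c n t)) \<longlonglongrightarrow> d b (c' t)"
  using tendsto_mdist[of "\<lambda>n. b" "\<lambda>n. c n t" b "c' t" sequentially]
    gray_properties(2)[OF gray(1) \<open>t \<ge> 0\<close>] gray_properties(2)[OF gray(2) \<open>t \<ge> 0\<close>] base
    converges_on_compacts_pointwise[OF conv \<open>t \<ge> 0\<close>] by simp

text \<open>A segment ending at p stops at height \<open>d b p\<close>, whereas the limit attains
  every height; time \<open>d b p + 1\<close> tells them apart.\<close>

lemma limit_is_ray:
  assumes gray: "\<And>n. gray (c n) (s n)" "gray c' x" and conv: "converges_on_compacts d c c'"
    and long: "\<And>T. T \<ge> 0 \<Longrightarrow> \<forall>\<^sub>F n in sequentially. d b (c n T) = T"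
  obtains \<xi> where "x = Inr \<xi>"
proof (cases x)
  case (Inl p)
  have "d b (c' T) = T" if "T \<ge> 0" for T
    by (rule LIMSEQ_unique[OF gray_lim_dist_base[OF gray conv that]])
      (rule tendsto_eventually[OF long[OF that]])
  from this[of "d b p + 1"] gray_Inl(2)[of c' p "d b p + 1"] gray(2)
  show ?thesis unfolding Inl by simp
qed (use that in blast)

lemma geodesic_rayD:
  assumes "c \<in> geodesic_rays X d"
  shows "t \<ge> 0 \<Longrightarrow> c t \<in> X" "s \<ge> 0 \<Longrightarrow> t \<ge> 0 \<Longrightarrow> d (c s) (c t) = \<bar>s - t\<bar>"
  using assms geodesic_onD[of "{0..}" c] by (simp_all add: geodesic_rays_def)

end

section \<open>Consequences of the four-point inequality\<close>

locale hyperbolic_space = proper_geodesic_space X d b for X :: "'a set" and d b +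
  fixes \<delta> :: real
  assumes \<delta>_nonneg: "0 \<le> \<delta>"
    and hyperbolic: "w \<in> X \<Longrightarrow> x \<in> X \<Longrightarrow> y \<in> X \<Longrightarrow> z \<in> X \<Longrightarrow>
      min (gromov_product d w x y) (gromov_product d w y z) - \<delta> \<le> gromov_product d w x z"
begin

text \<open>At the balanced point z both products equal half of \<open>d b z + (x|y)\<close>, so the
  inequality becomes \<open>d b z \<le> (x|y) + 2 * \<delta>\<close>. This takes the role of thin
  triangles: a geodesic far from \<open>b\<close> has endpoints with large product, and a bounded
  product anchors a geodesic near \<open>b\<close>.\<close>

lemma geodesic_near_base:
  assumes geo: "geodesic_on X d {s..t} \<sigma>" and "s \<le> t"
  obtains u where "u \<in> {s..t}" "d b (\<sigma> u) \<le> gromov_product d b (\<sigma> s) (\<sigma> t) + 2 * \<delta>"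
proof -
  let ?x = "\<sigma> s" and ?y = "\<sigma> t"
  have xy: "?x \<in> X" "?y \<in> X" "d ?x ?y = t - s" using geodesic_onD[OF geo] \<open>s \<le> t\<close> by auto
  \<comment> \<open>The point \<open>z\<close> of \<open>[x, y]\<close> with \<open>(x|z) = (z|y)\<close>, so that the minimum in the
    hyperbolicity inequality is their average.\<close>
  define u where "u = s + (t - s + d b ?x - d b ?y) / 2"
  have u: "s \<le> u" "u \<le> t"
    using triangle[OF base xy(1,2)] triangle[OF base xy(2,1)] xy(3) commute[of ?y ?x]
    by (simp_all add: u_def field_simps)
  have z: "\<sigma> u \<in> X" "d ?x (\<sigma> u) = u - s" "d (\<sigma> u) ?y = t - u"
    using geodesic_onD[OF geo] u by auto
  have "d b (\<sigma> u) \<le> gromov_product d b ?x ?y + 2 * \<delta>"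
    using hyperbolic[OF base xy(1) z(1) xy(2)] z(2,3) xy(3)
    by (simp add: gromov_product_def u_def min_def field_simps split: if_splits)
  then show thesis using that u by auto
qed

text \<open>Here z is the middle point of the four-point inequality; solving the product for the
  distance doubles the loss \<open>\<delta>\<close>.\<close>

lemma dist_le_gromov_product:
  assumes "x \<in> X" "y \<in> X" "z \<in> X" "m \<le> gromov_product d b x z" "m \<le> gromov_product d b z y"
  shows "d x y \<le> d b x + d b y - 2 * m + 2 * \<delta>"
proof -
  have "m - \<delta> \<le> gromov_product d b x y" using hyperbolic[OF base assms(1,3,2)] assms(4,5) by linarith
  then show ?thesis by (simp add: gromov_product_def)
qed

text \<open>The points p and q sit at height t on geodesics from \<open>b\<close> to x and y, so the
  products of p with x, x with y and y with q are all at least t. Two uses of the four-point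
  inequality lose \<open>\<delta>\<close> each in the product, which doubles in the
  distance.\<close>

lemma fellow_travel:
  assumes X: "x \<in> X" "y \<in> X" "p \<in> X" "q \<in> X"
    and p: "d b p = t" "d b x = t + d p x" and q: "d b q = t" "d b y = t + d q y"
    and t: "t \<le> gromov_product d b x y"
  shows "d p q \<le> 4 * \<delta>"
proof -
  have px: "gromov_product d b p x = t" using p by (simp add: gromov_product_def)
  have yq: "gromov_product d b y q = t" using q by (simp add: gromov_product_def commute)
  have "min t t - \<delta> \<le> gromov_product d b x q"
    using hyperbolic[OF base X(1,2,4)] t yq by linarith
  then have "d p q \<le> d b p + d b q - 2 * (t - \<delta>) + 2 * \<delta>"
    by (intro dist_le_gromov_product[of p q x]) (use X px \<delta>_nonneg in auto)
  then show ?thesis using p q by simp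
qed

text \<open>The point y lies at height t on a geodesic from \<open>b\<close> to z, and x does so up
  to the error E. Both products with z are at least \<open>t - E\<close>, whence the bound
  \<open>(t + E) + t - 2 * (t - E) + 2 * \<delta>\<close>.\<close>

lemma asymptotic_bound:
  assumes X: "x \<in> X" "y \<in> X" "z \<in> X" and "E \<ge> 0"
    and x: "t - E \<le> d b x" "d b x \<le> t + E" "d x z \<le> d b z + E - t"
    and y: "d b y = t" "d y z = d b z - t"
  shows "d x y \<le> 3 * E + 2 * \<delta>"
proof -
  have "t - E \<le> gromov_product d b x z" using x by (simp add: gromov_product_def)
  moreover have "t - E \<le> gromov_product d b z y"
    using y \<open>E \<ge> 0\<close> by (simp add: gromov_product_def commute[of z y])
  ultimately have "d x y \<le> d b x + d b y - 2 * (t - E) + 2 * \<delta>"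
    by (rule dist_le_gromov_product[OF X])
  then show ?thesis using x y by (simp add: algebra_simps)
qed

text \<open>The ray starts at distance D from \<open>b\<close>; up to the error D it is therefore a
  geodesic from \<open>b\<close> to any of its far points z. By \<open>asymptotic_bound\<close> its
  point at time T is close to the segment from \<open>b\<close> to z at time T, uniformly in z and
  T, and this passes to the limit ray.\<close>

lemma limit_along_ray:
  assumes \<gamma>: "\<gamma> \<in> geodesic_rays X d" and t: "filterlim t at_top sequentially" "\<And>n. t n \<ge> 0"
    and gray: "\<And>n. gray (c n) (Inl (\<gamma> (t n)))" "gray c' x" and conv: "converges_on_compacts d c c'"
  shows "x = Inr (asymptotic_rel X d `` {\<gamma>})"
proof -
  define D where "D = d b (\<gamma> 0)"
  have D: "D \<ge> 0" by (simp add: D_def)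
  have low: "u - D \<le> d b (\<gamma> u)" and high: "d b (\<gamma> u) \<le> u + D" if "u \<ge> 0" for u
    using triangle[OF base geodesic_rayD(1)[OF \<gamma>, of 0] geodesic_rayD(1)[OF \<gamma> that]]
      triangle[OF geodesic_rayD(1)[OF \<gamma>, of 0] base geodesic_rayD(1)[OF \<gamma> that]]
      geodesic_rayD(2)[OF \<gamma>, of 0 u] that commute[of b "\<gamma> 0"] by (simp_all add: D_def)
  have ev: "\<forall>\<^sub>F n in sequentially. T + D \<le> t n" for T
    using t(1) unfolding filterlim_at_top by blast
  have "\<forall>\<^sub>F n in sequentially. d b (c n T) = T" if "T \<ge> 0" for T
    using ev[of T]
  proof eventually_elim
    case (elim n)
    then show ?case using gray_Inl(2)[OF gray(1) that, of n] low[OF t(2), of n] by simp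
  qed
  then obtain \<xi> where \<xi>: "x = Inr \<xi>" using limit_is_ray[OF gray conv] by blast
  have c': "c' \<in> geodesic_rays X d" "\<xi> = asymptotic_rel X d `` {c'}"
    using gray_Inr(1,2) gray(2) unfolding \<xi> by blast+
  have "d (\<gamma> T) (c' T) \<le> 3 * D + 2 * \<delta>" if T: "T \<ge> 0" for T
  proof (rule tendsto_upperbound)
    show "(\<lambda>n. d (\<gamma> T) (c n T)) \<longlonglongrightarrow> d (\<gamma> T) (c' T)"
      using tendsto_mdist[of "\<lambda>n. \<gamma> T" "\<lambda>n. c n T" "\<gamma> T" "c' T" sequentially]
        geodesic_rayD(1)[OF \<gamma> T] gray_properties(2)[OF gray(1) T] gray_properties(2)[OF gray(2) T]
        converges_on_compacts_pointwise[OF conv T] by simp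
    show "\<forall>\<^sub>F n in sequentially. d (\<gamma> T) (c n T) \<le> 3 * D + 2 * \<delta>"
      using ev[of T]
    proof eventually_elim
      case (elim n)
      let ?z = "\<gamma> (t n)"
      have z: "?z \<in> X" using geodesic_rayD(1)[OF \<gamma> t(2)] .
      have Tz: "T \<le> d b ?z" using low[OF t(2), of n] elim by simp
      have cT: "d b (c n T) = T" using gray_Inl(2)[OF gray(1) T, of n] Tz by simp
      have cz: "c n (d b ?z) = ?z" using gray_Inl(3)[OF gray(1)] by simp
      have "d (c n T) ?z = d b ?z - T"
        using gray_properties(3)[OF gray(1) T, of "d b ?z" n] cT Tz unfolding cz by simp
      moreover have "d (\<gamma> T) ?z \<le> d b ?z + D - T"
        using geodesic_rayD(2)[OF \<gamma> T t(2), of n] low[OF t(2), of n] elim D by simp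
      ultimately show ?case
        using asymptotic_bound[OF geodesic_rayD(1)[OF \<gamma> T] gray_properties(2)[OF gray(1) T] z D]
          low[OF T] high[OF T] cT by blast
    qed
  qed simp
  then have "asymptotic_rel X d `` {\<gamma>} = asymptotic_rel X d `` {c'}"
    using asymptotic_class_eq_iff[OF \<gamma> c'(1)] by blast
  then show ?thesis using \<xi> c'(2) by simp
qed

text \<open>A class may have been given by a ray starting elsewhere; limits of the segments from
  \<open>b\<close> to points of that ray yield a representative from \<open>b\<close>.\<close>

lemma gray_exists:
  assumes "x \<in> gromov_bar X d"
  shows "\<exists>c. gray c x"
proof (cases x)
  case (Inl p)
  then have "p \<in> X" using assms by (auto simp: gromov_bar_def)
  then show ?thesis using gray_exists_Inl Inl by blast
next
  case (Inr \<xi>)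
  then have "\<xi> \<in> gromov_boundary X d" using assms by (auto simp: gromov_bar_def)
  then obtain \<gamma> where \<gamma>: "\<gamma> \<in> geodesic_rays X d" "\<xi> = asymptotic_rel X d `` {\<gamma>}"
    unfolding gromov_boundary_def by (rule quotientE)
  have "\<exists>c. gray c (Inl (\<gamma> (real n)))" for n
    by (rule gray_exists_Inl) (rule geodesic_rayD(1)[OF \<gamma>(1)], simp)
  then obtain c where c: "\<And>n. gray (c n) (Inl (\<gamma> (real n)))" by metis
  obtain r c' y where r: "strict_mono r" and c': "gray c' y" "converges_on_compacts d (c \<circ> r) c'"
    by (rule gray_convergent_subsequence[OF c])
  have "filterlim (\<lambda>n. real (r n)) at_top sequentially"
    using filterlim_compose[OF filterlim_real_sequentially filterlim_subseq[OF r]] .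
  then have "y = Inr \<xi>"
    unfolding \<gamma>(2) by (rule limit_along_ray[OF \<gamma>(1) _ _ _ c'(1) c'(2)]) (use c in auto)
  then show ?thesis using c'(1) Inr by blast
qed

lemma gromov_bar_seq_compact:
  assumes "\<And>n. s n \<in> gromov_bar X d"
  obtains r x where "strict_mono (r :: nat \<Rightarrow> nat)" "x \<in> gromov_bar X d" "gromov_converges X d b (s \<circ> r) x"
proof -
  have "\<forall>n. \<exists>c. gray c (s n)" using gray_exists assms by blast
  from choice[OF this] obtain c where "\<forall>n. gray (c n) (s n)" by (rule exE)
  then have c: "gray (c n) (s n)" for n by (rule spec)
  obtain r c' x where r: "strict_mono r" and c': "gray c' x" "converges_on_compacts d (c \<circ> r) c'"
    by (rule gray_convergent_subsequence[OF c])
  have "gromov_converges X d b (s \<circ> r) x"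
    by (rule gromov_convergesI[OF _ c']) (use c in auto)
  then show thesis using that r generalized_ray_in_gromov_bar[OF c'(1)] by blast
qed

text \<open>Once the product exceeds T, both segments are at least T long and are within
  \<open>4 * \<delta>\<close> of each other at time T. With T fixed and n growing, the limit rays
  inherit this bound at every T, so they are asymptotic.\<close>

lemma limits_eq_of_gromov_product:
  assumes gray: "\<And>n. gray (c n) (Inl (x n))" "gray c' \<xi>" and conv: "converges_on_compacts d c c'"
    and gray2: "\<And>n. gray (e n) (Inl (y n))" "gray e' \<eta>" and conv2: "converges_on_compacts d e e'"
    and gp: "filterlim (\<lambda>n. gromov_product d b (x n) (y n)) at_top sequentially"
  shows "\<xi> = \<eta>"
proof -
  have X: "x n \<in> X" "y n \<in> X" for n using gray_Inl(1) gray(1) gray2(1) by blast+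
  have ev: "\<forall>\<^sub>F n in sequentially. T \<le> gromov_product d b (x n) (y n)" for T
    using gp unfolding filterlim_at_top by blast
  have long: "\<forall>\<^sub>F n in sequentially. d b (c n T) = T" "\<forall>\<^sub>F n in sequentially. d b (e n T) = T"
    if T: "T \<ge> 0" for T
  proof -
    show "\<forall>\<^sub>F n in sequentially. d b (c n T) = T"
      using ev[of T]
    proof eventually_elim
      case (elim n)
      then show ?case using gray_Inl(2)[OF gray(1) T, of n] gromov_product_le(1)[OF X, of n n] by simp
    qed
    show "\<forall>\<^sub>F n in sequentially. d b (e n T) = T"
      using ev[of T]
    proof eventually_elim
      case (elim n)
      then show ?case using gray_Inl(2)[OF gray2(1) T, of n] gromov_product_le(2)[OF X, of n n] by simp
    qed
  qed
  obtain \<xi>' where \<xi>: "\<xi> = Inr \<xi>'" using limit_is_ray[OF gray conv long(1)] by blast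
  obtain \<eta>' where \<eta>: "\<eta> = Inr \<eta>'" using limit_is_ray[OF gray2 conv2 long(2)] by blast
  have c': "c' \<in> geodesic_rays X d" "\<xi>' = asymptotic_rel X d `` {c'}"
    using gray_Inr(1,2) gray(2) unfolding \<xi> by blast+
  have e': "e' \<in> geodesic_rays X d" "\<eta>' = asymptotic_rel X d `` {e'}"
    using gray_Inr(1,2) gray2(2) unfolding \<eta> by blast+
  have "d (c' T) (e' T) \<le> 4 * \<delta>" if T: "T \<ge> 0" for T
  proof (rule tendsto_upperbound)
    show "(\<lambda>n. d (c n T) (e n T)) \<longlonglongrightarrow> d (c' T) (e' T)"
      by (intro tendsto_mdist converges_on_compacts_pointwise[OF conv T]
          converges_on_compacts_pointwise[OF conv2 T])
        (use gray_properties(2)[OF _ T] gray gray2 in blast)+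
    show "\<forall>\<^sub>F n in sequentially. d (c n T) (e n T) \<le> 4 * \<delta>"
      using ev[of T] long[OF T]
    proof eventually_elim
      case (elim n)
      have cx: "c n (d b (x n)) = x n" "e n (d b (y n)) = y n"
        using gray_Inl(3) gray(1) gray2(1) by blast+
      have "T \<le> d b (x n)" "T \<le> d b (y n)" using gromov_product_le(1,2)[OF X, of n n] elim by auto
      then have "d (c n T) (x n) = d b (x n) - T" "d (e n T) (y n) = d b (y n) - T"
        using gray_properties(3)[OF gray(1) T, of "d b (x n)" n] elim(2)
          gray_properties(3)[OF gray2(1) T, of "d b (y n)" n] elim(3) unfolding cx by auto
      then show ?case
        by (intro fellow_travel[OF X gray_properties(2)[OF gray(1) T] gray_properties(2)[OF gray2(1) T]])
          (use elim in auto)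
    qed
  qed simp
  then show ?thesis
    using asymptotic_class_eq_iff[OF c'(1) e'(1)] \<xi> \<eta> c'(2) e'(2) by auto
qed

text \<open>Otherwise every T is exceeded by the product of some later pair of points, and
  \<open>fellow_travel\<close> keeps the rays within \<open>4 * \<delta>\<close> at every time T,
  making them asymptotic.\<close>

lemma gromov_product_bounded:
  assumes c1: "gray c1 (Inr \<xi>)" and c2: "gray c2 (Inr \<eta>)" and "\<xi> \<noteq> \<eta>"
  obtains G where "\<And>t. t \<ge> 0 \<Longrightarrow> gromov_product d b (c1 t) (c2 t) \<le> G"
proof (rule ccontr)
  assume "\<not> thesis"
  then have unbounded: "\<exists>t\<ge>0. G < gromov_product d b (c1 t) (c2 t)" for G
    using that by (meson not_le)
  have "d (c1 T) (c2 T) \<le> 4 * \<delta>" if T: "T \<ge> 0" for T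
  proof -
    obtain t where t: "t \<ge> 0" "T < gromov_product d b (c1 t) (c2 t)" using unbounded by blast
    note X = gray_properties(2)[OF c1] gray_properties(2)[OF c2]
    have "T \<le> t" using gromov_product_le(1)[OF X(1)[OF t(1)] X(2)[OF t(1)]] gray_Inr(3)[OF c1 t(1)] t(2) by simp
    then show ?thesis
      by (intro fellow_travel[OF X(1)[OF t(1)] X(2)[OF t(1)] X(1)[OF T] X(2)[OF T], of T])
        (use gray_Inr(3)[OF c1] gray_Inr(3)[OF c2] gray_properties(3)[OF c1 T t(1)]
          gray_properties(3)[OF c2 T t(1)] t T in auto)
  qed
  then have "\<xi> = \<eta>"
    using asymptotic_class_eq_iff[OF gray_Inr(1)[OF c1] gray_Inr(1)[OF c2]] gray_Inr(2)[OF c1] gray_Inr(2)[OF c2]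
    by blast
  then show False using \<open>\<xi> \<noteq> \<eta>\<close> by blast
qed

text \<open>The segments from \<open>c1 n\<close> to \<open>c2 n\<close> all pass within E of
  \<open>b\<close>. With time 0 placed there, their parameter intervals exhaust the real line, and
  Arzela-Ascoli gives a limit line. Its ends are compared with \<open>c1\<close> and
  \<open>c2\<close> by \<open>asymptotic_bound\<close>, with the endpoints of the segments as far
  points.\<close>

theorem line_between_boundary_points:
  assumes c1: "gray c1 (Inr \<xi>)" and c2: "gray c2 (Inr \<eta>)" and "\<xi> \<noteq> \<eta>"
  obtains \<sigma> where "geodesic_on X d UNIV \<sigma>"
    "asymptotic_rel X d `` {\<lambda>t. \<sigma> (- t)} = \<xi>" "asymptotic_rel X d `` {\<sigma>} = \<eta>"
    "(\<lambda>t. \<sigma> (- t)) \<in> geodesic_rays X d" "\<sigma> \<in> geodesic_rays X d"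
proof -
  note c1X = gray_properties(2)[OF c1] and c2X = gray_properties(2)[OF c2]
  obtain G where G: "\<And>t. t \<ge> 0 \<Longrightarrow> gromov_product d b (c1 t) (c2 t) \<le> G"
    by (rule gromov_product_bounded[OF assms]) (rule that)
  \<comment> \<open>The bound of \<open>geodesic_near_base\<close> for products at most G. It is
    also the error with which the segments are seen as geodesics issuing from
    \<open>b\<close>.\<close>
  define E where "E = G + 2 * \<delta>"
  have "0 \<le> G" using G[of 0] gromov_product_le(3)[OF c1X c2X, of 0 0] by simp
  then have E: "0 \<le> E" using \<delta>_nonneg by (simp add: E_def)
  define L where "L n = d (c1 (real n)) (c2 (real n))" for n :: nat
  have L0: "0 \<le> L n" for n by (simp add: L_def)
  have "\<exists>\<tau>. geodesic_on X d {0..L n} \<tau> \<and> \<tau> 0 = c1 (real n) \<and> \<tau> (L n) = c2 (real n)" for n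
    unfolding L_def by (intro geodesic c1X c2X) auto
  then obtain \<tau> where \<tau>: "\<And>n. geodesic_on X d {0..L n} (\<tau> n)" "\<And>n. \<tau> n 0 = c1 (real n)"
    "\<And>n. \<tau> n (L n) = c2 (real n)" by metis
  have "\<exists>u\<in>{0..L n}. d b (\<tau> n u) \<le> E" for n
  proof -
    obtain u where "u \<in> {0..L n}" "d b (\<tau> n u) \<le> gromov_product d b (\<tau> n 0) (\<tau> n (L n)) + 2 * \<delta>"
      by (rule geodesic_near_base[OF \<tau>(1) L0])
    then show ?thesis using G[of "real n"] unfolding \<tau>(2,3) E_def by force
  qed
  then obtain u where u: "\<And>n. u n \<in> {0..L n}" "\<And>n. d b (\<tau> n (u n)) \<le> E" by metis
  \<comment> \<open>Clamping the parameter stops the path at its ends: it becomes 1-Lipschitz on the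
    whole line and remains isometric on \<open>{-u n..L n - u n}\<close>.\<close>
  define f where "f n t = \<tau> n (max 0 (min (L n) (t + u n)))" for n t
  have in_dom: "max 0 (min (L n) t) \<in> {0..L n}" for n t using L0 by simp
  have fX: "f n t \<in> X" for n t unfolding f_def by (rule geodesic_onD(1)[OF \<tau>(1) in_dom])
  have f_dist: "d (f n s) (f n t) = \<bar>max 0 (min (L n) (s + u n)) - max 0 (min (L n) (t + u n))\<bar>" for n s t
    unfolding f_def by (rule geodesic_onD(2)[OF \<tau>(1) in_dom in_dom])
  have f0: "f n 0 = \<tau> n (u n)" for n using u(1)[of n] by (simp add: f_def)
  have f_left: "f n (- u n) = c1 (real n)" for n using \<tau>(2) L0 by (simp add: f_def)
  have f_right: "f n (L n - u n) = c2 (real n)" for n using \<tau>(3) L0 by (simp add: f_def)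
  have f_lip: "d (f n s) (f n t) \<le> \<bar>s - t\<bar>" for n s t
    unfolding f_dist by (simp add: max_def min_def)
  have f_iso: "d (f n s) (f n t) = \<bar>s - t\<bar>" if "s \<in> {-u n..L n - u n}" "t \<in> {-u n..L n - u n}" for n s t
    unfolding f_dist using that by (simp add: max_def min_def)
  have f_base: "d b (f n 0) \<le> E" for n using u(2) by (simp add: f0)
  have c1n: "d b (c1 (real n)) = real n" and c2n: "d b (c2 (real n)) = real n" for n
    using gray_Inr(3)[OF c1] gray_Inr(3)[OF c2] by simp_all
  \<comment> \<open>The endpoints have height n and the point at time 0 has height at most E, so
    each half of the segment has length n up to E.\<close>
  have u_bounds: "real n - E \<le> u n" "u n \<le> real n + E" for n
    using triangle[OF base fX[of n 0] c1X[of "real n"]]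
      triangle[OF fX[of n 0] base c1X[of "real n"]] f_iso[of 0 n "- u n"] u(1)[of n]
      f_base[of n] c1n[of n] f_left[of n] commute[of b "f n 0"] by simp_all
  have Lu_bounds: "real n - E \<le> L n - u n" "L n - u n \<le> real n + E" for n
    using triangle[OF base fX[of n 0] c2X[of "real n"]]
      triangle[OF fX[of n 0] base c2X[of "real n"]] f_iso[of 0 n "L n - u n"] u(1)[of n]
      f_base[of n] c2n[of n] f_right[of n] commute[of b "f n 0"] by simp_all
  obtain r \<sigma> where r: "strict_mono r" and \<sigma>X: "\<And>t. \<sigma> t \<in> X"
    and lim: "\<And>t. (\<lambda>n. d (f (r n) t) (\<sigma> t)) \<longlonglongrightarrow> 0"
    by (rule Arzela_Ascoli_Lipschitz[of f, OF fX f_lip base f_base]) (rule that)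
  have ev: "\<forall>\<^sub>F n in sequentially. \<bar>t\<bar> + E \<le> real (r n)" for t
    using filterlim_compose[OF filterlim_real_sequentially filterlim_subseq[OF r]]
    unfolding filterlim_at_top by blast
  have dom: "t \<in> {-u n..L n - u n}" if "\<bar>t\<bar> + E \<le> real n" for t n
    using that u_bounds(1)[of n] Lu_bounds(1)[of n] by auto
  have \<sigma>_dist: "d (\<sigma> s) (\<sigma> t) = \<bar>s - t\<bar>" for s t
  proof (rule LIMSEQ_unique[OF tendsto_mdist[OF fX fX \<sigma>X \<sigma>X lim lim]], rule tendsto_eventually)
    show "\<forall>\<^sub>F n in sequentially. d (f (r n) s) (f (r n) t) = \<bar>s - t\<bar>"
      using ev[of s] ev[of t] by eventually_elim (use f_iso dom in blast)
  qed
  have rays: "(\<lambda>t. \<sigma> (- t)) \<in> geodesic_rays X d" "\<sigma> \<in> geodesic_rays X d"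
    using \<sigma>X \<sigma>_dist by (auto simp: geodesic_rays_def geodesic_on_def is_interval_ci)
  have base_bounds: "\<bar>t\<bar> - E \<le> d b (f n t)" "d b (f n t) \<le> \<bar>t\<bar> + E" if "\<bar>t\<bar> + E \<le> real n" for n t
    using f_iso[of 0 n t] dom[OF that] dom[of 0 n] that E f_base[of n]
      triangle[OF base fX[of n 0] fX[of n t]] triangle[OF fX[of n 0] base fX[of n t]]
      commute[of b "f n 0"] by auto
  have bound: "d (\<sigma> t) y \<le> 3 * E + 2 * \<delta>"
    if y: "y \<in> X" and ev': "\<forall>\<^sub>F n in sequentially. d (f (r n) t) y \<le> 3 * E + 2 * \<delta>" for t y
    by (rule tendsto_upperbound[OF tendsto_mdist[of "\<lambda>n. f (r n) t" "\<lambda>n. y"] ev'])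
      (use fX y \<sigma>X lim in auto)
  have "d (\<sigma> t) (c2 t) \<le> 3 * E + 2 * \<delta>" if t: "t \<ge> 0" for t
    using c2X[OF t]
  proof (rule bound)
    show "\<forall>\<^sub>F n in sequentially. d (f (r n) t) (c2 t) \<le> 3 * E + 2 * \<delta>"
      using ev[of t]
    proof eventually_elim
      case (elim n)
      let ?n = "r n"
      have "L ?n - u ?n \<in> {-u ?n..L ?n - u ?n}" using L0 by simp
      from f_iso[OF dom[OF elim] this]
      have "d (f ?n t) (c2 (real ?n)) \<le> d b (c2 (real ?n)) + E - t"
        using dom[OF elim] Lu_bounds(2)[of ?n] by (simp add: f_right c2n)
      moreover have "d (c2 t) (c2 (real ?n)) = d b (c2 (real ?n)) - t"
        using gray_properties(3)[OF c2 t, of "real ?n"] gray_Inr(3)[OF c2 t] elim E t by (simp add: c2n)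
      ultimately show ?case
        using base_bounds[OF elim] t gray_Inr(3)[OF c2 t]
        by (intro asymptotic_bound[OF fX c2X[OF t] c2X[of "real ?n"] E, of t]) auto
    qed
  qed
  then have \<eta>: "asymptotic_rel X d `` {\<sigma>} = \<eta>"
    using asymptotic_class_eq_iff[OF rays(2) gray_Inr(1)[OF c2]] gray_Inr(2)[OF c2] by blast
  have "d (\<sigma> (- t)) (c1 t) \<le> 3 * E + 2 * \<delta>" if t: "t \<ge> 0" for t
    using c1X[OF t]
  proof (rule bound)
    show "\<forall>\<^sub>F n in sequentially. d (f (r n) (- t)) (c1 t) \<le> 3 * E + 2 * \<delta>"
      using ev[of "- t"]
    proof eventually_elim
      case (elim n)
      let ?n = "r n"
      have "- u ?n \<in> {-u ?n..L ?n - u ?n}" using L0 by simp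
      from f_iso[OF dom[OF elim] this]
      have "d (f ?n (- t)) (c1 (real ?n)) \<le> d b (c1 (real ?n)) + E - t"
        using dom[OF elim] u_bounds(2)[of ?n] by (simp add: f_left c1n)
      moreover have "d (c1 t) (c1 (real ?n)) = d b (c1 (real ?n)) - t"
        using gray_properties(3)[OF c1 t, of "real ?n"] gray_Inr(3)[OF c1 t] elim E t by (simp add: c1n)
      ultimately show ?case
        using base_bounds[OF elim] t gray_Inr(3)[OF c1 t]
        by (intro asymptotic_bound[OF fX c1X[OF t] c1X[of "real ?n"] E, of t]) auto
    qed
  qed
  then have \<xi>: "asymptotic_rel X d `` {\<lambda>t. \<sigma> (- t)} = \<xi>"
    using asymptotic_class_eq_iff[OF rays(1) gray_Inr(1)[OF c1]] gray_Inr(2)[OF c1] by blast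
  have "geodesic_on X d UNIV \<sigma>" using \<sigma>X \<sigma>_dist by (auto simp: geodesic_on_def)
  then show thesis using that \<xi> \<eta> rays by blast
qed

end


section \<open>Visibility and the boundary extension\<close>

locale embedded_hyperbolic_space = hyperbolic_space X d b \<delta>
  for X :: "'a :: euclidean_space set" and d b \<delta> +
  assumes bounded: "bounded X"
    and limitin_iff: "(\<And>n. s n \<in> X) \<Longrightarrow> x \<in> X \<Longrightarrow> limitin mtopology s x sequentially \<longleftrightarrow> s \<longlonglongrightarrow> x"
begin

definition visible :: bool where
  "visible \<longleftrightarrow> (\<forall>p \<in> closure X - X. \<forall>q \<in> closure X - X. p \<noteq> q \<longrightarrow>
     (\<exists>U V K. p \<in> interior U \<and> q \<in> interior V \<and> closure U \<inter> closure V = {} \<and>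
        compact K \<and> K \<subseteq> X \<and>
        (\<forall>\<gamma> s t. s \<le> t \<longrightarrow> geodesic_on X d {s..t} \<gamma> \<longrightarrow> \<gamma> s \<in> U \<longrightarrow> \<gamma> t \<in> V \<longrightarrow> \<gamma> ` {s..t} \<inter> K \<noteq> {})))"

definition extension :: "('a + (real \<Rightarrow> 'a) set \<Rightarrow> 'a) \<Rightarrow> bool" where
  "extension F \<longleftrightarrow> continuous_map (gromov_topology X d b) (top_of_set (closure X)) F \<and>
     F ` gromov_bar X d = closure X \<and> (\<forall>x\<in>X. F (Inl x) = x)"

lemma tendsto_iff_dist:
  assumes "\<And>n. s n \<in> X" "x \<in> X"
  shows "(\<lambda>n. d (s n) x) \<longlonglongrightarrow> 0 \<longleftrightarrow> s \<longlonglongrightarrow> x"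
  using limitin_iff[of s x] assms by (simp add: limitin_metric_dist_null)

lemma near_imp_dist_less:
  assumes "q \<in> X" "r > 0"
  obtains \<epsilon> where "\<epsilon> > 0" "\<And>y. y \<in> X \<Longrightarrow> dist y q < \<epsilon> \<Longrightarrow> d y q < r"
proof (rule ccontr)
  assume "\<not> thesis"
  then have "\<exists>y\<in>X. dist y q < inverse (real (Suc n)) \<and> \<not> d y q < r" for n
    using that[of "inverse (real (Suc n))"] by (meson inverse_positive_iff_positive of_nat_0_less_iff zero_less_Suc)
  then obtain y where y: "\<And>n. y n \<in> X" "\<And>n. dist (y n) q < inverse (real (Suc n))" "\<And>n. \<not> d (y n) q < r"
    by metis
  have "(\<lambda>n. dist (y n) q) \<longlonglongrightarrow> 0"
    by (rule Lim_null_comparison[OF _ LIMSEQ_inverse_real_of_nat]) (use y(2) in \<open>auto intro!: always_eventually less_imp_le\<close>)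
  then have "y \<longlonglongrightarrow> q" by (rule iffD2[OF tendsto_dist_iff])
  then have "(\<lambda>n. d (y n) q) \<longlonglongrightarrow> 0" using tendsto_iff_dist[of y q, OF y(1) assms(1)] by blast
  then have "\<forall>\<^sub>F n in sequentially. d (y n) q < r" using assms(2) order_tendstoD(2) by blast
  then show False using y(3) by simp
qed

text \<open>Euclidean convergence to a point of \<open>X\<close> is convergence in \<open>d\<close>,
  which would keep the distances from \<open>b\<close> bounded.\<close>

lemma limit_of_unbounded:
  assumes s: "\<And>n. s n \<in> X" and lim: "s \<longlonglongrightarrow> p" and unb: "filterlim (\<lambda>n. d b (s n)) at_top sequentially"
  shows "p \<in> closure X - X"
proof
  show "p \<in> closure X" using s lim closure_sequential by blast
  show "p \<notin> X"
  proof
    assume p: "p \<in> X"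
    then have "(\<lambda>n. d (s n) p) \<longlonglongrightarrow> 0" using tendsto_iff_dist[of s p, OF s p] lim by blast
    then have "\<forall>\<^sub>F n in sequentially. d (s n) p < 1" by (rule order_tendstoD) simp
    moreover have "\<forall>\<^sub>F n in sequentially. d b p + 1 \<le> d b (s n)"
      using unb unfolding filterlim_at_top by blast
    ultimately have "\<forall>\<^sub>F n in sequentially. False"
    proof eventually_elim
      case (elim n)
      then show ?case using triangle'[OF base p s, of n] by simp
    qed
    then show False by simp
  qed
qed

lemma closure_subsequence:
  assumes "\<And>n. s n \<in> closure X"
  obtains r l where "strict_mono (r :: nat \<Rightarrow> nat)" "l \<in> closure X" "(\<lambda>n. s (r n)) \<longlonglongrightarrow> l"
proof -
  have "compact (closure X)" using bounded by simp
  then obtain l r where "l \<in> closure X" "strict_mono (r :: nat \<Rightarrow> nat)" "(s \<circ> r) \<longlonglongrightarrow> l"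
    using assms unfolding compact_def by blast
  then show thesis using that by (simp add: o_def)
qed

text \<open>Together with \<open>compact_mcball\<close> this exchanges the compact sets in the
  definition of visibility for balls about \<open>b\<close>.\<close>

lemma compact_imp_dist_bounded:
  assumes "compact K" "K \<subseteq> X"
  obtains R where "\<And>x. x \<in> K \<Longrightarrow> d b x \<le> R"
proof (rule ccontr)
  assume "\<not> thesis"
  then have "\<exists>x\<in>K. real n < d b x" for n using that by (meson not_le)
  then obtain x where x: "\<And>n. x n \<in> K" "\<And>n. real n < d b (x n)" by metis
  obtain l r where l: "l \<in> K" and r: "strict_mono (r :: nat \<Rightarrow> nat)" "(x \<circ> r) \<longlonglongrightarrow> l"
    using assms(1) x(1) unfolding compact_def by blast
  have "filterlim (\<lambda>n. d b (x n)) at_top sequentially"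
    by (rule filterlim_at_top_mono[OF filterlim_real_sequentially])
      (use x(2) in \<open>auto intro!: always_eventually less_imp_le\<close>)
  from filterlim_compose[OF this filterlim_subseq[OF r(1)]]
  have "l \<notin> X" using limit_of_unbounded[OF _ r(2)] x(1) assms(2) by (auto simp: o_def)
  then show False using l assms(2) by blast
qed

lemma compact_mcball: "compact (mcball b R)"
  unfolding compact_def
proof (intro allI impI)
  fix s :: "nat \<Rightarrow> 'a" assume s: "\<forall>n. s n \<in> mcball b R"
  then obtain l r where l: "l \<in> mcball b R" "strict_mono r" "limitin mtopology (s \<circ> r) l sequentially"
    using proper[OF base, of R] unfolding compactin_sequentially by blast
  have "(s \<circ> r) \<longlonglongrightarrow> l" using limitin_iff[of "s \<circ> r" l] l s by simp
  then show "\<exists>l\<in>mcball b R. \<exists>r. strict_mono r \<and> (s \<circ> r) \<longlonglongrightarrow> l" using l by blast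
qed

text \<open>Besides passing to balls, this covers the case that q lies in \<open>X\<close>, about
  which visibility is silent: points Euclidean-close to q are \<open>d\<close>-close to it, so the
  terminal point of the geodesic is itself near \<open>b\<close>.\<close>

lemma visibleE:
  assumes vis: visible and p: "p \<in> closure X - X" and q: "q \<in> closure X" and "p \<noteq> q"
  obtains U V R where "open U" "open V" "p \<in> U" "q \<in> V"
    "\<And>\<gamma> s t. s \<le> t \<Longrightarrow> geodesic_on X d {s..t} \<gamma> \<Longrightarrow> \<gamma> s \<in> U \<Longrightarrow> \<gamma> t \<in> V \<Longrightarrow> \<exists>u\<in>{s..t}. d b (\<gamma> u) \<le> R"
proof (cases "q \<in> X")
  case True
  obtain \<epsilon> where \<epsilon>: "\<epsilon> > 0" "\<And>y. y \<in> X \<Longrightarrow> dist y q < \<epsilon> \<Longrightarrow> d y q < 1"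
    by (rule near_imp_dist_less[OF True, of 1]) auto
  show thesis
  proof (rule that[of UNIV "ball q \<epsilon>" "d b q + 1"])
    fix \<gamma> and s t :: real
    assume st: "s \<le> t" and geo: "geodesic_on X d {s..t} \<gamma>" and t: "\<gamma> t \<in> ball q \<epsilon>"
    have "\<gamma> t \<in> X" using geodesic_onD(1)[OF geo] st by simp
    then have "d b (\<gamma> t) \<le> d b q + 1"
      using \<epsilon>(2)[of "\<gamma> t"] t triangle'[OF base True, of "\<gamma> t"] triangle[OF base True, of "\<gamma> t"]
      by (simp add: dist_commute commute[of q "\<gamma> t"])
    then show "\<exists>u\<in>{s..t}. d b (\<gamma> u) \<le> d b q + 1" using st by (intro bexI[of _ t]) auto
  qed (use \<epsilon> in auto)
next
  case False
  then have "q \<in> closure X - X" using q by blast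
  from vis[unfolded visible_def, rule_format, OF p this \<open>p \<noteq> q\<close>]
  obtain U V K where UV: "p \<in> interior U" "q \<in> interior V" and K: "compact K" "K \<subseteq> X"
    and meets: "\<forall>\<gamma> s t. s \<le> t \<longrightarrow> geodesic_on X d {s..t} \<gamma> \<longrightarrow> \<gamma> s \<in> U \<longrightarrow> \<gamma> t \<in> V \<longrightarrow> \<gamma> ` {s..t} \<inter> K \<noteq> {}"
    by (elim exE conjE)
  obtain R where R: "\<And>x. x \<in> K \<Longrightarrow> d b x \<le> R" by (rule compact_imp_dist_bounded[OF K]) (rule that)
  show thesis
  proof (rule that[of "interior U" "interior V" R])
    fix \<gamma> and s t :: real
    assume "s \<le> t" "geodesic_on X d {s..t} \<gamma>" "\<gamma> s \<in> interior U" "\<gamma> t \<in> interior V"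
    then have "\<gamma> ` {s..t} \<inter> K \<noteq> {}" using meets interior_subset by blast
    then show "\<exists>u\<in>{s..t}. d b (\<gamma> u) \<le> R" using R by blast
  qed (use UV in auto)
qed

section \<open>Limits of rays under visibility\<close>

lemma geodesic_ray_subset:
  assumes "c \<in> geodesic_rays X d" "0 \<le> s"
  shows "geodesic_on X d {s..t} c"
  using assms geodesic_on_subset[of "{0..}" c "{s..t}"] by (auto simp: geodesic_rays_def is_interval_cc)

lemma ray_dist_base:
  assumes "c \<in> geodesic_rays X d" "t \<ge> 0"
  shows "t - d b (c 0) \<le> d b (c t)"
  using triangle[OF geodesic_rayD(1)[OF assms(1), of 0] base geodesic_rayD(1)[OF assms]]
    geodesic_rayD(2)[OF assms(1), of 0 t] assms(2) commute[of b "c 0"] by simp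

lemma ray_unbounded:
  assumes "c \<in> geodesic_rays X d" "filterlim t at_top F" "\<And>n. t n \<ge> 0"
  shows "filterlim (\<lambda>n. d b (c (t n))) at_top F"
proof (rule filterlim_at_top_mono)
  show "filterlim (\<lambda>n. - d b (c 0) + t n) at_top F"
    by (rule filterlim_tendsto_add_at_top[OF tendsto_const assms(2)])
  show "\<forall>\<^sub>F n in F. - d b (c 0) + t n \<le> d b (c (t n))"
    using ray_dist_base[OF assms(1,3)] by (auto intro!: always_eventually simp: algebra_simps)
qed

text \<open>The piece of the ray between times \<open>s n\<close> and \<open>t m\<close> would be a
  geodesic from near p to near q that stays far from \<open>b\<close>.\<close>

lemma visible_ray_limits_eq:
  assumes vis: visible and c: "c \<in> geodesic_rays X d"
    and s: "filterlim s at_top sequentially" "\<And>n. s n \<ge> 0" "(\<lambda>n. c (s n)) \<longlonglongrightarrow> p"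
    and t: "filterlim t at_top sequentially" "\<And>n. t n \<ge> 0" "(\<lambda>n. c (t n)) \<longlonglongrightarrow> q"
  shows "p = q"
proof (rule ccontr)
  assume "p \<noteq> q"
  have p: "p \<in> closure X - X"
    by (rule limit_of_unbounded[OF _ s(3) ray_unbounded[OF c s(1,2)]]) (use geodesic_rayD(1)[OF c] s(2) in auto)
  have q: "q \<in> closure X"
    using limit_of_unbounded[OF _ t(3) ray_unbounded[OF c t(1,2)]] geodesic_rayD(1)[OF c] t(2) by auto
  obtain U V R where UV: "open U" "open V" "p \<in> U" "q \<in> V"
    and R: "\<And>\<gamma> s t. s \<le> t \<Longrightarrow> geodesic_on X d {s..t} \<gamma> \<Longrightarrow> \<gamma> s \<in> U \<Longrightarrow> \<gamma> t \<in> V \<Longrightarrow> \<exists>u\<in>{s..t}. d b (\<gamma> u) \<le> R"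
    by (rule visibleE[OF vis p q \<open>p \<noteq> q\<close>]) (rule that)
  have "\<forall>\<^sub>F n in sequentially. c (s n) \<in> U \<and> R + d b (c 0) + 1 \<le> s n"
    using topological_tendstoD[OF s(3) UV(1,3)] s(1) unfolding filterlim_at_top by (auto intro: eventually_conj)
  \<comment> \<open>At time u the height is at least \<open>u - d b (c 0)\<close>, so from time
    \<open>s n\<close> on the ray is outside the ball of radius R. The index m is chosen only
    afterwards, so that \<open>t m\<close> comes later.\<close>
  then obtain n where n: "c (s n) \<in> U" "R + d b (c 0) + 1 \<le> s n"
    by (auto simp: eventually_sequentially)
  have "\<forall>\<^sub>F m in sequentially. c (t m) \<in> V \<and> s n \<le> t m"
    using topological_tendstoD[OF t(3) UV(2,4)] t(1) unfolding filterlim_at_top by (auto intro: eventually_conj)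
  then obtain m where m: "c (t m) \<in> V" "s n \<le> t m" by (auto simp: eventually_sequentially)
  obtain u where u: "u \<in> {s n..t m}" "d b (c u) \<le> R"
    using R[OF m(2) geodesic_ray_subset[OF c s(2)] n(1) m(1)] by blast
  have "u - d b (c 0) \<le> d b (c u)" by (rule ray_dist_base[OF c]) (use u(1) s(2)[of n] in auto)
  then show False using u n(2) by simp
qed

lemma visible_ray_converges:
  assumes vis: visible and c: "c \<in> geodesic_rays X d"
  obtains p where "p \<in> closure X - X" "(c \<longlongrightarrow> p) at_top"
proof -
  have cX: "c t \<in> closure X" if "t \<ge> 0" for t using geodesic_rayD(1)[OF c that] closure_subset by blast
  obtain r p where r: "strict_mono (r :: nat \<Rightarrow> nat)" and p: "(\<lambda>n. c (real (r n))) \<longlonglongrightarrow> p"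
    by (rule closure_subsequence[of "\<lambda>n. c (real n)"]) (use cX in auto)
  have r_top: "filterlim (\<lambda>n. real (r n)) at_top sequentially"
    using filterlim_compose[OF filterlim_real_sequentially filterlim_subseq[OF r]] .
  have "p \<in> closure X - X"
    by (rule limit_of_unbounded[OF _ p ray_unbounded[OF c r_top]]) (use geodesic_rayD(1)[OF c] in auto)
  \<comment> \<open>The ray is controlled from time 0 on only, while a sequence of times tending to
    infinity may begin with negative ones.\<close>
  moreover have "((\<lambda>t. c (max 0 t)) \<longlongrightarrow> p) at_top"
  proof (rule tendsto_at_topI_sequentially, rule tendsto_via_subsequences)
    fix t :: "nat \<Rightarrow> real" and q :: "nat \<Rightarrow> nat" assume t: "filterlim t at_top sequentially" and q: "strict_mono q"
    obtain q' l where q': "strict_mono (q' :: nat \<Rightarrow> nat)" and l: "(\<lambda>n. c (max 0 (t (q (q' n))))) \<longlonglongrightarrow> l"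
      by (rule closure_subsequence[of "\<lambda>n. c (max 0 (t (q n)))"]) (use cX in auto)
    have "filterlim (\<lambda>n. t (q (q' n))) at_top sequentially"
      using filterlim_compose[OF filterlim_compose[OF t filterlim_subseq[OF q]] filterlim_subseq[OF q']] .
    then have "filterlim (\<lambda>n. max 0 (t (q (q' n)))) at_top sequentially"
      by (rule filterlim_at_top_mono) auto
    from visible_ray_limits_eq[OF vis c r_top _ p this _ l] have "p = l" by simp
    then show "\<exists>r'. strict_mono r' \<and> ((\<lambda>n. c (max 0 (t n))) \<circ> q \<circ> r') \<longlonglongrightarrow> p"
      using q' l by (auto simp: o_def)
  qed
  then have "(c \<longlongrightarrow> p) at_top"
    by (rule Lim_transform_eventually) (use eventually_ge_at_top[of 0] in \<open>eventually_elim, simp\<close>)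
  ultimately show thesis by (rule that)
qed

text \<open>The segment from \<open>c n\<close> to \<open>c' n\<close> has length at most B, so all
  of it has height at least \<open>n - d b (c 0) - B\<close>.\<close>

lemma visible_asymptotic_limits_eq:
  assumes vis: visible and c: "c \<in> geodesic_rays X d" "c' \<in> geodesic_rays X d"
    and B: "\<And>t. t \<ge> 0 \<Longrightarrow> d (c t) (c' t) \<le> B"
    and p: "(c \<longlongrightarrow> p) at_top" "(c' \<longlongrightarrow> q) at_top"
  shows "p = q"
proof (rule ccontr)
  assume "p \<noteq> q"
  have lim: "(\<lambda>n. c (real n)) \<longlonglongrightarrow> p" "(\<lambda>n. c' (real n)) \<longlonglongrightarrow> q"
    by (rule filterlim_compose[OF p(1) filterlim_real_sequentially],
        rule filterlim_compose[OF p(2) filterlim_real_sequentially])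
  have pX: "p \<in> closure X - X"
    by (rule limit_of_unbounded[OF _ lim(1) ray_unbounded[OF c(1) filterlim_real_sequentially]])
      (use geodesic_rayD(1)[OF c(1)] in auto)
  have qX: "q \<in> closure X"
    using limit_of_unbounded[OF _ lim(2) ray_unbounded[OF c(2) filterlim_real_sequentially]]
      geodesic_rayD(1)[OF c(2)] by auto
  obtain U V R where UV: "open U" "open V" "p \<in> U" "q \<in> V"
    and R: "\<And>\<gamma> s t. s \<le> t \<Longrightarrow> geodesic_on X d {s..t} \<gamma> \<Longrightarrow> \<gamma> s \<in> U \<Longrightarrow> \<gamma> t \<in> V \<Longrightarrow> \<exists>u\<in>{s..t}. d b (\<gamma> u) \<le> R"
    by (rule visibleE[OF vis pX qX \<open>p \<noteq> q\<close>]) (rule that)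
  have "\<forall>\<^sub>F n in sequentially. R + d b (c 0) + B + 1 \<le> real n"
    using filterlim_real_sequentially unfolding filterlim_at_top by blast
  then have "\<forall>\<^sub>F n in sequentially. c (real n) \<in> U \<and> c' (real n) \<in> V \<and> R + d b (c 0) + B + 1 \<le> real n"
    using topological_tendstoD[OF lim(1) UV(1,3)] topological_tendstoD[OF lim(2) UV(2,4)]
    by eventually_elim simp
  then obtain n where n: "c (real n) \<in> U" "c' (real n) \<in> V" "R + d b (c 0) + B + 1 \<le> real n"
    by (auto simp: eventually_sequentially)
  have X: "c (real n) \<in> X" "c' (real n) \<in> X" using geodesic_rayD(1) c by auto
  define l where "l = d (c (real n)) (c' (real n))"
  have l: "0 \<le> l" "l \<le> B" using B[of "real n"] by (auto simp: l_def)
  obtain \<sigma> where \<sigma>: "geodesic_on X d {0..l} \<sigma>" "\<sigma> 0 = c (real n)" "\<sigma> l = c' (real n)"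
    using geodesic[OF X] unfolding l_def by blast
  obtain u where u: "u \<in> {0..l}" "d b (\<sigma> u) \<le> R" using R[OF l(1) \<sigma>(1)] n \<sigma>(2,3) by auto
  have "d (\<sigma> u) (\<sigma> 0) \<le> B" using geodesic_onD(2)[OF \<sigma>(1), of u 0] u(1) l by simp
  then have "d b (c (real n)) \<le> R + B"
    using triangle[OF base geodesic_onD(1)[OF \<sigma>(1) u(1)] X(1)] u(2) \<sigma>(2) by simp
  then show False using ray_dist_base[OF c(1), of "real n"] n(3) by simp
qed

section \<open>The extension built from limits of rays\<close>

definition boundary_extension :: "'a + (real \<Rightarrow> 'a) set \<Rightarrow> 'a" where
  "boundary_extension x = (case x of Inl p \<Rightarrow> p | Inr \<xi> \<Rightarrow> SOME p. \<exists>c\<in>\<xi>. (c \<longlongrightarrow> p) at_top)"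

lemma boundary_extension_Inl [simp]: "boundary_extension (Inl p) = p"
  by (simp add: boundary_extension_def)

text \<open>The choice in \<open>boundary_extension\<close> may pick the limit of another ray in the
  class, but asymptotic rays have equal limits.\<close>

lemma boundary_extension_ray:
  assumes vis: visible and c: "c \<in> geodesic_rays X d"
  shows "(c \<longlongrightarrow> boundary_extension (Inr (asymptotic_rel X d `` {c}))) at_top"
    "boundary_extension (Inr (asymptotic_rel X d `` {c})) \<in> closure X - X"
proof -
  obtain p where p: "p \<in> closure X - X" "(c \<longlongrightarrow> p) at_top" by (rule visible_ray_converges[OF vis c])
  have self: "c \<in> asymptotic_rel X d `` {c}"
    by (rule equiv_class_self[OF geodesic_rays_equiv c])
  let ?p = "boundary_extension (Inr (asymptotic_rel X d `` {c}))"
  have "\<exists>c'\<in>asymptotic_rel X d `` {c}. (c' \<longlongrightarrow> ?p) at_top"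
    unfolding boundary_extension_def sum.case by (rule someI_ex) (use p(2) self in blast)
  then obtain c' where c': "(c, c') \<in> asymptotic_rel X d" "(c' \<longlongrightarrow> ?p) at_top" by blast
  then obtain B where "c' \<in> geodesic_rays X d" "\<And>t. t \<ge> 0 \<Longrightarrow> d (c t) (c' t) \<le> B"
    by (auto simp: asymptotic_rel_def)
  from visible_asymptotic_limits_eq[OF vis c this p(2) c'(2)] have "p = ?p" .
  then show "(c \<longlongrightarrow> ?p) at_top" "?p \<in> closure X - X" using p by auto
qed

lemma boundary_extension_in_closure:
  assumes vis: visible and "x \<in> gromov_bar X d"
  shows "boundary_extension x \<in> closure X"
proof -
  obtain c where c: "gray c x" using gray_exists[OF assms(2)] by blast
  show ?thesis
  proof (cases x)
    case (Inl p)
    then show ?thesis using gray_Inl(1)[of c p] c closure_subset by auto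
  next
    case (Inr \<xi>)
    then show ?thesis using gray_Inr(1,2)[of c \<xi>] c boundary_extension_ray(2)[OF vis, of c] by auto
  qed
qed

text \<open>Height T at time T means that the generalized ray has not stopped before T.\<close>

lemma gray_geodesic_on:
  assumes "gray c x" and S: "S \<ge> 0" and T: "d b (c T) = T" "S \<le> T"
  shows "geodesic_on X d {S..T} c"
proof -
  have base_eq: "d b (c t) = t" if "t \<in> {S..T}" for t
  proof -
    have "t \<ge> 0" "t \<le> T" "T \<ge> 0" using that S T(2) by auto
    then show ?thesis using gray_profile[OF assms(1)] T(1) by (metis min.absorb1 min.bounded_iff min.cobounded2 order_trans)
  qed
  show ?thesis
    unfolding geodesic_on_def
  proof (intro conjI ballI image_subsetI)
    show "c t \<in> X" if "t \<in> {S..T}" for t by (rule gray_properties(2)[OF assms(1)]) (use that S in auto)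
    show "d (c s) (c t) = \<bar>s - t\<bar>" if "s \<in> {S..T}" "t \<in> {S..T}" for s t
      using gray_properties(3)[OF assms(1), of s t] base_eq[OF that(1)] base_eq[OF that(2)] that S by simp
  qed (rule is_interval_cc)
qed

text \<open>For x in \<open>X\<close> the generalized rays eventually stop before a fixed time,
  where the limit is pointwise. For a boundary point x, a value q different from its image would
  make \<open>c n\<close> pass near the image at a large time and near q later on, against
  visibility.\<close>

lemma boundary_extension_limit:
  assumes vis: visible
    and gray: "\<And>n. gray (c n) (s n)" "gray c' x" and conv: "converges_on_compacts d c c'"
    and q: "(\<lambda>n. boundary_extension (s n)) \<longlonglongrightarrow> q"
  shows "q = boundary_extension x"
proof (cases x)
  case (Inl p)
  note p = gray_Inl[OF gray(2)[unfolded Inl]]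
  \<comment> \<open>One unit after \<open>c'\<close> has stopped: eventually each \<open>c n\<close>
    has stopped before T as well, so that \<open>c n T\<close> is its endpoint.\<close>
  define T where "T = d b p + 1"
  have T: "T \<ge> 0" "T > d b p" using nonneg[of b p] by (auto simp: T_def)
  have c'T: "c' T = p" "d b (c' T) = d b p" using p(3)[of T] T by auto
  have "\<forall>\<^sub>F n in sequentially. d b (c n T) < T"
    using order_tendstoD(2)[OF gray_lim_dist_base[OF gray conv T(1)], of T] T c'T by simp
  then have "\<forall>\<^sub>F n in sequentially. c n T = boundary_extension (s n)"
  proof eventually_elim
    case (elim n)
    show ?case
    proof (cases "s n")
      case (Inl y)
      then have "gray (c n) (Inl y)" using gray(1)[of n] by simp
      from gray_Inl(2,3)[OF this, of T] T(1) elim show ?thesis by (simp add: Inl min_def split: if_splits)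
    next
      case (Inr \<eta>)
      then have "gray (c n) (Inr \<eta>)" using gray(1)[of n] by simp
      from gray_Inr(3)[OF this T(1)] elim show ?thesis by simp
    qed
  qed
  moreover have "(\<lambda>n. c n T) \<longlonglongrightarrow> p"
    using converges_on_compacts_pointwise[OF conv T(1)] tendsto_iff_dist[of "\<lambda>n. c n T" p]
      gray_properties(2)[OF gray(1) T(1)] p(1) c'T(1) by simp
  ultimately have "(\<lambda>n. boundary_extension (s n)) \<longlonglongrightarrow> p" by (rule Lim_transform_eventually[rotated])
  then show ?thesis using LIMSEQ_unique[OF q] Inl by simp
next
  case (Inr \<xi>)
  note c' = gray_Inr[OF gray(2)[unfolded Inr]]
  let ?p = "boundary_extension x"
  have p: "(c' \<longlongrightarrow> ?p) at_top" "?p \<in> closure X - X"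
    using boundary_extension_ray[OF vis c'(1)] c'(2) Inr by auto
  have bar: "s n \<in> gromov_bar X d" for n using generalized_ray_in_gromov_bar[OF gray(1)] .
  have qX: "q \<in> closure X"
    using closed_sequentially[OF closed_closure _ q] boundary_extension_in_closure[OF vis bar] by blast
  show ?thesis
  proof (rule ccontr)
    assume "q \<noteq> ?p"
    then have "?p \<noteq> q" by simp
    obtain U V R where UV: "open U" "open V" "?p \<in> U" "q \<in> V"
      and R: "\<And>\<gamma> s t. s \<le> t \<Longrightarrow> geodesic_on X d {s..t} \<gamma> \<Longrightarrow> \<gamma> s \<in> U \<Longrightarrow> \<gamma> t \<in> V \<Longrightarrow> \<exists>u\<in>{s..t}. d b (\<gamma> u) \<le> R"
      by (rule visibleE[OF vis p(2) qX \<open>?p \<noteq> q\<close>]) (rule that)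
    have "\<forall>\<^sub>F T in at_top. c' T \<in> U \<and> max 0 (R + 1) \<le> T"
      using topological_tendstoD[OF p(1) UV(1,3)] eventually_ge_at_top by (rule eventually_conj)
    \<comment> \<open>T is chosen on the limit ray alone, beyond the radius R; only then is n taken
      large enough for \<open>c n\<close> to be near \<open>c'\<close> at time T.\<close>
    then obtain T where T: "c' T \<in> U" "max 0 (R + 1) \<le> T"
      using eventually_happens'[OF trivial_limit_at_top_linorder] by blast
    \<comment> \<open>Height above T at time \<open>T + 1\<close> will rule out that
      \<open>c n\<close> has stopped by time T.\<close>
    have T0: "T \<ge> 0" "T + 1 \<ge> 0" using T(2) by auto
    have "(\<lambda>n. c n T) \<longlonglongrightarrow> c' T"
      using converges_on_compacts_pointwise[OF conv T0(1)] tendsto_iff_dist[of "\<lambda>n. c n T" "c' T"]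
        gray_properties(2)[OF gray(1) T0(1)] gray_properties(2)[OF gray(2) T0(1)] by simp
    from topological_tendstoD[OF this UV(1) T(1)] topological_tendstoD[OF q UV(2,4)]
      order_tendstoD(1)[OF gray_lim_dist_base[OF gray conv T0(2)], of T] c'(3)[OF T0(2)]
    have "\<forall>\<^sub>F n in sequentially. c n T \<in> U \<and> boundary_extension (s n) \<in> V \<and> T < d b (c n (T + 1))"
      by (auto intro: eventually_conj)
    then obtain n where n: "c n T \<in> U" "boundary_extension (s n) \<in> V" "T < d b (c n (T + 1))"
      by (auto simp: eventually_sequentially)
    \<comment> \<open>A later point of \<open>c n\<close> near q: the endpoint if it is a segment,
      otherwise a far point, since a ray converges to the value on its class.\<close>
    obtain T' where T': "T \<le> T'" "d b (c n T') = T'" "c n T' \<in> V"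
    proof (cases "s n")
      case (Inl y)
      then have y: "gray (c n) (Inl y)" using gray(1)[of n] by simp
      have "T \<le> d b y" using gray_Inl(2)[OF y T0(2)] n(3) by simp
      then show ?thesis using that[of "d b y"] gray_Inl(3)[OF y, of "d b y"] n(2) Inl by simp
    next
      case (Inr \<eta>)
      then have y: "gray (c n) (Inr \<eta>)" using gray(1)[of n] by simp
      have "(c n \<longlongrightarrow> boundary_extension (s n)) at_top"
        using boundary_extension_ray(1)[OF vis gray_Inr(1)[OF y]] gray_Inr(2)[OF y] Inr by simp
      from eventually_conj[OF topological_tendstoD[OF this UV(2) n(2)] eventually_ge_at_top[of T]]
      obtain t where "c n t \<in> V" "T \<le> t"
        using eventually_happens'[OF trivial_limit_at_top_linorder] by blast
      then show ?thesis using that[of t] gray_Inr(3)[OF y, of t] T0 by simp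
    qed
    have geo: "geodesic_on X d {T..T'} (c n)" by (rule gray_geodesic_on[OF gray(1) T0(1) T'(2,1)])
    obtain u where u: "u \<in> {T..T'}" "d b (c n u) \<le> R" using R[OF T'(1) geo n(1) T'(3)] by blast
    have "geodesic_on X d {0..T'} (c n)" by (rule gray_geodesic_on[OF gray(1) _ T'(2)]) (use T' T0 in auto)
    from geodesic_onD(2)[OF this, of 0 u] have "d b (c n u) = u"
      using u(1) T0 gray_properties(1)[OF gray(1)] by simp
    then show False using u T(2) by simp
  qed
qed

text \<open>Closed sets of the Gromov topology are the sequentially closed ones, so continuity
  reduces to limits of sequences. For surjectivity, a sequence in \<open>X\<close> tending to p
  subconverges in the Gromov sense, and the image of that limit must be p.\<close>

lemma extension_of_visible:
  assumes vis: visible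
  shows "extension boundary_extension"
proof -
  have seq: "(\<lambda>n. boundary_extension (s n)) \<longlonglongrightarrow> boundary_extension x"
    if conv: "gromov_converges X d b s x" for s x
  proof (rule tendsto_via_subsequences)
    fix r :: "nat \<Rightarrow> nat" assume r: "strict_mono r"
    obtain r1 c c' where r1: "strict_mono (r1 :: nat \<Rightarrow> nat)" "\<And>n. gray (c n) ((s \<circ> r) (r1 n))" "gray c' x"
      "converges_on_compacts d c c'"
      by (rule gromov_convergesD[OF gromov_converges_subseq[OF conv r]]) (rule that)
    have bar: "(s \<circ> r) (r1 n) \<in> gromov_bar X d" for n using generalized_ray_in_gromov_bar[OF r1(2)] .
    obtain r2 q where r2: "strict_mono (r2 :: nat \<Rightarrow> nat)"
      and q: "(\<lambda>n. boundary_extension ((s \<circ> r) (r1 (r2 n)))) \<longlonglongrightarrow> q"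
      by (rule closure_subsequence[of "\<lambda>n. boundary_extension ((s \<circ> r) (r1 n))"])
        (use boundary_extension_in_closure[OF vis bar] in auto)
    have "q = boundary_extension x"
      by (rule boundary_extension_limit[OF vis _ r1(3) converges_on_compacts_subseq[OF r1(4) r2] q])
        (use r1(2) in \<open>auto simp: o_def\<close>)
    then show "\<exists>r'. strict_mono r' \<and> ((\<lambda>n. boundary_extension (s n)) \<circ> r \<circ> r') \<longlonglongrightarrow> boundary_extension x"
      using q strict_mono_o[OF r1(1) r2] by (intro exI[of _ "r1 \<circ> r2"]) (auto simp: o_def)
  qed
  have "continuous_map (gromov_topology X d b) (top_of_set (closure X)) boundary_extension"
    unfolding continuous_map_closedin topspace_gromov_topology
  proof (intro conjI allI impI Pi_I)
    show "boundary_extension x \<in> topspace (top_of_set (closure X))" if "x \<in> gromov_bar X d" for x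
      using boundary_extension_in_closure[OF vis that] by simp
    fix C assume "closedin (top_of_set (closure X)) C"
    then have C: "closed C" using closedin_closed_trans by blast
    have "gromov_open X d b (gromov_bar X d - {x \<in> gromov_bar X d. boundary_extension x \<in> C})"
      unfolding gromov_open_def
    proof (intro conjI allI impI)
      fix s x
      assume s: "\<forall>n. s n \<in> gromov_bar X d - (gromov_bar X d - {x \<in> gromov_bar X d. boundary_extension x \<in> C})"
        and x: "gromov_converges X d b s x"
      have "boundary_extension x \<in> C"
        by (rule closed_sequentially[OF C _ seq[OF x]]) (use s in blast)
      then show "x \<notin> gromov_bar X d - {x \<in> gromov_bar X d. boundary_extension x \<in> C}" by blast
    qed blast
    then show "closedin (gromov_topology X d b) {x \<in> gromov_bar X d. boundary_extension x \<in> C}"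
      unfolding closedin_def topspace_gromov_topology openin_gromov_topology by blast
  qed
  moreover have "boundary_extension ` gromov_bar X d = closure X"
  proof
    show "boundary_extension ` gromov_bar X d \<subseteq> closure X"
      using boundary_extension_in_closure[OF vis] by blast
    show "closure X \<subseteq> boundary_extension ` gromov_bar X d"
    proof
      fix p assume "p \<in> closure X"
      then obtain y where y: "\<And>n. y n \<in> X" "y \<longlonglongrightarrow> p" unfolding closure_sequential by blast
      have "Inl (y n) \<in> gromov_bar X d" for n using y(1)[of n] by (simp add: gromov_bar_def InlI)
      then obtain r x where r: "strict_mono (r :: nat \<Rightarrow> nat)" and x: "x \<in> gromov_bar X d"
        "gromov_converges X d b ((\<lambda>n. Inl (y n)) \<circ> r) x"
        by (rule gromov_bar_seq_compact)
      have "(y \<circ> r) \<longlonglongrightarrow> boundary_extension x" using seq[OF x(2)] by (simp add: o_def)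
      moreover have "(y \<circ> r) \<longlonglongrightarrow> p" using LIMSEQ_subseq_LIMSEQ[OF y(2) r] .
      ultimately have "p = boundary_extension x" by (rule LIMSEQ_unique[rotated])
      then show "p \<in> boundary_extension ` gromov_bar X d" using x(1) by blast
    qed
  qed
  ultimately show ?thesis by (simp add: extension_def)
qed

end

section \<open>Properties forced on every continuous extension\<close>

context embedded_hyperbolic_space
begin

lemma extension_limit:
  assumes F: "extension F" and conv: "gromov_converges X d b s x"
  shows "(\<lambda>n. F (s n)) \<longlonglongrightarrow> F x"
proof -
  obtain c where c: "\<forall>n. gray (c n) (s n)" using conv unfolding gromov_converges_def by blast
  have s: "s n \<in> gromov_bar X d" for n by (rule generalized_ray_in_gromov_bar[OF c[rule_format]])
  obtain r e e' where "strict_mono (r :: nat \<Rightarrow> nat)" "\<And>n. gray (e n) (s (r n))" "gray e' x"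
    "converges_on_compacts d e e'"
    by (rule gromov_convergesD[OF conv]) (rule that)
  from this(3) have x: "x \<in> gromov_bar X d" by (rule generalized_ray_in_gromov_bar)
  have "continuous_map (gromov_topology X d b) (top_of_set (closure X)) F"
    using F by (simp add: extension_def)
  from continuous_map_limit[OF this gromov_converges_limitin[OF conv s x]]
  have "limitin (top_of_set (closure X)) (F \<circ> s) (F x) sequentially" .
  then show ?thesis by (simp add: limitin_subtopology limitin_canonical_iff o_def)
qed

text \<open>The two neighbourhoods are fixed at once. Only K varies, through the balls about
  \<open>b\<close>, so the failure of visibility produces geodesics from one neighbourhood to the
  other that escape every ball.\<close>

lemma visible_of_extension:
  assumes F: "extension F"
  shows visible
  unfolding visible_def
proof (intro ballI impI)
  fix p q assume pq: "p \<in> closure X - X" "q \<in> closure X - X" "p \<noteq> q"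
  \<comment> \<open>A third of the distance keeps the closed balls disjoint; their closedness
    retains the limits of the endpoints at the end.\<close>
  define r where "r = dist p q / 3"
  have r: "r > 0" using pq(3) by (simp add: r_def)
  have disj: "cball p r \<inter> cball q r = {}"
  proof (rule ccontr)
    assume "cball p r \<inter> cball q r \<noteq> {}"
    then obtain z where "dist p z \<le> r" "dist q z \<le> r" by auto
    then have "dist p q \<le> 2 * r" using dist_triangle2[of p q z] by simp
    then show False using r by (simp add: r_def)
  qed
  show "\<exists>U V K. p \<in> interior U \<and> q \<in> interior V \<and> closure U \<inter> closure V = {} \<and> compact K \<and> K \<subseteq> X \<and>
    (\<forall>\<gamma> s t. s \<le> t \<longrightarrow> geodesic_on X d {s..t} \<gamma> \<longrightarrow> \<gamma> s \<in> U \<longrightarrow> \<gamma> t \<in> V \<longrightarrow> \<gamma> ` {s..t} \<inter> K \<noteq> {})"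
  proof (rule ccontr)
    assume none: "\<not> ?thesis"
    have "\<exists>\<gamma> s t. s \<le> t \<and> geodesic_on X d {s..t} \<gamma> \<and> \<gamma> s \<in> cball p r \<and> \<gamma> t \<in> cball q r \<and>
        \<gamma> ` {s..t} \<inter> mcball b (real n) = {}" for n
    proof (rule ccontr)
      assume "\<not> ?thesis"
      then have "\<forall>\<gamma> s t. s \<le> t \<longrightarrow> geodesic_on X d {s..t} \<gamma> \<longrightarrow> \<gamma> s \<in> cball p r \<longrightarrow> \<gamma> t \<in> cball q r \<longrightarrow>
          \<gamma> ` {s..t} \<inter> mcball b (real n) \<noteq> {}" by blast
      moreover have "p \<in> interior (cball p r)" "q \<in> interior (cball q r)"
        "closure (cball p r) \<inter> closure (cball q r) = {}" using r disj by simp_all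
      ultimately show False
        using none compact_mcball[of "real n"] mcball_subset_mspace[of b "real n"] by blast
    qed
    then obtain \<gamma> s t where st: "\<And>n. s n \<le> t n" and geo: "\<And>n. geodesic_on X d {s n..t n} (\<gamma> n)"
      and U: "\<And>n. \<gamma> n (s n) \<in> cball p r" and V: "\<And>n. \<gamma> n (t n) \<in> cball q r"
      and avoid: "\<And>n. \<gamma> n ` {s n..t n} \<inter> mcball b (real n) = {}" by metis
    define x where "x n = \<gamma> n (s n)" for n
    define y where "y n = \<gamma> n (t n)" for n
    have xy: "x n \<in> X" "y n \<in> X" for n
      using geodesic_onD(1)[OF geo] st[of n] by (auto simp: x_def y_def)
    have "real n - 2 * \<delta> \<le> gromov_product d b (x n) (y n)" for n
    proof -
      obtain u where u: "u \<in> {s n..t n}" "d b (\<gamma> n u) \<le> gromov_product d b (x n) (y n) + 2 * \<delta>"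
        using geodesic_near_base[OF geo st] unfolding x_def y_def by blast
      have "\<gamma> n u \<notin> mcball b (real n)" using avoid[of n] u(1) by blast
      then have "real n < d b (\<gamma> n u)" using base geodesic_onD(1)[OF geo u(1)] by simp
      then show ?thesis using u(2) by simp
    qed
    moreover have "filterlim (\<lambda>n. - (2 * \<delta>) + real n) at_top sequentially"
      by (rule filterlim_tendsto_add_at_top[OF tendsto_const filterlim_real_sequentially])
    ultimately have gp: "filterlim (\<lambda>n. gromov_product d b (x n) (y n)) at_top sequentially"
      by (elim filterlim_at_top_mono) (auto intro!: always_eventually simp: algebra_simps)
    have "\<forall>n. \<exists>c. gray c (Inl (x n))" "\<forall>n. \<exists>c. gray c (Inl (y n))"
      using gray_exists_Inl xy by blast+
    then obtain c e where c: "\<And>n. gray (c n) (Inl (x n))" and e: "\<And>n. gray (e n) (Inl (y n))" by metis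
    obtain r1 c' \<xi> where r1: "strict_mono r1" "gray c' \<xi>" "converges_on_compacts d (c \<circ> r1) c'"
      by (rule gray_convergent_subsequence[OF c]) (rule that)
    \<comment> \<open>The second extraction is made along the first, so that both families of
      segments converge along the common indices \<open>r1 (r2 n)\<close>.\<close>
    have e1: "gray ((e \<circ> r1) n) (Inl (y (r1 n)))" for n using e by simp
    obtain r2 e' \<eta> where r2: "strict_mono r2" "gray e' \<eta>" "converges_on_compacts d (e \<circ> r1 \<circ> r2) e'"
      by (rule gray_convergent_subsequence[OF e1]) (rule that)
    have c2: "gray ((c \<circ> r1 \<circ> r2) n) (Inl (x (r1 (r2 n))))" for n using c by simp
    have e2: "gray ((e \<circ> r1 \<circ> r2) n) (Inl (y (r1 (r2 n))))" for n using e by simp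
    note conv_c = converges_on_compacts_subseq[OF r1(3) r2(1)]
    have "filterlim (\<lambda>n. gromov_product d b (x (r1 (r2 n))) (y (r1 (r2 n)))) at_top sequentially"
      using filterlim_compose[OF filterlim_compose[OF gp filterlim_subseq[OF r1(1)]] filterlim_subseq[OF r2(1)]] .
    from limits_eq_of_gromov_product[OF c2 r1(2) conv_c e2 r2(2,3) this] have "\<xi> = \<eta>" .
    have Fx: "F (Inl (x n)) = x n" "F (Inl (y n)) = y n" for n using F xy by (auto simp: extension_def)
    have lim: "(\<lambda>n. x (r1 (r2 n))) \<longlonglongrightarrow> F \<xi>" "(\<lambda>n. y (r1 (r2 n))) \<longlonglongrightarrow> F \<eta>"
      using extension_limit[OF F gromov_convergesI[OF c2 r1(2) conv_c]]
        extension_limit[OF F gromov_convergesI[OF e2 r2(2,3)]] unfolding Fx by blast+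
    have "F \<xi> \<in> cball p r" by (rule closed_sequentially[OF closed_cball _ lim(1)]) (simp only: x_def U)
    moreover have "F \<eta> \<in> cball q r" by (rule closed_sequentially[OF closed_cball _ lim(2)]) (simp only: y_def V)
    ultimately show False using disj \<open>\<xi> = \<eta>\<close> by blast
  qed
qed

text \<open>Points of a ray converge to its class in the Gromov sense, so any extension, not only
  the constructed one, must send the class to the Euclidean limit of the ray.\<close>

lemma extension_along_ray:
  assumes F: "extension F" and \<gamma>: "\<gamma> \<in> geodesic_rays X d"
  shows "(\<gamma> \<longlongrightarrow> F (Inr (asymptotic_rel X d `` {\<gamma>}))) at_top"
proof -
  let ?p = "F (Inr (asymptotic_rel X d `` {\<gamma>}))"
  have "((\<lambda>t. \<gamma> (max 0 t)) \<longlongrightarrow> ?p) at_top"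
  proof (rule tendsto_at_topI_sequentially, rule tendsto_via_subsequences)
    fix t :: "nat \<Rightarrow> real" and q :: "nat \<Rightarrow> nat" assume t: "filterlim t at_top sequentially" and q: "strict_mono q"
    define T where "T n = max 0 (t (q n))" for n
    have T: "filterlim T at_top sequentially"
      by (rule filterlim_at_top_mono[OF filterlim_compose[OF t filterlim_subseq[OF q]]]) (simp add: T_def)
    have T0: "T n \<ge> 0" for n by (simp add: T_def)
    have \<gamma>X: "\<gamma> (T n) \<in> X" for n using geodesic_rayD(1)[OF \<gamma> T0] .
    have "\<forall>n. \<exists>c. gray c (Inl (\<gamma> (T n)))" using gray_exists_Inl[OF \<gamma>X] by blast
    then obtain c where c: "\<And>n. gray (c n) (Inl (\<gamma> (T n)))" by metis
    obtain r c' x where r: "strict_mono r" "gray c' x" "converges_on_compacts d (c \<circ> r) c'"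
      by (rule gray_convergent_subsequence[OF c]) (rule that)
    have cr: "gray ((c \<circ> r) n) (Inl (\<gamma> (T (r n))))" for n using c by simp
    have "x = Inr (asymptotic_rel X d `` {\<gamma>})"
      by (rule limit_along_ray[OF \<gamma> filterlim_compose[OF T filterlim_subseq[OF r(1)]] T0 cr r(2,3)])
    moreover have "(\<lambda>n. F (Inl (\<gamma> (T (r n))))) \<longlonglongrightarrow> F x"
      by (rule extension_limit[OF F gromov_convergesI[OF cr r(2,3)]])
    moreover have "F (Inl (\<gamma> (T (r n)))) = \<gamma> (T (r n))" for n using F \<gamma>X by (simp add: extension_def)
    ultimately have "(\<lambda>n. \<gamma> (T (r n))) \<longlonglongrightarrow> ?p" by simp
    then show "\<exists>r'. strict_mono r' \<and> ((\<lambda>n. \<gamma> (max 0 (t n))) \<circ> q \<circ> r') \<longlonglongrightarrow> ?p"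
      using r(1) by (intro exI[of _ r]) (simp add: T_def o_def)
  qed
  then show ?thesis
    by (rule Lim_transform_eventually) (use eventually_ge_at_top[of 0] in \<open>eventually_elim, simp\<close>)
qed

lemma extension_boundary_notin:
  assumes F: "extension F" and \<gamma>: "\<gamma> \<in> geodesic_rays X d"
  shows "F (Inr (asymptotic_rel X d `` {\<gamma>})) \<notin> X"
  using limit_of_unbounded[OF _ filterlim_compose[OF extension_along_ray[OF F \<gamma>] filterlim_real_sequentially]
      ray_unbounded[OF \<gamma> filterlim_real_sequentially]] geodesic_rayD(1)[OF \<gamma>] by auto

lemma line_rays:
  assumes "geodesic_on X d UNIV \<gamma>"
  shows "\<gamma> \<in> geodesic_rays X d" "(\<lambda>t. \<gamma> (- t)) \<in> geodesic_rays X d"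
  using assms by (auto simp: geodesic_rays_def geodesic_on_def is_interval_ci)

lemma extension_along_line:
  assumes F: "extension F" and \<gamma>: "geodesic_on X d UNIV \<gamma>"
  shows "(\<gamma> \<longlongrightarrow> F (Inr (asymptotic_rel X d `` {\<gamma>}))) at_top"
    "(\<gamma> \<longlongrightarrow> F (Inr (asymptotic_rel X d `` {\<lambda>t. \<gamma> (- t)}))) at_bot"
  using extension_along_ray[OF F line_rays(1)[OF \<gamma>]] extension_along_ray[OF F line_rays(2)[OF \<gamma>]]
  by (simp_all add: filterlim_at_bot_mirror)

text \<open>The points at times t and -t are 2t apart, which exceeds every bound.\<close>

lemma line_ends_distinct:
  assumes \<gamma>: "geodesic_on X d UNIV \<gamma>"
  shows "asymptotic_rel X d `` {\<gamma>} \<noteq> asymptotic_rel X d `` {\<lambda>t. \<gamma> (- t)}"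
proof
  assume "asymptotic_rel X d `` {\<gamma>} = asymptotic_rel X d `` {\<lambda>t. \<gamma> (- t)}"
  then obtain B where B: "\<forall>t\<ge>0. d (\<gamma> t) (\<gamma> (- t)) \<le> B"
    using asymptotic_class_eq_iff[OF line_rays[OF \<gamma>]] by blast
  have "d (\<gamma> (\<bar>B\<bar> + 1)) (\<gamma> (- (\<bar>B\<bar> + 1))) = \<bar>(\<bar>B\<bar> + 1) - (- (\<bar>B\<bar> + 1))\<bar>"
    by (rule geodesic_onD(2)[OF \<gamma>]) auto
  then show False using B[rule_format, of "\<bar>B\<bar> + 1"] by simp
qed

lemma extension_closed_map:
  assumes F: "extension F"
  shows "closed_map (gromov_topology X d b) (top_of_set (closure X)) F"
  unfolding closed_map_def
proof (intro allI impI)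
  fix C assume C: "closedin (gromov_topology X d b) C"
  then have sub: "C \<subseteq> gromov_bar X d" and op: "gromov_open X d b (gromov_bar X d - C)"
    unfolding closedin_def topspace_gromov_topology openin_gromov_topology by blast+
  have "closed (F ` C)"
    unfolding closed_sequential_limits
  proof (intro allI impI)
    fix y l assume yl: "(\<forall>n. y n \<in> F ` C) \<and> y \<longlonglongrightarrow> l"
    then have "\<forall>n. \<exists>x. x \<in> C \<and> y n = F x" by blast
    then obtain x where x: "\<And>n. x n \<in> C" "\<And>n. y n = F (x n)" by metis
    obtain r z where r: "strict_mono (r :: nat \<Rightarrow> nat)" and z: "z \<in> gromov_bar X d"
      "gromov_converges X d b (x \<circ> r) z"
      by (rule gromov_bar_seq_compact[of x]) (use x sub in auto)
    have "\<forall>n. (x \<circ> r) n \<in> gromov_bar X d - (gromov_bar X d - C)" using x(1) sub by auto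
    moreover have "(\<forall>n. (x \<circ> r) n \<in> gromov_bar X d - (gromov_bar X d - C)) \<longrightarrow>
        gromov_converges X d b (x \<circ> r) z \<longrightarrow> z \<notin> gromov_bar X d - C"
      using op unfolding gromov_open_def by blast
    ultimately have "z \<notin> gromov_bar X d - C" using z(2) by blast
    then have "z \<in> C" using z(1) by blast
    moreover have "(\<lambda>n. y (r n)) \<longlonglongrightarrow> F z" using extension_limit[OF F z(2)] by (simp add: x(2))
    moreover have "(\<lambda>n. y (r n)) \<longlonglongrightarrow> l" using LIMSEQ_subseq_LIMSEQ[OF conjunct2[OF yl] r] by (simp add: o_def)
    ultimately show "l \<in> F ` C" using LIMSEQ_unique by blast
  qed
  moreover have "F ` C \<subseteq> closure X" using F sub by (auto simp: extension_def)
  ultimately show "closedin (top_of_set (closure X)) (F ` C)"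
    using closed_subset by blast
qed

text \<open>An extension makes every line converge at both ends, so loops can be taken as lines with
  one common limit.\<close>

theorem extension_homeomorphic_iff:
  assumes F: "extension F"
  shows "homeomorphic_map (gromov_topology X d b) (top_of_set (closure X)) F \<longleftrightarrow>
    \<not> (\<exists>\<gamma> p. geodesic_on X d UNIV \<gamma> \<and> (\<gamma> \<longlongrightarrow> p) at_top \<and> (\<gamma> \<longlongrightarrow> p) at_bot)" (is "?L \<longleftrightarrow> \<not> ?R")
proof
  assume ?L
  then have inj: "inj_on F (gromov_bar X d)"
    using homeomorphic_imp_injective_map topspace_gromov_topology by metis
  show "\<not> ?R"
  proof
    assume ?R
    then obtain \<gamma> p where \<gamma>: "geodesic_on X d UNIV \<gamma>" and p: "(\<gamma> \<longlongrightarrow> p) at_top" "(\<gamma> \<longlongrightarrow> p) at_bot" by blast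
    have "F (Inr (asymptotic_rel X d `` {\<gamma>})) = p" "F (Inr (asymptotic_rel X d `` {\<lambda>t. \<gamma> (- t)})) = p"
      using tendsto_unique[OF trivial_limit_at_top_linorder extension_along_line(1)[OF F \<gamma>] p(1)]
        tendsto_unique[OF trivial_limit_at_bot_linorder extension_along_line(2)[OF F \<gamma>] p(2)] .
    moreover have "Inr (asymptotic_rel X d `` {\<gamma>}) \<in> gromov_bar X d"
      "Inr (asymptotic_rel X d `` {\<lambda>t. \<gamma> (- t)}) \<in> gromov_bar X d"
      using line_rays[OF \<gamma>] unfolding gromov_bar_def gromov_boundary_def by (auto intro!: InrI quotientI)
    ultimately have "(Inr (asymptotic_rel X d `` {\<gamma>}) :: 'a + (real \<Rightarrow> 'a) set) =
        Inr (asymptotic_rel X d `` {\<lambda>t. \<gamma> (- t)})"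
      by (intro inj_onD[OF inj]) auto
    then show False using line_ends_distinct[OF \<gamma>] by simp
  qed
next
  assume noR: "\<not> ?R"
  \<comment> \<open>Rays leave every ball, so boundary points have images outside \<open>X\<close>;
    a failure of injectivity can therefore only come from two boundary points.\<close>
  have mixed: "F (Inl p) \<noteq> F (Inr \<xi>)" if p: "Inl p \<in> gromov_bar X d" and \<xi>: "Inr \<xi> \<in> gromov_bar X d" for p \<xi>
  proof -
    obtain c where c: "gray c (Inr \<xi>)" using gray_exists[OF \<xi>] by blast
    have "p \<in> X" using p by (auto simp: gromov_bar_def)
    then show ?thesis
      using extension_boundary_notin[OF F gray_Inr(1)[OF c]] gray_Inr(2)[OF c] F by (auto simp: extension_def)
  qed
  have inj: "inj_on F (gromov_bar X d)"
  proof (rule inj_onI)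
    fix x y assume x: "x \<in> gromov_bar X d" and y: "y \<in> gromov_bar X d" and eq: "F x = F y"
    consider p q where "x = Inl p" "y = Inl q" | p \<xi> where "x = Inl p" "y = Inr \<xi>"
      | p \<xi> where "x = Inr \<xi>" "y = Inl p" | \<xi> \<eta> where "x = Inr \<xi>" "y = Inr \<eta>"
      by (cases x; cases y) auto
    then show "x = y"
    proof cases
      case (1 p q)
      then have "p \<in> X" "q \<in> X" using x y by (auto simp: gromov_bar_def)
      then show ?thesis using eq 1 F by (simp add: extension_def)
    next
      case (2 p \<xi>)
      then show ?thesis using mixed[of p \<xi>] x y eq by simp
    next
      case (3 p \<xi>)
      then show ?thesis using mixed[of p \<xi>] x y eq by simp
    next
      case (4 \<xi> \<eta>)
      obtain c1 c2 where c: "gray c1 (Inr \<xi>)" "gray c2 (Inr \<eta>)"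
        using gray_exists x y unfolding 4 by blast
      show ?thesis
      proof (rule ccontr)
        assume "x \<noteq> y"
        then have "\<xi> \<noteq> \<eta>" using 4 by simp
        obtain \<sigma> where \<sigma>: "geodesic_on X d UNIV \<sigma>"
          "asymptotic_rel X d `` {\<lambda>t. \<sigma> (- t)} = \<xi>" "asymptotic_rel X d `` {\<sigma>} = \<eta>"
          by (rule line_between_boundary_points[OF c \<open>\<xi> \<noteq> \<eta>\<close>]) (rule that)
        have "(\<sigma> \<longlongrightarrow> F y) at_top" "(\<sigma> \<longlongrightarrow> F y) at_bot"
          using extension_along_line[OF F \<sigma>(1)] unfolding \<sigma>(2,3) using 4 eq by simp_all
        then show False using noR \<sigma>(1) by blast
      qed
    qed
  qed
  show ?L
    by (rule bijective_closed_imp_homeomorphic_map)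
      (use F inj extension_closed_map[OF F] in \<open>auto simp: extension_def topspace_gromov_topology\<close>)
qed

end


section \<open>Geodesic subspaces\<close>

lemma geodesic_on_superset:
  assumes "S \<subseteq> M"
  shows "geodesic_on S d I \<gamma> \<longleftrightarrow> geodesic_on M d I \<gamma> \<and> \<gamma> ` I \<subseteq> S"
  using assms unfolding geodesic_on_def by blast

text \<open>A geodesic subspace supplies a geodesic on an arbitrary interval, with the two points at
  any times and in either order; it is cut down and reparametrised to start at 0.\<close>

lemma geodesic_on_between_points:
  assumes geo: "geodesic_on M d I \<sigma>" and sub: "\<sigma> ` I \<subseteq> S" and s: "s \<in> I" and t: "t \<in> I"
  shows "\<exists>\<tau>. geodesic_on S d {0..d (\<sigma> s) (\<sigma> t)} \<tau> \<and> \<tau> 0 = \<sigma> s \<and> \<tau> (d (\<sigma> s) (\<sigma> t)) = \<sigma> t"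
proof -
  \<comment> \<open>Direction of travel: -1 runs the geodesic backwards.\<close>
  define e :: real where "e = (if s \<le> t then 1 else - 1)"
  have dist: "d (\<sigma> u) (\<sigma> v) = \<bar>u - v\<bar>" if "u \<in> I" "v \<in> I" for u v
    using geo that unfolding geodesic_on_def by blast
  have "is_interval I" using geo unfolding geodesic_on_def by blast
  then have I: "s + e * u \<in> I" if "u \<in> {0..\<bar>s - t\<bar>}" for u
    using s t that mem_is_interval_1_I[of I s t "s + e * u"] mem_is_interval_1_I[of I t s "s + e * u"]
    by (auto simp: e_def abs_if split: if_splits)
  have "geodesic_on S d {0..\<bar>s - t\<bar>} (\<lambda>u. \<sigma> (s + e * u))"
    unfolding geodesic_on_def
  proof (intro conjI ballI image_subsetI)
    show "\<sigma> (s + e * u) \<in> S" if "u \<in> {0..\<bar>s - t\<bar>}" for u using I[OF that] sub by blast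
    show "d (\<sigma> (s + e * u)) (\<sigma> (s + e * v)) = \<bar>u - v\<bar>" if "u \<in> {0..\<bar>s - t\<bar>}" "v \<in> {0..\<bar>s - t\<bar>}" for u v
      using dist[OF I[OF that(1)] I[OF that(2)]] by (simp add: e_def abs_minus_commute)
  qed (rule is_interval_cc)
  moreover have "s + e * \<bar>s - t\<bar> = t" by (simp add: e_def)
  ultimately show ?thesis
    unfolding dist[OF s t] by (intro exI[of _ "\<lambda>u. \<sigma> (s + e * u)"]) simp
qed

text \<open>The sequence t serves to show that p itself is attained as a limit point.\<close>

lemma limit_points_along_eq:
  assumes lim: "(\<gamma> \<longlongrightarrow> p) F" and p: "p \<in> closure S" and t: "filterlim t F sequentially"
  shows "limit_points_along S F \<gamma> = {p}"
proof (intro equalityI subsetI)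
  fix q assume "q \<in> limit_points_along S F \<gamma>"
  then obtain u :: "nat \<Rightarrow> real" where u: "filterlim u F sequentially" "(\<lambda>n. \<gamma> (u n)) \<longlonglongrightarrow> q"
    by (auto simp: limit_points_along_def)
  show "q \<in> {p}" using LIMSEQ_unique[OF u(2) filterlim_compose[OF lim u(1)]] by simp
next
  fix q assume "q \<in> {p}"
  then show "q \<in> limit_points_along S F \<gamma>"
    using p t filterlim_compose[OF lim t] by (auto simp: limit_points_along_def)
qed

context bounded_submanifold
begin

lemma geodesic_subspace_embedded:
  assumes S: "geodesic_subspace M S" and hyp: "gromov_hyperbolic S (kobayashi_dist M)" and b: "b \<in> S"
  obtains \<delta> where "embedded_hyperbolic_space S (kobayashi_dist M) b \<delta>"
proof -
  let ?d = "kobayashi_dist M"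
  have sub: "S \<subseteq> M" using S by (simp add: geodesic_subspace_def)
  interpret S: Metric_space S ?d by (rule subspace[OF sub])
  have complete: "S.mcomplete" using S by (simp add: geodesic_subspace_def)
  have lim_iff: "limitin S.mtopology s x sequentially \<longleftrightarrow> s \<longlonglongrightarrow> x" if "\<And>n. s n \<in> S" "x \<in> S" for s x
  proof -
    have inM: "\<And>n. s n \<in> M" "x \<in> M" using that sub by auto
    show ?thesis
      unfolding limitin_kobayashi_iff[OF inM, symmetric]
      using that inM by (simp add: S.limitin_metric_dist_null limitin_metric_dist_null)
  qed
  have geod: "\<exists>\<tau>. geodesic_on S ?d {0..?d x y} \<tau> \<and> \<tau> 0 = x \<and> \<tau> (?d x y) = y"
    if x: "x \<in> S" and y: "y \<in> S" for x y
  \<comment> \<open>A geodesic is provided for distinct points only; equal points get a constant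
    path on a degenerate interval.\<close>
  proof (cases "x = y")
    case True
    then show ?thesis using x is_interval_cc[of 0 "0 :: real"]
      by (intro exI[of _ "\<lambda>_. x"]) (auto simp: geodesic_on_def)
  next
    case False
    then obtain I \<sigma> where "geodesic_on M ?d I \<sigma>" "x \<in> \<sigma> ` I" "y \<in> \<sigma> ` I" "\<sigma> ` I \<subseteq> S"
      using S x y unfolding geodesic_subspace_def by blast
    then show ?thesis using geodesic_on_between_points by blast
  qed
  \<comment> \<open>A small Kobayashi ball lies in a compact piece of \<open>M\<close>. A
    subsequence converges in \<open>M\<close>, hence is Cauchy, and completeness of \<open>S\<close>
    places its limit in \<open>S\<close>.\<close>
  have local_compact: "\<exists>\<rho>>0. compactin S.mtopology (S.mcball x \<rho>)" if x: "x \<in> S" for x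
  proof -
    obtain r where r: "r > 0" "compact (cball x r \<inter> M)"
      by (rule submanifold_locally_compact[OF embedded]) (use x sub in auto)
    obtain C where C: "C > 0" "\<And>x y. x \<in> M \<Longrightarrow> y \<in> M \<Longrightarrow> norm (x - y) \<le> C * ?d x y"
      by (rule norm_le_kobayashi_dist) (rule that)
    \<comment> \<open>Since the Euclidean distance is at most C times the Kobayashi distance, radius
      \<open>r / C\<close> stays inside the Euclidean ball of radius r.\<close>
    have "compactin S.mtopology (S.mcball x (r / C))"
      unfolding S.compactin_sequentially
    proof (intro conjI allI impI)
      fix s :: "nat \<Rightarrow> complex ^ 'd" assume "range s \<subseteq> S.mcball x (r / C)"
      then have "s n \<in> S.mcball x (r / C)" for n by (rule range_subsetD)
      then have s: "s n \<in> S" "?d x (s n) \<le> r / C" for n by simp_all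
      have "s n \<in> cball x r \<inter> M" for n
      proof -
        have "norm (x - s n) \<le> C * ?d x (s n)" using C(2) x s(1) sub by blast
        also have "\<dots> \<le> C * (r / C)" using s(2) C(1) by (intro mult_left_mono) auto
        finally show ?thesis using s(1) sub C(1) by (auto simp: dist_norm)
      qed
      then obtain l q where l: "l \<in> M" and q: "strict_mono (q :: nat \<Rightarrow> nat)" "(s \<circ> q) \<longlonglongrightarrow> l"
        using r(2) unfolding compact_def by blast
      have sM: "(s \<circ> q) n \<in> M" for n using s(1) sub by auto
      have "MCauchy (s \<circ> q)"
        using limitin_kobayashi_iff[of "s \<circ> q" l, OF sM l] q(2)
        by (intro convergent_imp_MCauchy[of "s \<circ> q" l] image_subsetI sM) simp
      then have "S.MCauchy (s \<circ> q)" using s(1) by (auto simp: MCauchy_def S.MCauchy_def)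
      then obtain l' where lim: "limitin S.mtopology (s \<circ> q) l' sequentially"
        using complete unfolding S.mcomplete_def by blast
      then have l': "l' \<in> S" "(\<lambda>n. ?d (s (q n)) l') \<longlonglongrightarrow> 0" by (auto simp: S.limitin_metric_dist_null)
      have "?d x l' \<le> r / C"
        by (rule tendsto_upperbound[OF S.tendsto_mdist[of "\<lambda>n. x" "\<lambda>n. s (q n)" x l' sequentially]])
          (use x s l' in auto)
      then show "\<exists>l q. l \<in> S.mcball x (r / C) \<and> strict_mono (q :: nat \<Rightarrow> nat) \<and> limitin S.mtopology (s \<circ> q) l sequentially"
        using lim q(1) x l'(1) by auto
    qed (rule S.mcball_subset_mspace)
    then show ?thesis using r(1) C(1) by (intro exI[of _ "r / C"]) simp
  qed
  have proper: "compactin S.mtopology (S.mcball x r)" if "x \<in> S" for x r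
  proof (rule S.Hopf_Rinow[OF complete local_compact _ that])
    fix x y t assume "x \<in> S" "y \<in> S" "0 \<le> t" "t \<le> ?d x y"
    then obtain \<tau> where "geodesic_on S ?d {0..?d x y} \<tau>" "\<tau> 0 = x" "\<tau> (?d x y) = y"
      using geod by blast
    moreover have "\<tau> t \<in> S" "?d (\<tau> 0) (\<tau> t) = \<bar>0 - t\<bar>" "?d (\<tau> t) (\<tau> (?d x y)) = \<bar>t - ?d x y\<bar>"
      using calculation(1) \<open>0 \<le> t\<close> \<open>t \<le> ?d x y\<close> unfolding geodesic_on_def image_subset_iff by simp_all
    ultimately show "\<exists>z\<in>S. ?d x z = t \<and> ?d z y = ?d x y - t"
      using \<open>0 \<le> t\<close> \<open>t \<le> ?d x y\<close> by (intro bexI[of _ "\<tau> t"]) simp_all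
  qed
  obtain \<delta> where \<delta>: "\<delta> \<ge> 0" "\<forall>w\<in>S. \<forall>x\<in>S. \<forall>y\<in>S. \<forall>z\<in>S.
        gromov_product ?d w x z \<ge> min (gromov_product ?d w x y) (gromov_product ?d w y z) - \<delta>"
    using hyp unfolding gromov_hyperbolic_def by blast
  have "embedded_hyperbolic_space S ?d b \<delta>"
  proof unfold_locales
    show "bounded S" using bounded sub bounded_subset by blast
    show "compactin S.mtopology (S.mcball x r)" if "x \<in> S" for x r using proper[OF that] .
  qed (use b geod \<delta> lim_iff in blast)+
  then show thesis by (rule that)
qed

end

theorem theorem1p9:
  fixes M S :: "(complex ^ 'd) set" and b :: "complex ^ 'd"
  assumes "bounded M" and "connected M" and "embedded_complex_submanifold M"
    and "geodesic_subspace M S"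
    and "gromov_hyperbolic S (kobayashi_dist M)"
    and "b \<in> S"
  shows "(visibility_subspace M S \<longleftrightarrow> (\<exists>F. extends_identity M S b F)) \<and>
         (\<forall>F. extends_identity M S b F \<longrightarrow>
            (homeomorphic_map (gromov_topology S (kobayashi_dist M) b)
                              (top_of_set (closure S)) F
             \<longleftrightarrow> \<not> (\<exists>\<gamma>. geodesic_loop M S \<gamma>)))"
proof -
  interpret M: bounded_submanifold M by unfold_locales (fact assms)+
  obtain \<delta> where "embedded_hyperbolic_space S (kobayashi_dist M) b \<delta>"
    by (rule M.geodesic_subspace_embedded[OF assms(4-6)])
  then interpret S: embedded_hyperbolic_space S "kobayashi_dist M" b \<delta> .
  have sub: "S \<subseteq> M" using assms(4) by (simp add: geodesic_subspace_def)
  have ext: "extends_identity M S b F \<longleftrightarrow> S.extension F" for F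
    by (simp add: extends_identity_def S.extension_def)
  \<comment> \<open>Geodesics of \<open>M\<close> with image in \<open>S\<close> are exactly the
    geodesics of \<open>S\<close>, which also absorbs the intersections of U and V with
    \<open>S\<close>.\<close>
  have "(\<forall>\<gamma> s t. s \<le> t \<longrightarrow> geodesic_on M (kobayashi_dist M) {s..t} \<gamma> \<longrightarrow> \<gamma> ` {s..t} \<subseteq> S \<longrightarrow>
              \<gamma> s \<in> U \<inter> S \<longrightarrow> \<gamma> t \<in> V \<inter> S \<longrightarrow> \<gamma> ` {s..t} \<inter> K \<noteq> {}) \<longleftrightarrow>
        (\<forall>\<gamma> s t. s \<le> t \<longrightarrow> geodesic_on S (kobayashi_dist M) {s..t} \<gamma> \<longrightarrow> \<gamma> s \<in> U \<longrightarrow> \<gamma> t \<in> V \<longrightarrow>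
              \<gamma> ` {s..t} \<inter> K \<noteq> {})" for U V K
    unfolding geodesic_on_superset[OF sub] by (auto simp: image_subset_iff)
  then have vis: "visibility_subspace M S \<longleftrightarrow> S.visible"
    using assms(4) by (simp add: visibility_subspace_def S.visible_def)
  \<comment> \<open>Given an extension, both ends of a line converge, so the two sets of limit
    points are singletons and their equality becomes equality of the two limits.\<close>
  have loop: "geodesic_loop M S \<gamma> \<longleftrightarrow> geodesic_on S (kobayashi_dist M) UNIV \<gamma> \<and>
      (\<exists>p. (\<gamma> \<longlongrightarrow> p) at_top \<and> (\<gamma> \<longlongrightarrow> p) at_bot)" if F: "S.extension F" for F \<gamma>
  proof (cases "geodesic_on S (kobayashi_dist M) UNIV \<gamma>")
    case True
    have "\<gamma> t \<in> closure S" for t using True closure_subset[of S] by (auto simp: geodesic_on_def)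
    then have cl: "p \<in> closure S" if "(\<gamma> \<longlongrightarrow> p) G" "G \<noteq> bot" for p G
      by (intro Lim_in_closed_set[OF closed_closure _ that(2,1)] always_eventually allI)
    obtain p q where p: "(\<gamma> \<longlongrightarrow> p) at_top" and q: "(\<gamma> \<longlongrightarrow> q) at_bot"
      using S.extension_along_line[OF F True] by blast
    have bot: "filterlim (\<lambda>n. - real n) at_bot sequentially"
      using filterlim_real_sequentially by (simp add: filterlim_uminus_at_bot)
    have "geodesic_loop M S \<gamma> \<longleftrightarrow> p = q"
      using limit_points_along_eq[OF p cl[OF p] filterlim_real_sequentially]
        limit_points_along_eq[OF q cl[OF q] bot] True by (simp add: geodesic_loop_def)
    moreover have "(\<exists>p. (\<gamma> \<longlongrightarrow> p) at_top \<and> (\<gamma> \<longlongrightarrow> p) at_bot) \<longleftrightarrow> p = q"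
      using p q tendsto_unique[OF trivial_limit_at_top_linorder p] tendsto_unique[OF trivial_limit_at_bot_linorder q]
      by metis
    ultimately show ?thesis using True by simp
  qed (simp add: geodesic_loop_def)
  show ?thesis
  proof (intro conjI allI impI)
    show "visibility_subspace M S \<longleftrightarrow> (\<exists>F. extends_identity M S b F)"
      unfolding vis ext using S.extension_of_visible S.visible_of_extension by blast
    fix F assume "extends_identity M S b F"
    then have F: "S.extension F" by (simp add: ext)
    show "homeomorphic_map (gromov_topology S (kobayashi_dist M) b) (top_of_set (closure S)) F \<longleftrightarrow>
        \<not> (\<exists>\<gamma>. geodesic_loop M S \<gamma>)"
      unfolding S.extension_homeomorphic_iff[OF F] loop[OF F] by blast
  qed
qed

end
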